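(* Let $\mathfrak{g}$ be a finite-dimensional Lie algebra over a field $\mathbb{K}$ and let $\Omega$ be a differential envelope, that is, $\Omega=\Omega(\mathcal{A})$ for some unital associative algebra $\mathcal{A}$ over $\mathbb{K}$. Then every operation $X\mapsto i_X$ of the Lie algebra $\mathfrak{g}$ in $\Omega$ has a unique extension to an operation $h\mapsto i_h$ of the Hopf algebra $U(\mathfrak{g})$ in $\Omega$.
   Context: Algebras are unital associative over $\mathbb{K}$; graded algebras are $\mathbb{N}$-graded; a graded differential algebra is a graded algebra with a differential $d$ (graded derivation of degree $1$ with $d^2=0$), no graded commutativity assumed. $\Omega(\mathcal{A})$ denotes the universal differential calculus (differential envelope) over $\mathcal{A}$: the graded differential algebra with $\Omega^0(\mathcal{A})=\mathcal{A}$ such that every unital algebra homomorphism from $\mathcal{A}$ into the degree-$0$ part of a graded differential algebra extends uniquely to a homomorphism of graded differential algebras on $\Omega(\mathcal{A})$. Operation of a Lie algebra: an operation of $\mathfrak{g}$ in $\Omega$ is a linear map $X\mapsto i_X$ from $\mathfrak{g}$ into the space of antiderivations of degree $-1$ of $\Omega$ (linear maps $\delta$ homogeneous of degree $-1$ with $\delta(\alpha\beta)=\delta(\alpha)\beta+(-1)^a\alpha\delta(\beta)$ for $\alpha\in\Omega^a$, $\beta\in\Omega$) such that, with $L_X=i_Xd+di_X$, $[i_X,L_Y]=i_{[X,Y]}$ for all $X,Y\in\mathfrak{g}$. Operation of a Hopf algebra: let $\mathcal{H}$ be a Hopf algebra over $\mathbb{K}$ with coproduct $\Delta$, counit $\varepsilon$,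 antipode $S$, Sweedler notation $\Delta h=\sum_j h^{(1)}_j\otimes h^{(2)}_j$, and right adjoint action $\mathrm{ad}(h)g=\sum_j S(h^{(1)}_j)gh^{(2)}_j$. An operation of $\mathcal{H}$ in $\Omega$ is a linear map $h\mapsto i_h$ from $\mathcal{H}$ into the linear endomorphisms of $\Omega$ homogeneous of degree $-1$ with $i_1=0$ and such that, setting $L_h=di_h+i_hd+\varepsilon(h)I_\Omega$, one has for all $g,h\in\mathcal{H}$: (i) $i_h(\alpha\beta)=\sum_j i_{h^{(1)}_j}(\alpha)L_{h^{(2)}_j}(\beta)+(-1)^a\alpha\, i_h(\beta)$ for $\alpha\in\Omega^a$, $\beta\in\Omega$; (ii) $i_gL_h=\sum_j L_{h^{(1)}_j}i_{\mathrm{ad}(h^{(2)}_j)g}$; (iii) $L_hL_g=L_{hg}$. $U(\mathfrak{g})$ is the universal enveloping algebra with its standard Hopf algebra structure, for which $\Delta X=X\otimes 1+1\otimes X$, $\varepsilon(X)=0$, $S(X)=-X$ for $X\in\mathfrak{g}$. The restriction to $\mathfrak{g}\subset U(\mathfrak{g})$ of an operation of $U(\mathfrak{g})$ is an operation of $\mathfrak{g}$; "extension" refers to this restriction. *)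

theory Defs
  imports "HOL-Algebra.Module"
begin

section \<open>Linear maps and algebras over a field\<close>

definition lin_map ::
  "'k ring \<Rightarrow> ('k, 'a, 'm) module_scheme \<Rightarrow> ('k, 'b, 'n) module_scheme \<Rightarrow> ('a \<Rightarrow> 'b) \<Rightarrow> bool" where
  "lin_map K M N f \<longleftrightarrow>
     f \<in> carrier M \<rightarrow> carrier N \<and>
     (\<forall>x\<in>carrier M. \<forall>y\<in>carrier M. f (x \<oplus>\<^bsub>M\<^esub> y) = f x \<oplus>\<^bsub>N\<^esub> f y) \<and>
     (\<forall>c\<in>carrier K. \<forall>x\<in>carrier M. f (c \<odot>\<^bsub>M\<^esub> x) = c \<odot>\<^bsub>N\<^esub> f x)"

definition finite_dim :: "'k ring \<Rightarrow> ('k, 'a, 'm) module_scheme \<Rightarrow> bool" where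
  "finite_dim K M \<longleftrightarrow>
     (\<exists>B. finite B \<and> B \<subseteq> carrier M \<and>
       (\<forall>x\<in>carrier M. \<exists>c \<in> B \<rightarrow> carrier K. x = (\<Oplus>\<^bsub>M\<^esub>b\<in>B. c b \<odot>\<^bsub>M\<^esub> b)))"

text \<open>Unital associative algebras.  The library locale \<^locale>\<open>algebra\<close> is restricted to
  commutative ones.  The zero algebra is allowed.\<close>

locale assoc_algebra = K?: field K + module K A + A?: ring A
  for K :: "'k ring" (structure) and A :: "('k, 'a, 'm) module_scheme" (structure) +
  assumes smult_mult_left:
      "\<lbrakk>c \<in> carrier K; x \<in> carrier A; y \<in> carrier A\<rbrakk>
        \<Longrightarrow> (c \<odot>\<^bsub>A\<^esub> x) \<otimes>\<^bsub>A\<^esub> y = c \<odot>\<^bsub>A\<^esub> (x \<otimes>\<^bsub>A\<^esub> y)"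
    and smult_mult_right:
      "\<lbrakk>c \<in> carrier K; x \<in> carrier A; y \<in> carrier A\<rbrakk>
        \<Longrightarrow> x \<otimes>\<^bsub>A\<^esub> (c \<odot>\<^bsub>A\<^esub> y) = c \<odot>\<^bsub>A\<^esub> (x \<otimes>\<^bsub>A\<^esub> y)"

definition alg_hom ::
  "'k ring \<Rightarrow> ('k, 'a, 'm) module_scheme \<Rightarrow> ('k, 'b, 'n) module_scheme \<Rightarrow> ('a \<Rightarrow> 'b) \<Rightarrow> bool" where
  "alg_hom K A B f \<longleftrightarrow> f \<in> ring_hom A B \<and> lin_map K A B f"


section \<open>Graded differential algebras\<close>

record ('k, 'w) gda = "('k, 'w) module" +
  gcomp :: "nat \<Rightarrow> 'w set"
  gdiff :: "'w \<Rightarrow> 'w"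

definition sign_pow :: "('w, 'm) ring_scheme \<Rightarrow> nat \<Rightarrow> 'w \<Rightarrow> 'w" where
  "sign_pow M n x = (if even n then x else \<ominus>\<^bsub>M\<^esub> x)"

locale graded_diff_algebra = assoc_algebra K \<Omega>
  for K :: "'k ring" and \<Omega> :: "('k, 'w) gda" +
  assumes gcomp_submodule: "submodule (gcomp \<Omega> n) K \<Omega>"
    and gcomp_direct_sum: "x \<in> carrier \<Omega> \<Longrightarrow>
      \<exists>!c. (\<forall>n. c n \<in> gcomp \<Omega> n) \<and> finite {n. c n \<noteq> \<zero>\<^bsub>\<Omega>\<^esub>} \<and>
           x = (\<Oplus>\<^bsub>\<Omega>\<^esub>n\<in>{n. c n \<noteq> \<zero>\<^bsub>\<Omega>\<^esub>}. c n)"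
    and gcomp_one: "\<one>\<^bsub>\<Omega>\<^esub> \<in> gcomp \<Omega> 0"
    and gcomp_mult: "\<lbrakk>x \<in> gcomp \<Omega> m; y \<in> gcomp \<Omega> n\<rbrakk> \<Longrightarrow> x \<otimes>\<^bsub>\<Omega>\<^esub> y \<in> gcomp \<Omega> (m + n)"
    and gdiff_linear: "lin_map K \<Omega> \<Omega> (gdiff \<Omega>)"
    and gdiff_degree: "x \<in> gcomp \<Omega> n \<Longrightarrow> gdiff \<Omega> x \<in> gcomp \<Omega> (Suc n)"
    and gdiff_leibniz: "\<lbrakk>x \<in> gcomp \<Omega> n; y \<in> carrier \<Omega>\<rbrakk> \<Longrightarrow>
      gdiff \<Omega> (x \<otimes>\<^bsub>\<Omega>\<^esub> y) =
        gdiff \<Omega> x \<otimes>\<^bsub>\<Omega>\<^esub> y \<oplus>\<^bsub>\<Omega>\<^esub> sign_pow \<Omega> n (x \<otimes>\<^bsub>\<Omega>\<^esub> gdiff \<Omega> y)"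
    and gdiff_gdiff: "x \<in> carrier \<Omega> \<Longrightarrow> gdiff \<Omega> (gdiff \<Omega> x) = \<zero>\<^bsub>\<Omega>\<^esub>"

definition gda_hom :: "'k ring \<Rightarrow> ('k, 'v) gda \<Rightarrow> ('k, 'w) gda \<Rightarrow> ('v \<Rightarrow> 'w) \<Rightarrow> bool" where
  "gda_hom K \<Omega> \<Omega>' f \<longleftrightarrow>
     alg_hom K \<Omega> \<Omega>' f \<and>
     (\<forall>n. f ` gcomp \<Omega> n \<subseteq> gcomp \<Omega>' n) \<and>
     (\<forall>x\<in>carrier \<Omega>. f (gdiff \<Omega> x) = gdiff \<Omega>' (f x))"

definition degree_minus_one :: "('k, 'w) gda \<Rightarrow> ('w \<Rightarrow> 'w) \<Rightarrow> bool" where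
  "degree_minus_one \<Omega> f \<longleftrightarrow>
     f ` gcomp \<Omega> 0 \<subseteq> {\<zero>\<^bsub>\<Omega>\<^esub>} \<and> (\<forall>n. f ` gcomp \<Omega> (Suc n) \<subseteq> gcomp \<Omega> n)"

definition antiderivation_minus_one :: "'k ring \<Rightarrow> ('k, 'w) gda \<Rightarrow> ('w \<Rightarrow> 'w) \<Rightarrow> bool" where
  "antiderivation_minus_one K \<Omega> f \<longleftrightarrow>
     lin_map K \<Omega> \<Omega> f \<and> degree_minus_one \<Omega> f \<and>
     (\<forall>n. \<forall>\<alpha>\<in>gcomp \<Omega> n. \<forall>\<beta>\<in>carrier \<Omega>.
       f (\<alpha> \<otimes>\<^bsub>\<Omega>\<^esub> \<beta>) = f \<alpha> \<otimes>\<^bsub>\<Omega>\<^esub> \<beta> \<oplus>\<^bsub>\<Omega>\<^esub> sign_pow \<Omega> n (\<alpha> \<otimes>\<^bsub>\<Omega>\<^esub> f \<beta>))"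


section \<open>Universal objects\<close>

text \<open>Universal properties quantify over all target objects, which HOL permits only for targets
  whose carrier is a set of elements of one given type.  The two predicates of this section
  therefore carry a type argument \<open>'c\<close>: the universal property is required for all targets with
  carrier in \<open>'c\<close>.  The property for targets in arbitrary types implies the one for
  any particular \<open>'c\<close>, so a theorem that assumes it for one \<open>'c\<close> applies to every
  genuine universal object.

  \<open>('u, 'w) universe\<close> consists of the sets of words in elements of \<open>'u\<close> and \<open>'w\<close>.  Functions
  from \<open>'u\<close> or \<open>'w\<close> to tuples over \<open>'w\<close> embed in it, as graphs.\<close>

type_synonym ('u, 'w) universe = "('u + 'w) list set"

text \<open>The map \<open>\<iota>\<close> is the identification of \<open>A\<close> with the degree-zero part.\<close>

definition differential_envelope ::
  "'c itself \<Rightarrow> 'k ring \<Rightarrow> ('k, 'a) module \<Rightarrow> ('k, 'w) gda \<Rightarrow> ('a \<Rightarrow> 'w) \<Rightarrow> bool" where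
  "differential_envelope T K A \<Omega> \<iota> \<longleftrightarrow>
     assoc_algebra K A \<and> graded_diff_algebra K \<Omega> \<and>
     alg_hom K A \<Omega> \<iota> \<and> bij_betw \<iota> (carrier A) (gcomp \<Omega> 0) \<and>
     (\<forall>(B :: ('k, 'c) gda) \<phi>.
       graded_diff_algebra K B \<and> alg_hom K A B \<phi> \<and> \<phi> ` carrier A \<subseteq> gcomp B 0 \<longrightarrow>
       (\<exists>\<Phi>. gda_hom K \<Omega> B \<Phi> \<and> (\<forall>a\<in>carrier A. \<Phi> (\<iota> a) = \<phi> a) \<and>
         (\<forall>\<Psi>. gda_hom K \<Omega> B \<Psi> \<and> (\<forall>a\<in>carrier A. \<Psi> (\<iota> a) = \<phi> a) \<longrightarrow>
              (\<forall>x\<in>carrier \<Omega>. \<Psi> x = \<Phi> x))))"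

record ('k, 'g) lie_alg = "('k, 'g) module" +
  bracket :: "'g \<Rightarrow> 'g \<Rightarrow> 'g"

locale lie_algebra = K?: field K + module K G
  for K :: "'k ring" and G :: "('k, 'g) lie_alg" +
  assumes bracket_linear_left: "y \<in> carrier G \<Longrightarrow> lin_map K G G (\<lambda>x. bracket G x y)"
    and bracket_linear_right: "x \<in> carrier G \<Longrightarrow> lin_map K G G (bracket G x)"
    and bracket_self: "x \<in> carrier G \<Longrightarrow> bracket G x x = \<zero>\<^bsub>G\<^esub>"
    and jacobi: "\<lbrakk>x \<in> carrier G; y \<in> carrier G; z \<in> carrier G\<rbrakk> \<Longrightarrow>
      bracket G x (bracket G y z) \<oplus>\<^bsub>G\<^esub> bracket G y (bracket G z x)
        \<oplus>\<^bsub>G\<^esub> bracket G z (bracket G x y) = \<zero>\<^bsub>G\<^esub>"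

definition lie_to_alg_hom ::
  "'k ring \<Rightarrow> ('k, 'g) lie_alg \<Rightarrow> ('k, 'b, 'n) module_scheme \<Rightarrow> ('g \<Rightarrow> 'b) \<Rightarrow> bool" where
  "lie_to_alg_hom K G B \<phi> \<longleftrightarrow>
     lin_map K G B \<phi> \<and>
     (\<forall>x\<in>carrier G. \<forall>y\<in>carrier G.
       \<phi> (bracket G x y) = (\<phi> x \<otimes>\<^bsub>B\<^esub> \<phi> y) \<ominus>\<^bsub>B\<^esub> (\<phi> y \<otimes>\<^bsub>B\<^esub> \<phi> x))"

definition universal_enveloping_algebra ::
  "'c itself \<Rightarrow> 'k ring \<Rightarrow> ('k, 'g) lie_alg \<Rightarrow> ('k, 'u, 'n) module_scheme \<Rightarrow> ('g \<Rightarrow> 'u) \<Rightarrow> bool" where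
  "universal_enveloping_algebra T K G U j \<longleftrightarrow>
     assoc_algebra K U \<and> lie_to_alg_hom K G U j \<and>
     (\<forall>(B :: ('k, 'c) module) \<phi>.
       assoc_algebra K B \<and> lie_to_alg_hom K G B \<phi> \<longrightarrow>
       (\<exists>\<Phi>. alg_hom K U B \<Phi> \<and> (\<forall>x\<in>carrier G. \<Phi> (j x) = \<phi> x) \<and>
         (\<forall>\<Psi>. alg_hom K U B \<Psi> \<and> (\<forall>x\<in>carrier G. \<Psi> (j x) = \<phi> x) \<longrightarrow>
              (\<forall>u\<in>carrier U. \<Psi> u = \<Phi> u))))"


section \<open>Tensors and Hopf algebras\<close>

text \<open>A word \<open>[x\<^sub>1, \<dots>, x\<^sub>n]\<close> stands for the pure tensor \<open>x\<^sub>1 \<otimes> \<dots> \<otimes> x\<^sub>n\<close> and a list of words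
  for the sum of its entries.  Two such formal sums are related iff they denote the same
  element of the tensor power; the rules are those that define it as a quotient of the free
  commutative monoid on pure tensors (negatives exist because of the zero rule).\<close>

inductive tensor_eq ::
  "'k ring \<Rightarrow> ('k, 'a, 'm) module_scheme \<Rightarrow> 'a list list \<Rightarrow> 'a list list \<Rightarrow> bool"
  for K :: "'k ring" and M :: "('k, 'a, 'm) module_scheme" where
  tensor_refl: "s \<in> lists (lists (carrier M)) \<Longrightarrow> tensor_eq K M s s"
| tensor_sym: "tensor_eq K M s t \<Longrightarrow> tensor_eq K M t s"
| tensor_trans: "\<lbrakk>tensor_eq K M s t; tensor_eq K M t r\<rbrakk> \<Longrightarrow> tensor_eq K M s r"
| tensor_append: "\<lbrakk>tensor_eq K M s s'; tensor_eq K M t t'\<rbrakk> \<Longrightarrow> tensor_eq K M (s @ t) (s' @ t')"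
| tensor_comm: "\<lbrakk>s \<in> lists (lists (carrier M)); t \<in> lists (lists (carrier M))\<rbrakk>
    \<Longrightarrow> tensor_eq K M (s @ t) (t @ s)"
| tensor_add: "\<lbrakk>p \<in> lists (carrier M); x \<in> carrier M; y \<in> carrier M; q \<in> lists (carrier M)\<rbrakk>
    \<Longrightarrow> tensor_eq K M [p @ (x \<oplus>\<^bsub>M\<^esub> y) # q] [p @ x # q, p @ y # q]"
| tensor_zero: "\<lbrakk>p \<in> lists (carrier M); q \<in> lists (carrier M)\<rbrakk>
    \<Longrightarrow> tensor_eq K M [p @ \<zero>\<^bsub>M\<^esub> # q] []"
| tensor_smult: "\<lbrakk>c \<in> carrier K; p \<in> lists (carrier M); x \<in> carrier M; q \<in> lists (carrier M);
      y \<in> carrier M; r \<in> lists (carrier M)\<rbrakk>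
    \<Longrightarrow> tensor_eq K M [p @ (c \<odot>\<^bsub>M\<^esub> x) # q @ y # r] [p @ x # q @ (c \<odot>\<^bsub>M\<^esub> y) # r]"

abbreviation pair_words :: "('a \<times> 'a) list \<Rightarrow> 'a list list" where
  "pair_words s \<equiv> map (\<lambda>(x, y). [x, y]) s"

definition tensor_sum :: "('b, 'n) ring_scheme \<Rightarrow> ('a \<Rightarrow> 'a \<Rightarrow> 'b) \<Rightarrow> ('a \<times> 'a) list \<Rightarrow> 'b" where
  "tensor_sum N f s = foldr (\<lambda>(x, y) r. f x y \<oplus>\<^bsub>N\<^esub> r) s \<zero>\<^bsub>N\<^esub>"

lemma tensor_sum_cong:
  assumes M: "module K M" and N: "abelian_group N"
    and closed: "\<And>x y. \<lbrakk>x \<in> carrier M; y \<in> carrier M\<rbrakk> \<Longrightarrow> f x y \<in> carrier N"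
    and add1: "\<And>x x' y. \<lbrakk>x \<in> carrier M; x' \<in> carrier M; y \<in> carrier M\<rbrakk>
      \<Longrightarrow> f (x \<oplus>\<^bsub>M\<^esub> x') y = f x y \<oplus>\<^bsub>N\<^esub> f x' y"
    and add2: "\<And>x y y'. \<lbrakk>x \<in> carrier M; y \<in> carrier M; y' \<in> carrier M\<rbrakk>
      \<Longrightarrow> f x (y \<oplus>\<^bsub>M\<^esub> y') = f x y \<oplus>\<^bsub>N\<^esub> f x y'"
    and balanced: "\<And>c x y. \<lbrakk>c \<in> carrier K; x \<in> carrier M; y \<in> carrier M\<rbrakk>
      \<Longrightarrow> f (c \<odot>\<^bsub>M\<^esub> x) y = f x (c \<odot>\<^bsub>M\<^esub> y)"
    and eq: "tensor_eq K M (pair_words s) (pair_words t)"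
  shows "tensor_sum N f s = tensor_sum N f t"
proof -
  interpret M: module K M by (rule M)
  interpret N: abelian_group N by (rule N)
  define ev where "ev = (\<lambda>w. if length w = 2 then f (w ! 0) (w ! 1) else \<zero>\<^bsub>N\<^esub>)"
  define es where "es = (\<lambda>s. foldr (\<lambda>w r. ev w \<oplus>\<^bsub>N\<^esub> r) s \<zero>\<^bsub>N\<^esub>)"
  have ev_closed: "ev w \<in> carrier N" if "w \<in> lists (carrier M)" for w
    using that closed by (auto simp: ev_def in_lists_conv_set)
  have es_closed: "es u \<in> carrier N" if "u \<in> lists (lists (carrier M))" for u
    using that by (induction u) (auto simp: es_def ev_closed)
  have es_append: "es (u @ v) = es u \<oplus>\<^bsub>N\<^esub> es v"
    if "u \<in> lists (lists (carrier M))" "v \<in> lists (lists (carrier M))" for u v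
    using that
  proof (induction u)
    case Nil
    then show ?case using es_closed[of v] by (simp add: es_def)
  next
    case (Cons w u)
    then have w: "ev w \<in> carrier N" and u: "es u \<in> carrier N" and v: "es v \<in> carrier N"
      using ev_closed es_closed by auto
    have "es ((w # u) @ v) = ev w \<oplus>\<^bsub>N\<^esub> es (u @ v)" "es (w # u) = ev w \<oplus>\<^bsub>N\<^esub> es u"
      by (simp_all add: es_def)
    then show ?case using Cons w u v by (simp add: N.a_assoc)
  qed
  have zero1: "f \<zero>\<^bsub>M\<^esub> y = \<zero>\<^bsub>N\<^esub>" if "y \<in> carrier M" for y
    using add1[of "\<zero>\<^bsub>M\<^esub>" "\<zero>\<^bsub>M\<^esub>" y] closed[of "\<zero>\<^bsub>M\<^esub>" y] that by simp
  have zero2: "f x \<zero>\<^bsub>M\<^esub> = \<zero>\<^bsub>N\<^esub>" if "x \<in> carrier M" for x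
    using add2[of x "\<zero>\<^bsub>M\<^esub>" "\<zero>\<^bsub>M\<^esub>"] closed[of x "\<zero>\<^bsub>M\<^esub>"] that by simp
  have "u \<in> lists (lists (carrier M)) \<and> v \<in> lists (lists (carrier M)) \<and> es u = es v"
    if "tensor_eq K M u v" for u v
    using that
  proof induction
    case (tensor_append s s' t t')
    then show ?case using es_append by simp
  next
    case (tensor_comm s t)
    then show ?case using es_append es_closed N.a_comm by simp
  next
    case (tensor_add p x y q)
    consider z where "p = []" "q = [z]" | z where "p = [z]" "q = []" | "length p + length q \<noteq> 1"
      by (cases p; cases q) (auto simp: length_Suc_conv)
    then show ?case
      using tensor_add by cases (auto simp: es_def ev_def add1 add2 closed)
  next
    case (tensor_zero p q)
    consider z where "p = []" "q = [z]" | z where "p = [z]" "q = []" | "length p + length q \<noteq> 1"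
      by (cases p; cases q) (auto simp: length_Suc_conv)
    then show ?case
      using tensor_zero by cases (auto simp: es_def ev_def zero1 zero2)
  next
    case (tensor_smult c p x q y r)
    consider "p = []" "q = []" "r = []" | "length p + length q + length r \<noteq> 0"
      by auto
    then show ?case
      using tensor_smult by cases (auto simp: es_def ev_def balanced)
  qed auto
  then have "es (pair_words s) = es (pair_words t)" using eq by blast
  moreover have "es (pair_words u) = tensor_sum N f u" for u
    by (induction u) (auto simp: es_def ev_def tensor_sum_def)
  ultimately show ?thesis by simp
qed

text \<open>\<open>comult H h\<close> lists the pairs of factors of some expression of the coproduct of \<open>h\<close> as
  a sum of pure tensors (Sweedler notation).  The choice is immaterial: the axioms only
  involve it up to equality of tensors, and sums of bilinear terms over it do not depend on it
  by \<open>tensor_sum_cong\<close>.\<close>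

record ('k, 'u) hopf = "('k, 'u) module" +
  comult :: "'u \<Rightarrow> ('u \<times> 'u) list"
  counit :: "'u \<Rightarrow> 'k"
  antipode :: "'u \<Rightarrow> 'u"

locale hopf_algebra = assoc_algebra K H
  for K :: "'k ring" and H :: "('k, 'u) hopf" +
  assumes comult_closed: "h \<in> carrier H \<Longrightarrow> set (comult H h) \<subseteq> carrier H \<times> carrier H"
    and comult_add: "\<lbrakk>g \<in> carrier H; h \<in> carrier H\<rbrakk> \<Longrightarrow>
      tensor_eq K H (pair_words (comult H (g \<oplus>\<^bsub>H\<^esub> h))) (pair_words (comult H g @ comult H h))"
    and comult_smult: "\<lbrakk>c \<in> carrier K; h \<in> carrier H\<rbrakk> \<Longrightarrow>
      tensor_eq K H (pair_words (comult H (c \<odot>\<^bsub>H\<^esub> h)))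
        (pair_words [(c \<odot>\<^bsub>H\<^esub> x, y). (x, y) \<leftarrow> comult H h])"
    and comult_one: "tensor_eq K H (pair_words (comult H \<one>\<^bsub>H\<^esub>)) (pair_words [(\<one>\<^bsub>H\<^esub>, \<one>\<^bsub>H\<^esub>)])"
    and comult_mult: "\<lbrakk>g \<in> carrier H; h \<in> carrier H\<rbrakk> \<Longrightarrow>
      tensor_eq K H (pair_words (comult H (g \<otimes>\<^bsub>H\<^esub> h)))
        (pair_words [(x \<otimes>\<^bsub>H\<^esub> x', y \<otimes>\<^bsub>H\<^esub> y'). (x, y) \<leftarrow> comult H g, (x', y') \<leftarrow> comult H h])"
    and coassoc: "h \<in> carrier H \<Longrightarrow>
      tensor_eq K H
        [[x', x'', y]. (x, y) \<leftarrow> comult H h, (x', x'') \<leftarrow> comult H x]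
        [[x, y', y'']. (x, y) \<leftarrow> comult H h, (y', y'') \<leftarrow> comult H y]"
    and counit_ring_hom: "counit H \<in> ring_hom H K"
    and counit_smult: "\<lbrakk>c \<in> carrier K; h \<in> carrier H\<rbrakk> \<Longrightarrow>
      counit H (c \<odot>\<^bsub>H\<^esub> h) = c \<otimes>\<^bsub>K\<^esub> counit H h"
    and counit_left: "h \<in> carrier H \<Longrightarrow>
      tensor_sum H (\<lambda>x y. counit H x \<odot>\<^bsub>H\<^esub> y) (comult H h) = h"
    and counit_right: "h \<in> carrier H \<Longrightarrow>
      tensor_sum H (\<lambda>x y. counit H y \<odot>\<^bsub>H\<^esub> x) (comult H h) = h"
    and antipode_linear: "lin_map K H H (antipode H)"
    and antipode_left: "h \<in> carrier H \<Longrightarrow>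
      tensor_sum H (\<lambda>x y. antipode H x \<otimes>\<^bsub>H\<^esub> y) (comult H h) = counit H h \<odot>\<^bsub>H\<^esub> \<one>\<^bsub>H\<^esub>"
    and antipode_right: "h \<in> carrier H \<Longrightarrow>
      tensor_sum H (\<lambda>x y. x \<otimes>\<^bsub>H\<^esub> antipode H y) (comult H h) = counit H h \<odot>\<^bsub>H\<^esub> \<one>\<^bsub>H\<^esub>"

definition right_adjoint :: "('k, 'u) hopf \<Rightarrow> 'u \<Rightarrow> 'u \<Rightarrow> 'u" where
  "right_adjoint H h g =
     tensor_sum H (\<lambda>x y. antipode H x \<otimes>\<^bsub>H\<^esub> g \<otimes>\<^bsub>H\<^esub> y) (comult H h)"

definition enveloping_hopf_algebra ::
  "'c itself \<Rightarrow> 'k ring \<Rightarrow> ('k, 'g) lie_alg \<Rightarrow> ('k, 'u) hopf \<Rightarrow> ('g \<Rightarrow> 'u) \<Rightarrow> bool" where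
  "enveloping_hopf_algebra T K G U j \<longleftrightarrow>
     universal_enveloping_algebra T K G U j \<and> hopf_algebra K U \<and>
     (\<forall>X\<in>carrier G.
       tensor_eq K U (pair_words (comult U (j X))) (pair_words [(j X, \<one>\<^bsub>U\<^esub>), (\<one>\<^bsub>U\<^esub>, j X)]) \<and>
       counit U (j X) = \<zero>\<^bsub>K\<^esub> \<and>
       antipode U (j X) = (\<ominus>\<^bsub>U\<^esub> j X))"


section \<open>Operations\<close>

definition lie_der :: "('k, 'w) gda \<Rightarrow> ('g \<Rightarrow> 'w \<Rightarrow> 'w) \<Rightarrow> 'g \<Rightarrow> 'w \<Rightarrow> 'w" where
  "lie_der \<Omega> i X \<alpha> = i X (gdiff \<Omega> \<alpha>) \<oplus>\<^bsub>\<Omega>\<^esub> gdiff \<Omega> (i X \<alpha>)"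

definition lie_operation ::
  "'k ring \<Rightarrow> ('k, 'g) lie_alg \<Rightarrow> ('k, 'w) gda \<Rightarrow> ('g \<Rightarrow> 'w \<Rightarrow> 'w) \<Rightarrow> bool" where
  "lie_operation K G \<Omega> i \<longleftrightarrow>
     (\<forall>X\<in>carrier G. antiderivation_minus_one K \<Omega> (i X)) \<and>
     (\<forall>\<alpha>\<in>carrier \<Omega>. lin_map K G \<Omega> (\<lambda>X. i X \<alpha>)) \<and>
     (\<forall>X\<in>carrier G. \<forall>Y\<in>carrier G. \<forall>\<alpha>\<in>carrier \<Omega>.
       i X (lie_der \<Omega> i Y \<alpha>) \<ominus>\<^bsub>\<Omega>\<^esub> lie_der \<Omega> i Y (i X \<alpha>) = i (bracket G X Y) \<alpha>)"

definition hopf_der ::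
  "('k, 'u) hopf \<Rightarrow> ('k, 'w) gda \<Rightarrow> ('u \<Rightarrow> 'w \<Rightarrow> 'w) \<Rightarrow> 'u \<Rightarrow> 'w \<Rightarrow> 'w" where
  "hopf_der H \<Omega> i h \<alpha> =
     gdiff \<Omega> (i h \<alpha>) \<oplus>\<^bsub>\<Omega>\<^esub> i h (gdiff \<Omega> \<alpha>) \<oplus>\<^bsub>\<Omega>\<^esub> counit H h \<odot>\<^bsub>\<Omega>\<^esub> \<alpha>"

definition hopf_operation ::
  "'k ring \<Rightarrow> ('k, 'u) hopf \<Rightarrow> ('k, 'w) gda \<Rightarrow> ('u \<Rightarrow> 'w \<Rightarrow> 'w) \<Rightarrow> bool" where
  "hopf_operation K H \<Omega> i \<longleftrightarrow>
     (\<forall>h\<in>carrier H. lin_map K \<Omega> \<Omega> (i h) \<and> degree_minus_one \<Omega> (i h)) \<and>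
     (\<forall>\<alpha>\<in>carrier \<Omega>. lin_map K H \<Omega> (\<lambda>h. i h \<alpha>)) \<and>
     (\<forall>\<alpha>\<in>carrier \<Omega>. i \<one>\<^bsub>H\<^esub> \<alpha> = \<zero>\<^bsub>\<Omega>\<^esub>) \<and>
     (\<forall>h\<in>carrier H. \<forall>n. \<forall>\<alpha>\<in>gcomp \<Omega> n. \<forall>\<beta>\<in>carrier \<Omega>.
       i h (\<alpha> \<otimes>\<^bsub>\<Omega>\<^esub> \<beta>) =
         tensor_sum \<Omega> (\<lambda>x y. i x \<alpha> \<otimes>\<^bsub>\<Omega>\<^esub> hopf_der H \<Omega> i y \<beta>) (comult H h)
         \<oplus>\<^bsub>\<Omega>\<^esub> sign_pow \<Omega> n (\<alpha> \<otimes>\<^bsub>\<Omega>\<^esub> i h \<beta>)) \<and>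
     (\<forall>g\<in>carrier H. \<forall>h\<in>carrier H. \<forall>\<alpha>\<in>carrier \<Omega>.
       i g (hopf_der H \<Omega> i h \<alpha>) =
         tensor_sum \<Omega> (\<lambda>x y. hopf_der H \<Omega> i x (i (right_adjoint H y g) \<alpha>)) (comult H h)) \<and>
     (\<forall>g\<in>carrier H. \<forall>h\<in>carrier H. \<forall>\<alpha>\<in>carrier \<Omega>.
       hopf_der H \<Omega> i h (hopf_der H \<Omega> i g \<alpha>) = hopf_der H \<Omega> i (h \<otimes>\<^bsub>H\<^esub> g) \<alpha>)"

definition extends_operation ::
  "('k, 'g) lie_alg \<Rightarrow> ('k, 'w) gda \<Rightarrow> ('g \<Rightarrow> 'u) \<Rightarrow> ('g \<Rightarrow> 'w \<Rightarrow> 'w) \<Rightarrow> ('u \<Rightarrow> 'w \<Rightarrow> 'w) \<Rightarrow> bool" where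
  "extends_operation G \<Omega> j i I \<longleftrightarrow>
     (\<forall>X\<in>carrier G. \<forall>\<alpha>\<in>carrier \<Omega>. I (j X) \<alpha> = i X \<alpha>)"

end

theory Submission
  imports Defs
begin

text \<open>The Lie derivatives \<open>L\<^sub>h\<close> of an operation of \<open>U(g)\<close> represent \<open>U(g)\<close> on \<open>\<Omega>\<close>, by (iii), so they
  are determined by the Lie derivatives \<open>L\<^sub>X\<close> for \<open>X \<in> g\<close>.  The map \<open>i\<^sub>h\<close> vanishes on
  \<open>\<Omega>\<^sup>0 = A\<close> for reasons of degree, the definition of \<open>L\<^sub>h\<close> gives
  \<open>i\<^sub>h(d \<alpha>) = L\<^sub>h \<alpha> - \<epsilon>(h) \<alpha> - d(i\<^sub>h \<alpha>)\<close>, and (i) gives \<open>i\<^sub>h\<close> on products.  As \<open>A\<close>, \<open>d\<close> and products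
  generate the envelope \<open>\<Omega>\<close>, an operation of \<open>U(g)\<close> is determined by its restriction to \<open>g\<close>: this is
  the uniqueness.

  For existence the same formulas have to be consistent.  Linear maps \<open>U(g) \<rightarrow> \<Omega>\<close> (those with values in
  finitely many degrees) form a graded differential algebra \<open>C\<close> under convolution
  \<open>(f * g)(h) = \<Sum> f(h\<^sup>(\<^sup>1\<^sup>)) g(h\<^sup>(\<^sup>2\<^sup>))\<close>, with the differential applied to values.  Both
  \<open>\<phi>(\<alpha>) = (h \<mapsto> \<epsilon>(h) \<alpha>)\<close> and \<open>\<psi>(\<alpha>) = (h \<mapsto> L\<^sub>h \<alpha>)\<close> are morphisms \<open>\<Omega> \<rightarrow> C\<close>.  In these terms (i) says
  that \<open>p(\<alpha>) = (h \<mapsto> i\<^sub>h \<alpha>)\<close> satisfies \<open>p(\<alpha>\<beta>) = p(\<alpha>) \<psi>(\<beta>) \<plusminus> \<phi>(\<alpha>) p(\<beta>)\<close>, and the definition of \<open>L\<^sub>h\<close>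
  says \<open>dp + pd = \<psi> - \<phi>\<close>.  Any two morphisms out of a differential envelope have such a homotopy
  (\<open>gda_hom_homotopy\<close>): upper triangular matrices with diagonal \<open>a, q\<close> and corner \<open>p\<close> over \<open>C\<close>, where the
  corner is shifted by one degree and \<open>d\<close> is perturbed by the commutator with the matrix unit in the
  corner, form a graded differential algebra, and the homomorphism \<open>a \<mapsto> diag(\<phi>(a), \<psi>(a))\<close> on \<open>A\<close>
  extends to \<open>\<Omega>\<close>; the corner of the extension is \<open>p\<close>.

  It remains to check (ii).  For \<open>h = X \<in> g\<close> it reads \<open>i\<^sub>u L\<^sub>X = L\<^sub>X i\<^sub>u + i\<^sub>[\<^sub>u\<^sub>,\<^sub>X\<^sub>]\<close> with \<open>u \<in> U(g)\<close>, which follows by induction over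
  \<open>\<Omega>\<close> (\<open>I_L\<close>).  The general case follows by induction on \<open>h\<close>, multiplying by elements \<open>X\<close> of \<open>g\<close> on the
  right (\<open>I_act\<close>), because \<open>ad(hX) = [ad(h) - , X]\<close>.

  The two inductions come from the universal properties: elements that satisfy a condition closed
  under the operations form a subobject, through which the identity then factors.  Universal
  properties are assumed for targets in one type only, so each target in the argument is first moved into
  that type along an injection, whose domain consists of elements or of functions, encoded as sets of words.\<close>

section \<open>Linear maps and algebras\<close>

text \<open>The scalar \<open>-1\<close> provides additive inverses, so that the premises need not mention them.\<close>

lemma assoc_algebraI:
  fixes K :: "'k ring" and A :: "('k, 'a, 'm) module_scheme"
  assumes K: "field K"
    and add_closed: "\<And>x y. \<lbrakk>x \<in> carrier A; y \<in> carrier A\<rbrakk> \<Longrightarrow> x \<oplus>\<^bsub>A\<^esub> y \<in> carrier A"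
    and zero_closed: "\<zero>\<^bsub>A\<^esub> \<in> carrier A"
    and add_assoc: "\<And>x y z. \<lbrakk>x \<in> carrier A; y \<in> carrier A; z \<in> carrier A\<rbrakk>
      \<Longrightarrow> (x \<oplus>\<^bsub>A\<^esub> y) \<oplus>\<^bsub>A\<^esub> z = x \<oplus>\<^bsub>A\<^esub> (y \<oplus>\<^bsub>A\<^esub> z)"
    and add_comm: "\<And>x y. \<lbrakk>x \<in> carrier A; y \<in> carrier A\<rbrakk> \<Longrightarrow> x \<oplus>\<^bsub>A\<^esub> y = y \<oplus>\<^bsub>A\<^esub> x"
    and add_zero: "\<And>x. x \<in> carrier A \<Longrightarrow> \<zero>\<^bsub>A\<^esub> \<oplus>\<^bsub>A\<^esub> x = x"
    and smult_zero: "\<And>x. x \<in> carrier A \<Longrightarrow> \<zero>\<^bsub>K\<^esub> \<odot>\<^bsub>A\<^esub> x = \<zero>\<^bsub>A\<^esub>"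
    and mult_closed: "\<And>x y. \<lbrakk>x \<in> carrier A; y \<in> carrier A\<rbrakk> \<Longrightarrow> x \<otimes>\<^bsub>A\<^esub> y \<in> carrier A"
    and one_closed: "\<one>\<^bsub>A\<^esub> \<in> carrier A"
    and mult_assoc: "\<And>x y z. \<lbrakk>x \<in> carrier A; y \<in> carrier A; z \<in> carrier A\<rbrakk>
      \<Longrightarrow> (x \<otimes>\<^bsub>A\<^esub> y) \<otimes>\<^bsub>A\<^esub> z = x \<otimes>\<^bsub>A\<^esub> (y \<otimes>\<^bsub>A\<^esub> z)"
    and l_one: "\<And>x. x \<in> carrier A \<Longrightarrow> \<one>\<^bsub>A\<^esub> \<otimes>\<^bsub>A\<^esub> x = x"
    and r_one: "\<And>x. x \<in> carrier A \<Longrightarrow> x \<otimes>\<^bsub>A\<^esub> \<one>\<^bsub>A\<^esub> = x"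
    and l_distr: "\<And>x y z. \<lbrakk>x \<in> carrier A; y \<in> carrier A; z \<in> carrier A\<rbrakk>
      \<Longrightarrow> (x \<oplus>\<^bsub>A\<^esub> y) \<otimes>\<^bsub>A\<^esub> z = x \<otimes>\<^bsub>A\<^esub> z \<oplus>\<^bsub>A\<^esub> y \<otimes>\<^bsub>A\<^esub> z"
    and r_distr: "\<And>x y z. \<lbrakk>x \<in> carrier A; y \<in> carrier A; z \<in> carrier A\<rbrakk>
      \<Longrightarrow> z \<otimes>\<^bsub>A\<^esub> (x \<oplus>\<^bsub>A\<^esub> y) = z \<otimes>\<^bsub>A\<^esub> x \<oplus>\<^bsub>A\<^esub> z \<otimes>\<^bsub>A\<^esub> y"
    and smult_closed: "\<And>c x. \<lbrakk>c \<in> carrier K; x \<in> carrier A\<rbrakk> \<Longrightarrow> c \<odot>\<^bsub>A\<^esub> x \<in> carrier A"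
    and smult_l_distr: "\<And>c c' x. \<lbrakk>c \<in> carrier K; c' \<in> carrier K; x \<in> carrier A\<rbrakk>
      \<Longrightarrow> (c \<oplus>\<^bsub>K\<^esub> c') \<odot>\<^bsub>A\<^esub> x = c \<odot>\<^bsub>A\<^esub> x \<oplus>\<^bsub>A\<^esub> c' \<odot>\<^bsub>A\<^esub> x"
    and smult_r_distr: "\<And>c x y. \<lbrakk>c \<in> carrier K; x \<in> carrier A; y \<in> carrier A\<rbrakk>
      \<Longrightarrow> c \<odot>\<^bsub>A\<^esub> (x \<oplus>\<^bsub>A\<^esub> y) = c \<odot>\<^bsub>A\<^esub> x \<oplus>\<^bsub>A\<^esub> c \<odot>\<^bsub>A\<^esub> y"
    and smult_assoc: "\<And>c c' x. \<lbrakk>c \<in> carrier K; c' \<in> carrier K; x \<in> carrier A\<rbrakk>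
      \<Longrightarrow> (c \<otimes>\<^bsub>K\<^esub> c') \<odot>\<^bsub>A\<^esub> x = c \<odot>\<^bsub>A\<^esub> (c' \<odot>\<^bsub>A\<^esub> x)"
    and smult_one: "\<And>x. x \<in> carrier A \<Longrightarrow> \<one>\<^bsub>K\<^esub> \<odot>\<^bsub>A\<^esub> x = x"
    and smult_mult_left: "\<And>c x y. \<lbrakk>c \<in> carrier K; x \<in> carrier A; y \<in> carrier A\<rbrakk>
      \<Longrightarrow> (c \<odot>\<^bsub>A\<^esub> x) \<otimes>\<^bsub>A\<^esub> y = c \<odot>\<^bsub>A\<^esub> (x \<otimes>\<^bsub>A\<^esub> y)"
    and smult_mult_right: "\<And>c x y. \<lbrakk>c \<in> carrier K; x \<in> carrier A; y \<in> carrier A\<rbrakk>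
      \<Longrightarrow> x \<otimes>\<^bsub>A\<^esub> (c \<odot>\<^bsub>A\<^esub> y) = c \<odot>\<^bsub>A\<^esub> (x \<otimes>\<^bsub>A\<^esub> y)"
  shows "assoc_algebra K A"
proof -
  interpret K: field K by (rule K)
  have inv: "\<exists>y\<in>carrier A. y \<oplus>\<^bsub>A\<^esub> x = \<zero>\<^bsub>A\<^esub>" if x: "x \<in> carrier A" for x
  proof (rule bexI)
    have "(\<ominus>\<^bsub>K\<^esub> \<one>\<^bsub>K\<^esub>) \<odot>\<^bsub>A\<^esub> x \<oplus>\<^bsub>A\<^esub> x = (\<ominus>\<^bsub>K\<^esub> \<one>\<^bsub>K\<^esub>) \<odot>\<^bsub>A\<^esub> x \<oplus>\<^bsub>A\<^esub> \<one>\<^bsub>K\<^esub> \<odot>\<^bsub>A\<^esub> x"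
      using x by (subst smult_one) auto
    also have "\<dots> = (\<ominus>\<^bsub>K\<^esub> \<one>\<^bsub>K\<^esub> \<oplus>\<^bsub>K\<^esub> \<one>\<^bsub>K\<^esub>) \<odot>\<^bsub>A\<^esub> x"
      using x by (intro smult_l_distr[symmetric]) auto
    finally show "(\<ominus>\<^bsub>K\<^esub> \<one>\<^bsub>K\<^esub>) \<odot>\<^bsub>A\<^esub> x \<oplus>\<^bsub>A\<^esub> x = \<zero>\<^bsub>A\<^esub>"
      using x by (simp add: smult_zero K.l_neg)
    show "(\<ominus>\<^bsub>K\<^esub> \<one>\<^bsub>K\<^esub>) \<odot>\<^bsub>A\<^esub> x \<in> carrier A" using x by (simp add: smult_closed)
  qed
  have ab: "abelian_group A"
    using add_closed zero_closed add_assoc add_comm add_zero inv by (rule abelian_groupI)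
  have mon: "monoid A"
    using mult_closed one_closed mult_assoc l_one r_one by (rule monoidI)
  have "ring A"
    using l_distr r_distr by (rule ringI[OF ab mon])
  moreover have "module K A"
    using smult_closed smult_l_distr smult_r_distr smult_assoc smult_one
    by (rule moduleI[OF K.is_cring ab])
  ultimately show ?thesis
    using K smult_mult_left smult_mult_right
    by (intro assoc_algebra.intro assoc_algebra_axioms.intro)
qed

lemma assoc_algebra_ring: "assoc_algebra K A \<Longrightarrow> ring A"
  by (simp add: assoc_algebra_def)

lemma assoc_algebra_module: "assoc_algebra K A \<Longrightarrow> module K A"
  by (simp add: assoc_algebra_def)

lemma assoc_algebra_field: "assoc_algebra K A \<Longrightarrow> field K"
  by (simp add: assoc_algebra_def)

lemma module_abelian_group: "module K M \<Longrightarrow> abelian_group M"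
  by (simp add: module_def)

lemma lin_mapI:
  assumes "\<And>x. x \<in> carrier M \<Longrightarrow> f x \<in> carrier N"
    and "\<And>x y. \<lbrakk>x \<in> carrier M; y \<in> carrier M\<rbrakk> \<Longrightarrow> f (x \<oplus>\<^bsub>M\<^esub> y) = f x \<oplus>\<^bsub>N\<^esub> f y"
    and "\<And>c x. \<lbrakk>c \<in> carrier K; x \<in> carrier M\<rbrakk> \<Longrightarrow> f (c \<odot>\<^bsub>M\<^esub> x) = c \<odot>\<^bsub>N\<^esub> f x"
  shows "lin_map K M N f"
  using assms by (auto simp: lin_map_def)

lemma lin_map_closed: "\<lbrakk>lin_map K M N f; x \<in> carrier M\<rbrakk> \<Longrightarrow> f x \<in> carrier N"
  by (auto simp: lin_map_def)

lemma lin_map_add: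
  "\<lbrakk>lin_map K M N f; x \<in> carrier M; y \<in> carrier M\<rbrakk> \<Longrightarrow> f (x \<oplus>\<^bsub>M\<^esub> y) = f x \<oplus>\<^bsub>N\<^esub> f y"
  by (auto simp: lin_map_def)

lemma lin_map_smult:
  "\<lbrakk>lin_map K M N f; c \<in> carrier K; x \<in> carrier M\<rbrakk> \<Longrightarrow> f (c \<odot>\<^bsub>M\<^esub> x) = c \<odot>\<^bsub>N\<^esub> f x"
  by (auto simp: lin_map_def)

lemma uminus_eq_smult:
  assumes "module K M" "x \<in> carrier M"
  shows "\<ominus>\<^bsub>M\<^esub> x = (\<ominus>\<^bsub>K\<^esub> \<one>\<^bsub>K\<^esub>) \<odot>\<^bsub>M\<^esub> x"
proof -
  interpret module K M by fact
  show ?thesis using assms(2) smult_l_minus[of "\<one>\<^bsub>K\<^esub>" x] by simp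
qed

lemma lin_map_zero:
  assumes "module K M" "module K N" "lin_map K M N f"
  shows "f \<zero>\<^bsub>M\<^esub> = \<zero>\<^bsub>N\<^esub>"
proof -
  interpret M: module K M by fact
  interpret N: module K N by fact
  have "f (\<zero>\<^bsub>K\<^esub> \<odot>\<^bsub>M\<^esub> \<zero>\<^bsub>M\<^esub>) = \<zero>\<^bsub>K\<^esub> \<odot>\<^bsub>N\<^esub> f \<zero>\<^bsub>M\<^esub>"
    using assms(3) by (intro lin_map_smult[where f = f]) auto
  then show ?thesis using lin_map_closed[OF assms(3)] by simp
qed

lemma lin_map_uminus:
  assumes M: "module K M" and N: "module K N" and f: "lin_map K M N f" and x: "x \<in> carrier M"
  shows "f (\<ominus>\<^bsub>M\<^esub> x) = \<ominus>\<^bsub>N\<^esub> f x"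
proof -
  interpret M: module K M by fact
  show ?thesis
    using uminus_eq_smult[OF M x] uminus_eq_smult[OF N lin_map_closed[OF f x]]
      lin_map_smult[OF f _ x] by simp
qed

lemma lin_map_minus:
  assumes M: "module K M" and N: "module K N" and f: "lin_map K M N f"
    and x: "x \<in> carrier M" and y: "y \<in> carrier M"
  shows "f (x \<ominus>\<^bsub>M\<^esub> y) = f x \<ominus>\<^bsub>N\<^esub> f y"
proof -
  interpret M: module K M by fact
  show ?thesis using lin_map_add[OF f x, of "\<ominus>\<^bsub>M\<^esub> y"] lin_map_uminus[OF M N f y] y
    by (simp add: a_minus_def)
qed

lemma lin_map_sign_pow:
  assumes "module K M" "module K N" "lin_map K M N f" "x \<in> carrier M"
  shows "f (sign_pow M n x) = sign_pow N n (f x)"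
  using lin_map_uminus[OF assms] by (simp add: sign_pow_def)

lemma lin_map_comp:
  assumes "lin_map K M N f" "lin_map K N P g"
  shows "lin_map K M P (\<lambda>x. g (f x))"
  using assms by (auto simp: lin_map_def Pi_iff)

lemma sign_pow_closed:
  assumes "abelian_group M" "x \<in> carrier M"
  shows "sign_pow M n x \<in> carrier M"
  using assms by (simp add: sign_pow_def abelian_group.a_inv_closed)

lemma submodule_sign_pow:
  assumes "module K M" "submodule V K M" "x \<in> V"
  shows "sign_pow M n x \<in> V"
  using module.submoduleE(3)[OF assms(1,2)] assms(3) by (simp add: sign_pow_def)

lemma sign_pow_add:
  assumes "abelian_group M" "x \<in> carrier M" "y \<in> carrier M"
  shows "sign_pow M n (x \<oplus>\<^bsub>M\<^esub> y) = sign_pow M n x \<oplus>\<^bsub>M\<^esub> sign_pow M n y"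
proof -
  interpret abelian_group M by fact
  show ?thesis using assms by (simp add: sign_pow_def minus_add)
qed

lemma lin_map_finsum:
  assumes M: "module K M" and N: "module K N" and f: "lin_map K M N f"
    and S: "finite S" and g: "\<And>s. s \<in> S \<Longrightarrow> g s \<in> carrier M"
  shows "f (\<Oplus>\<^bsub>M\<^esub>s\<in>S. g s) = (\<Oplus>\<^bsub>N\<^esub>s\<in>S. f (g s))"
  using S g
proof (induction S)
  case empty
  interpret M: module K M by fact
  interpret N: module K N by fact
  show ?case using lin_map_zero[OF M N f] by simp
next
  case (insert s S)
  interpret M: module K M by fact
  interpret N: module K N by fact
  have "f (\<Oplus>\<^bsub>M\<^esub>s\<in>insert s S. g s) = f (g s \<oplus>\<^bsub>M\<^esub> (\<Oplus>\<^bsub>M\<^esub>s\<in>S. g s))"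
    using insert by (subst M.finsum_insert) auto
  also have "\<dots> = f (g s) \<oplus>\<^bsub>N\<^esub> f (\<Oplus>\<^bsub>M\<^esub>s\<in>S. g s)"
    using insert by (intro lin_map_add[OF f] M.finsum_closed) auto
  also have "\<dots> = (\<Oplus>\<^bsub>N\<^esub>s\<in>insert s S. f (g s))"
    using insert lin_map_closed[OF f] by (subst N.finsum_insert) auto
  finally show ?case .
qed

lemma finsum_extend:
  assumes "abelian_group M" "finite T" "S \<subseteq> T" "\<And>s. s \<in> T \<Longrightarrow> g s \<in> carrier M"
    and "\<And>s. s \<in> T - S \<Longrightarrow> g s = \<zero>\<^bsub>M\<^esub>"
  shows "(\<Oplus>\<^bsub>M\<^esub>s\<in>S. g s) = (\<Oplus>\<^bsub>M\<^esub>s\<in>T. g s)"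
proof -
  interpret abelian_group M by fact
  show ?thesis using assms by (intro add.finprod_mono_neutral_cong_left) auto
qed

lemma alg_hom_mult:
  "\<lbrakk>alg_hom K A B f; x \<in> carrier A; y \<in> carrier A\<rbrakk> \<Longrightarrow> f (x \<otimes>\<^bsub>A\<^esub> y) = f x \<otimes>\<^bsub>B\<^esub> f y"
  by (simp add: alg_hom_def ring_hom_def)

lemma alg_hom_one: "alg_hom K A B f \<Longrightarrow> f \<one>\<^bsub>A\<^esub> = \<one>\<^bsub>B\<^esub>"
  by (simp add: alg_hom_def ring_hom_def)

lemma alg_hom_lin: "alg_hom K A B f \<Longrightarrow> lin_map K A B f"
  by (simp add: alg_hom_def)

lemma alg_homI:
  assumes "lin_map K A B f"
    and "\<And>x y. \<lbrakk>x \<in> carrier A; y \<in> carrier A\<rbrakk> \<Longrightarrow> f (x \<otimes>\<^bsub>A\<^esub> y) = f x \<otimes>\<^bsub>B\<^esub> f y"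
    and "f \<one>\<^bsub>A\<^esub> = \<one>\<^bsub>B\<^esub>"
  shows "alg_hom K A B f"
  using assms by (auto simp: alg_hom_def ring_hom_def lin_map_def)

lemma alg_hom_comp:
  assumes "alg_hom K A B f" "alg_hom K B C g"
  shows "alg_hom K A C (\<lambda>x. g (f x))"
  by (rule alg_homI, rule lin_map_comp[OF assms[THEN alg_hom_lin]])
    (simp_all add: alg_hom_mult[OF assms(1)] alg_hom_mult[OF assms(2)] alg_hom_one[OF assms(1)]
      alg_hom_one[OF assms(2)] lin_map_closed[OF alg_hom_lin[OF assms(1)]])


lemma assoc_algebra_subalgebra:
  assumes A: "assoc_algebra K A" and S: "S \<subseteq> carrier A"
    and zero: "\<zero>\<^bsub>A\<^esub> \<in> S" and one: "\<one>\<^bsub>A\<^esub> \<in> S"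
    and add: "\<And>x y. \<lbrakk>x \<in> S; y \<in> S\<rbrakk> \<Longrightarrow> x \<oplus>\<^bsub>A\<^esub> y \<in> S"
    and mult: "\<And>x y. \<lbrakk>x \<in> S; y \<in> S\<rbrakk> \<Longrightarrow> x \<otimes>\<^bsub>A\<^esub> y \<in> S"
    and smult: "\<And>c x. \<lbrakk>c \<in> carrier K; x \<in> S\<rbrakk> \<Longrightarrow> c \<odot>\<^bsub>A\<^esub> x \<in> S"
  shows "assoc_algebra K (A\<lparr>carrier := S\<rparr>)"
proof -
  interpret R: ring A by (rule assoc_algebra_ring[OF A])
  interpret M: module K A by (rule assoc_algebra_module[OF A])
  note [simp] = subsetD[OF S]
  show ?thesis
    by (rule assoc_algebraI)
      (simp_all add: assoc_algebra_field[OF A] zero one add mult smult R.a_ac R.m_assoc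
        R.l_distr R.r_distr M.smult_l_distr M.smult_r_distr M.smult_assoc1
        assoc_algebra.smult_mult_left[OF A] assoc_algebra.smult_mult_right[OF A])
qed

text \<open>The axioms are equations, hence pass to the image of a homomorphism.\<close>

lemma assoc_algebra_image:
  fixes A :: "('k, 'a, 'm) module_scheme" and B :: "('k, 'b, 'n) module_scheme"
  assumes A: "assoc_algebra K A" and carrier: "carrier B = e ` carrier A"
    and hom: "alg_hom K A B e" and zero: "\<zero>\<^bsub>B\<^esub> = e \<zero>\<^bsub>A\<^esub>"
  shows "assoc_algebra K B"
proof -
  interpret R: ring A by (rule assoc_algebra_ring[OF A])
  interpret M: module K A by (rule assoc_algebra_module[OF A])
  note e = alg_hom_mult[OF hom, symmetric] alg_hom_one[OF hom, symmetric] zero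
    lin_map_add[OF alg_hom_lin[OF hom], symmetric] lin_map_smult[OF alg_hom_lin[OF hom], symmetric]
  show ?thesis
    by (rule assoc_algebraI; (unfold carrier)?; (elim imageE)?)
      (simp_all add: e assoc_algebra_field[OF A] R.a_ac R.m_assoc
        R.l_distr R.r_distr M.smult_l_distr M.smult_r_distr M.smult_assoc1
        assoc_algebra.smult_mult_left[OF A] assoc_algebra.smult_mult_right[OF A])
qed

text \<open>Copying an algebra along an injection into another type makes it an admissible target for a universal
  property that is assumed for that type.\<close>

definition transported_algebra ::
  "('a \<Rightarrow> 'c) \<Rightarrow> ('k, 'a, 'm) module_scheme \<Rightarrow> ('k, 'c) module" where
  "transported_algebra e A = (let r = inv_into (carrier A) e in
     \<lparr>carrier = e ` carrier A, mult = (\<lambda>x y. e (r x \<otimes>\<^bsub>A\<^esub> r y)), one = e \<one>\<^bsub>A\<^esub>,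
      zero = e \<zero>\<^bsub>A\<^esub>, add = (\<lambda>x y. e (r x \<oplus>\<^bsub>A\<^esub> r y)), smult = (\<lambda>c x. e (c \<odot>\<^bsub>A\<^esub> r x))\<rparr>)"

lemma transported_algebra:
  assumes A: "assoc_algebra K A" and inj: "inj_on e (carrier A)"
  shows "assoc_algebra K (transported_algebra e A)"
    and "alg_hom K A (transported_algebra e A) e"
    and "alg_hom K (transported_algebra e A) A (inv_into (carrier A) e)"
proof -
  interpret R: ring A by (rule assoc_algebra_ring[OF A])
  interpret M: module K A by (rule assoc_algebra_module[OF A])
  show hom: "alg_hom K A (transported_algebra e A) e"
    by (intro alg_homI lin_mapI) (auto simp: transported_algebra_def Let_def inj)
  show "assoc_algebra K (transported_algebra e A)"
    by (rule assoc_algebra_image[OF A _ hom]) (auto simp: transported_algebra_def Let_def)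
  show "alg_hom K (transported_algebra e A) A (inv_into (carrier A) e)"
    by (intro alg_homI lin_mapI) (auto simp: transported_algebra_def Let_def inj)
qed

section \<open>Graded differential algebras\<close>

text \<open>The span of a family of subspaces, built by adding one homogeneous element at a time: its induction
  rule reduces statements that are additive to homogeneous elements.\<close>

inductive_set graded_span :: "('a, 'm) ring_scheme \<Rightarrow> (nat \<Rightarrow> 'a set) \<Rightarrow> 'a set"
  for R V where
  zero: "\<zero>\<^bsub>R\<^esub> \<in> graded_span R V"
| add: "\<lbrakk>x \<in> V n; y \<in> graded_span R V\<rbrakk> \<Longrightarrow> x \<oplus>\<^bsub>R\<^esub> y \<in> graded_span R V"

lemma graded_span_decomposition:
  assumes M: "module K M" and sub: "\<And>n. submodule (V n) K M" and x: "x \<in> graded_span M V"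
  shows "\<exists>c. (\<forall>n. c n \<in> V n) \<and> finite {n. c n \<noteq> \<zero>\<^bsub>M\<^esub>} \<and>
    x = (\<Oplus>\<^bsub>M\<^esub>n\<in>{n. c n \<noteq> \<zero>\<^bsub>M\<^esub>}. c n)"
  using x
proof induction
  case zero
  interpret M: module K M by (rule M)
  have "\<zero>\<^bsub>M\<^esub> \<in> V n" for n
    using sub[of n] by (auto simp: submodule_def dest: subgroup.one_closed)
  then show ?case by (intro exI[of _ "\<lambda>_. \<zero>\<^bsub>M\<^esub>"]) auto
next
  case (add x n y)
  interpret M: module K M by (rule M)
  note V = M.submoduleE[OF sub]
  obtain c where c: "\<And>n. c n \<in> V n" and fin: "finite {n. c n \<noteq> \<zero>\<^bsub>M\<^esub>}"
    and y: "y = (\<Oplus>\<^bsub>M\<^esub>n\<in>{n. c n \<noteq> \<zero>\<^bsub>M\<^esub>}. c n)"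
    using add.IH by blast
  define S where "S = insert n {n. c n \<noteq> \<zero>\<^bsub>M\<^esub>}"
  define c' where "c' = c(n := x \<oplus>\<^bsub>M\<^esub> c n)"
  have cc [simp]: "c m \<in> carrier M" for m using V(1) c by blast
  have [simp]: "x \<in> carrier M" using V(1) add.hyps by blast
  have S: "finite S" "n \<in> S" using fin by (auto simp: S_def)
  have c'V: "c' m \<in> V m" for m using c V(5) add.hyps by (simp add: c'_def)
  have c'c [simp]: "c' m \<in> carrier M" for m using V(1) c'V by blast
  have supp: "{n. c' n \<noteq> \<zero>\<^bsub>M\<^esub>} \<subseteq> S" by (auto simp: c'_def S_def)
  have "x \<oplus>\<^bsub>M\<^esub> y = (\<Oplus>\<^bsub>M\<^esub>m\<in>S. if n = m then x else \<zero>\<^bsub>M\<^esub>) \<oplus>\<^bsub>M\<^esub> (\<Oplus>\<^bsub>M\<^esub>m\<in>S. c m)"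
  proof -
    have "y = (\<Oplus>\<^bsub>M\<^esub>m\<in>S. c m)"
      unfolding y by (rule finsum_extend[OF module_abelian_group[OF M] S(1)]) (auto simp: S_def)
    moreover have "(\<Oplus>\<^bsub>M\<^esub>m\<in>S. if n = m then x else \<zero>\<^bsub>M\<^esub>) = x"
      using S by (intro M.finsum_singleton) auto
    ultimately show ?thesis by simp
  qed
  also have "\<dots> = (\<Oplus>\<^bsub>M\<^esub>m\<in>S. (if n = m then x else \<zero>\<^bsub>M\<^esub>) \<oplus>\<^bsub>M\<^esub> c m)"
    by (subst M.finsum_addf) auto
  also have "\<dots> = (\<Oplus>\<^bsub>M\<^esub>m\<in>S. c' m)"
    by (rule M.finsum_cong') (auto simp: c'_def)
  also have "\<dots> = (\<Oplus>\<^bsub>M\<^esub>m\<in>{n. c' n \<noteq> \<zero>\<^bsub>M\<^esub>}. c' m)"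
    using S supp by (intro finsum_extend[symmetric] module_abelian_group[OF M]) auto
  finally show ?case using c'V supp S(1) by (blast intro: finite_subset)
qed

text \<open>Direct sums are awkward to verify from their definition.  It suffices that homogeneous elements span
  and that there are linear maps \<open>pr n\<close> acting on them as the projections: these read off every
  component of a decomposition, which makes it unique.  All other axioms extend from homogeneous
  elements to their span.\<close>

lemma gdaI:
  fixes B :: "('k, 'b) gda"
  assumes B: "assoc_algebra K B"
    and sub: "\<And>n. submodule (gcomp B n) K B"
    and span: "carrier B \<subseteq> graded_span B (gcomp B)"
    and pr: "\<And>n. lin_map K B B (pr n)"
    and pr_same: "\<And>n x. x \<in> gcomp B n \<Longrightarrow> pr n x = x"
    and pr_other: "\<And>m n x. \<lbrakk>x \<in> gcomp B n; m \<noteq> n\<rbrakk> \<Longrightarrow> pr m x = \<zero>\<^bsub>B\<^esub>"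
    and one: "\<one>\<^bsub>B\<^esub> \<in> gcomp B 0"
    and mult: "\<And>m n x y. \<lbrakk>x \<in> gcomp B m; y \<in> gcomp B n\<rbrakk> \<Longrightarrow> x \<otimes>\<^bsub>B\<^esub> y \<in> gcomp B (m + n)"
    and d: "lin_map K B B (gdiff B)"
    and degree: "\<And>n x. x \<in> gcomp B n \<Longrightarrow> gdiff B x \<in> gcomp B (Suc n)"
    and leibniz: "\<And>m n x y. \<lbrakk>x \<in> gcomp B m; y \<in> gcomp B n\<rbrakk> \<Longrightarrow>
      gdiff B (x \<otimes>\<^bsub>B\<^esub> y) = gdiff B x \<otimes>\<^bsub>B\<^esub> y \<oplus>\<^bsub>B\<^esub> sign_pow B m (x \<otimes>\<^bsub>B\<^esub> gdiff B y)"
    and dd: "\<And>n x. x \<in> gcomp B n \<Longrightarrow> gdiff B (gdiff B x) = \<zero>\<^bsub>B\<^esub>"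
  shows "graded_diff_algebra K B"
proof -
  have M: "module K B" by (rule assoc_algebra_module[OF B])
  interpret R: ring B by (rule assoc_algebra_ring[OF B])
  interpret M: module K B by (rule M)
  note V = M.submoduleE[OF sub]
  have Vc [simp]: "x \<in> gcomp B n \<Longrightarrow> x \<in> carrier B" for x n using V(1) by blast
  note dc [simp] = lin_map_closed[OF d] and d_add = lin_map_add[OF d]
  have d0 [simp]: "gdiff B \<zero>\<^bsub>B\<^esub> = \<zero>\<^bsub>B\<^esub>" by (rule lin_map_zero[OF M M d])
  have span_carrier: "x \<in> carrier B" if "x \<in> graded_span B (gcomp B)" for x
    using that by induction auto
  have unique: "c n = pr n x"
    if c: "\<forall>n. c n \<in> gcomp B n" and S: "finite {n. c n \<noteq> \<zero>\<^bsub>B\<^esub>}"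
      and x: "x = (\<Oplus>\<^bsub>B\<^esub>n\<in>{n. c n \<noteq> \<zero>\<^bsub>B\<^esub>}. c n)" for c n x
  proof -
    have cn: "c m \<in> gcomp B m" for m using c by blast
    have [simp]: "c m \<in> carrier B" for m using cn Vc by blast
    have "pr n x = (\<Oplus>\<^bsub>B\<^esub>m\<in>{n. c n \<noteq> \<zero>\<^bsub>B\<^esub>}. pr n (c m))"
      unfolding x using cn by (intro lin_map_finsum[OF M M pr S]) auto
    also have "\<dots> = (\<Oplus>\<^bsub>B\<^esub>m\<in>{n. c n \<noteq> \<zero>\<^bsub>B\<^esub>}. if n = m then c m else \<zero>\<^bsub>B\<^esub>)"
      by (intro R.finsum_cong') (auto simp: pr_same[OF cn] pr_other[OF cn])
    also have "\<dots> = c n"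
    proof (cases "c n = \<zero>\<^bsub>B\<^esub>")
      case True
      have "(\<Oplus>\<^bsub>B\<^esub>m\<in>{n. c n \<noteq> \<zero>\<^bsub>B\<^esub>}. if n = m then c m else \<zero>\<^bsub>B\<^esub>) =
          (\<Oplus>\<^bsub>B\<^esub>m\<in>{n. c n \<noteq> \<zero>\<^bsub>B\<^esub>}. \<zero>\<^bsub>B\<^esub>)"
        using True by (intro R.finsum_cong') auto
      then show ?thesis using True by simp
    next
      case False
      then show ?thesis using S cn by (intro R.finsum_singleton) auto
    qed
    finally show ?thesis by simp
  qed
  have decomposition: "\<exists>!c. (\<forall>n. c n \<in> gcomp B n) \<and> finite {n. c n \<noteq> \<zero>\<^bsub>B\<^esub>} \<and>
      x = (\<Oplus>\<^bsub>B\<^esub>n\<in>{n. c n \<noteq> \<zero>\<^bsub>B\<^esub>}. c n)" if "x \<in> carrier B" for x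
  proof (rule ex_ex1I)
    show "\<exists>c. (\<forall>n. c n \<in> gcomp B n) \<and> finite {n. c n \<noteq> \<zero>\<^bsub>B\<^esub>} \<and>
      x = (\<Oplus>\<^bsub>B\<^esub>n\<in>{n. c n \<noteq> \<zero>\<^bsub>B\<^esub>}. c n)"
      by (rule graded_span_decomposition[OF M sub subsetD[OF span that]])
    fix c c'
    assume c: "(\<forall>n. c n \<in> gcomp B n) \<and> finite {n. c n \<noteq> \<zero>\<^bsub>B\<^esub>} \<and>
      x = (\<Oplus>\<^bsub>B\<^esub>n\<in>{n. c n \<noteq> \<zero>\<^bsub>B\<^esub>}. c n)"
      and c': "(\<forall>n. c' n \<in> gcomp B n) \<and> finite {n. c' n \<noteq> \<zero>\<^bsub>B\<^esub>} \<and>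
      x = (\<Oplus>\<^bsub>B\<^esub>n\<in>{n. c' n \<noteq> \<zero>\<^bsub>B\<^esub>}. c' n)"
    have "c n = pr n x" "c' n = pr n x" for n
      using unique[of c x n] unique[of c' x n] c c' by simp_all
    then show "c = c'" by (intro ext) simp
  qed
  have leibniz': "gdiff B (x \<otimes>\<^bsub>B\<^esub> y) =
      gdiff B x \<otimes>\<^bsub>B\<^esub> y \<oplus>\<^bsub>B\<^esub> sign_pow B n (x \<otimes>\<^bsub>B\<^esub> gdiff B y)"
    if x: "x \<in> gcomp B n" and y: "y \<in> graded_span B (gcomp B)" for x y n
    using y
  proof induction
    case zero
    then show ?case using x by (simp add: sign_pow_def)
  next
    case (add u m v)
    then have [simp]: "u \<in> carrier B" "v \<in> carrier B" "x \<in> carrier B"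
      using span_carrier x by auto
    have "gdiff B (x \<otimes>\<^bsub>B\<^esub> (u \<oplus>\<^bsub>B\<^esub> v)) =
        (gdiff B x \<otimes>\<^bsub>B\<^esub> u \<oplus>\<^bsub>B\<^esub> sign_pow B n (x \<otimes>\<^bsub>B\<^esub> gdiff B u)) \<oplus>\<^bsub>B\<^esub>
        (gdiff B x \<otimes>\<^bsub>B\<^esub> v \<oplus>\<^bsub>B\<^esub> sign_pow B n (x \<otimes>\<^bsub>B\<^esub> gdiff B v))"
      using add x by (simp add: R.r_distr d_add leibniz)
    also have "\<dots> = gdiff B x \<otimes>\<^bsub>B\<^esub> (u \<oplus>\<^bsub>B\<^esub> v) \<oplus>\<^bsub>B\<^esub> sign_pow B n (x \<otimes>\<^bsub>B\<^esub> gdiff B (u \<oplus>\<^bsub>B\<^esub> v))"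
      by (simp add: R.r_distr d_add sign_pow_add R.abelian_group_axioms sign_pow_closed R.a_ac)
    finally show ?case .
  qed
  have dd': "gdiff B (gdiff B x) = \<zero>\<^bsub>B\<^esub>" if "x \<in> graded_span B (gcomp B)" for x
    using that span_carrier by induction (auto simp: d_add dd)
  show ?thesis
    by (intro graded_diff_algebra.intro B graded_diff_algebra_axioms.intro sub decomposition one
      mult d degree) (use span leibniz' dd' in auto)
qed

definition hom_part :: "('k, 'w) gda \<Rightarrow> nat \<Rightarrow> 'w \<Rightarrow> 'w" where
  "hom_part \<Omega> n x = (THE c. (\<forall>n. c n \<in> gcomp \<Omega> n) \<and> finite {n. c n \<noteq> \<zero>\<^bsub>\<Omega>\<^esub>} \<and>
           x = (\<Oplus>\<^bsub>\<Omega>\<^esub>n\<in>{n. c n \<noteq> \<zero>\<^bsub>\<Omega>\<^esub>}. c n)) n"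

text \<open>The automorphism that is \<open>(-1)\<^sup>n\<close> in degree \<open>n\<close>.  It turns the sign of a graded Leibniz rule, which
  makes sense for homogeneous elements only, into a linear map.\<close>

definition grade_involution :: "('k, 'w) gda \<Rightarrow> 'w \<Rightarrow> 'w" where
  "grade_involution \<Omega> x =
     (\<Oplus>\<^bsub>\<Omega>\<^esub>n\<in>{n. hom_part \<Omega> n x \<noteq> \<zero>\<^bsub>\<Omega>\<^esub>}. sign_pow \<Omega> n (hom_part \<Omega> n x))"

text \<open>The same locale with \<open>\<Omega>\<close> as implicit structure: operations without a subscript are those of \<open>\<Omega>\<close>.\<close>

locale gda = graded_diff_algebra K \<Omega>
  for K :: "'k ring" and \<Omega> :: "('k, 'w) gda" (structure)

sublocale graded_diff_algebra \<subseteq> gda K \<Omega> ..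

context gda
begin

lemma gda_algebra: "assoc_algebra K \<Omega>" ..
lemma gda_module: "module K \<Omega>" ..
lemma gda_ring: "ring \<Omega>" ..
lemma gda_abelian_group: "abelian_group \<Omega>" ..

lemmas gcomp_uminus = module.submoduleE(3)[OF gda_module gcomp_submodule]
lemmas gcomp_smult = module.submoduleE(4)[OF gda_module gcomp_submodule]
lemmas gcomp_add = module.submoduleE(5)[OF gda_module gcomp_submodule]

lemma gcomp_carrier [simp]: "x \<in> gcomp \<Omega> n \<Longrightarrow> x \<in> carrier \<Omega>"
  using module.submoduleE(1)[OF gda_module gcomp_submodule] by blast

lemma gcomp_zero [simp]: "\<zero> \<in> gcomp \<Omega> n"
  using gcomp_submodule[of n] by (auto simp: submodule_def dest: subgroup.one_closed)

lemmas gdiff_closed [simp] = lin_map_closed[OF gdiff_linear]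
lemmas gdiff_add = lin_map_add[OF gdiff_linear]
lemmas gdiff_smult = lin_map_smult[OF gdiff_linear]
lemmas gdiff_zero [simp] = lin_map_zero[OF gda_module gda_module gdiff_linear]
lemmas gdiff_uminus = lin_map_uminus[OF gda_module gda_module gdiff_linear]
lemmas gdiff_sign_pow = lin_map_sign_pow[OF gda_module gda_module gdiff_linear]
lemmas sign_closed [simp] = sign_pow_closed[OF gda_abelian_group]

lemma hom_part_decomposition:
  assumes "x \<in> carrier \<Omega>"
  shows "hom_part \<Omega> n x \<in> gcomp \<Omega> n" and "finite {n. hom_part \<Omega> n x \<noteq> \<zero>}"
    and "x = (\<Oplus>n\<in>{n. hom_part \<Omega> n x \<noteq> \<zero>}. hom_part \<Omega> n x)"
  using theI'[OF gcomp_direct_sum[OF assms]] unfolding hom_part_def by blast+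

lemma hom_part_closed [simp]: "x \<in> carrier \<Omega> \<Longrightarrow> hom_part \<Omega> n x \<in> carrier \<Omega>"
  by (rule gcomp_carrier[OF hom_part_decomposition(1)])

text \<open>Uniqueness of the decomposition, in a form where the support may be any finite superset; sums of two
  elements can then be compared over a common index set.\<close>

lemma hom_part_eqI:
  assumes S: "finite S" and c: "\<And>n. c n \<in> gcomp \<Omega> n" and zero: "\<And>n. n \<notin> S \<Longrightarrow> c n = \<zero>"
    and x: "x = (\<Oplus>n\<in>S. c n)"
  shows "hom_part \<Omega> n x = c n"
proof -
  have [simp]: "c n \<in> carrier \<Omega>" for n using c gcomp_carrier by blast
  have supp: "{n. c n \<noteq> \<zero>} \<subseteq> S" using zero by auto
  have fin: "finite {n. c n \<noteq> \<zero>}" by (rule finite_subset[OF supp S])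
  have x': "x = (\<Oplus>n\<in>{n. c n \<noteq> \<zero>}. c n)"
    unfolding x using supp S c by (intro finsum_extend[symmetric] gda_abelian_group) auto
  have "x \<in> carrier \<Omega>"
    unfolding x using c by (intro abelian_monoid.finsum_closed) (auto intro: abelian_group.axioms gda_abelian_group)
  from the1_equality[OF gcomp_direct_sum[OF this], of c] show ?thesis
    using c fin x' by (simp add: hom_part_def)
qed

lemma hom_part_support:
  assumes "x \<in> carrier \<Omega>" "finite S" "{n. hom_part \<Omega> n x \<noteq> \<zero>} \<subseteq> S"
  shows "x = (\<Oplus>n\<in>S. hom_part \<Omega> n x)"
  by (rule trans[OF hom_part_decomposition(3)[OF assms(1)]
      finsum_extend[OF gda_abelian_group assms(2,3)]]) (use assms(1) in auto)

lemma hom_part_add: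
  assumes x: "x \<in> carrier \<Omega>" and y: "y \<in> carrier \<Omega>"
  shows "hom_part \<Omega> n (x \<oplus> y) = hom_part \<Omega> n x \<oplus> hom_part \<Omega> n y"
proof -
  define S where "S = {n. hom_part \<Omega> n x \<noteq> \<zero>} \<union> {n. hom_part \<Omega> n y \<noteq> \<zero>}"
  have S: "finite S" using hom_part_decomposition(2) x y by (simp add: S_def)
  show ?thesis
  proof (rule hom_part_eqI[OF S])
    show "x \<oplus> y = (\<Oplus>n\<in>S. hom_part \<Omega> n x \<oplus> hom_part \<Omega> n y)"
    proof -
      have "x = (\<Oplus>n\<in>S. hom_part \<Omega> n x)" "y = (\<Oplus>n\<in>S. hom_part \<Omega> n y)"
        by (rule hom_part_support[OF x S], simp add: S_def) (rule hom_part_support[OF y S], simp add: S_def)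
      then have "x \<oplus> y = (\<Oplus>n\<in>S. hom_part \<Omega> n x) \<oplus> (\<Oplus>n\<in>S. hom_part \<Omega> n y)"
        by metis
      then show ?thesis using x y by (simp add: M.finsum_addf)
    qed
  qed (use hom_part_decomposition(1) x y in \<open>auto simp: S_def gcomp_add\<close>)
qed

lemma hom_part_smult:
  assumes c: "c \<in> carrier K" and x: "x \<in> carrier \<Omega>"
  shows "hom_part \<Omega> n (c \<odot> x) = c \<odot> hom_part \<Omega> n x"
proof -
  show ?thesis
  proof (rule hom_part_eqI[OF hom_part_decomposition(2)[OF x]])
    show "c \<odot> x = (\<Oplus>n\<in>{n. hom_part \<Omega> n x \<noteq> \<zero>}. c \<odot> hom_part \<Omega> n x)"
      using c x finsum_smult_ldistr[OF hom_part_decomposition(2)[OF x] c, of "\<lambda>n. hom_part \<Omega> n x"]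
      by (simp add: hom_part_decomposition(3)[OF x, symmetric])
  qed (use c hom_part_decomposition(1) x in \<open>auto simp: gcomp_smult\<close>)
qed

lemma hom_part_linear: "lin_map K \<Omega> \<Omega> (hom_part \<Omega> n)"
  by (intro lin_mapI hom_part_closed hom_part_add hom_part_smult)

lemma hom_part_homogeneous:
  assumes "x \<in> gcomp \<Omega> m"
  shows "hom_part \<Omega> n x = (if n = m then x else \<zero>)"
proof (rule hom_part_eqI[where S = "{m}"])
  show "x = (\<Oplus>n\<in>{m}. if n = m then x else \<zero>)"
    using assms by simp
qed (use assms in auto)

lemma carrier_eq_graded_span: "carrier \<Omega> = graded_span \<Omega> (gcomp \<Omega>)"
proof
  have "(\<Oplus>n\<in>S. c n) \<in> graded_span \<Omega> (gcomp \<Omega>)"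
    if "finite S" "\<And>n. c n \<in> gcomp \<Omega> n" for c S
    using that
  proof (induction S)
    case empty
    then show ?case by (simp add: graded_span.zero)
  next
    case (insert n S)
    have "c m \<in> carrier \<Omega>" for m using insert gcomp_carrier by blast
    then show ?case using insert by (subst finsum_insert) (auto intro: graded_span.add)
  qed
  then show "carrier \<Omega> \<subseteq> graded_span \<Omega> (gcomp \<Omega>)"
    using hom_part_decomposition by (metis subsetI)
  have "x \<in> carrier \<Omega>" if "x \<in> graded_span \<Omega> (gcomp \<Omega>)" for x
    using that by induction auto
  then show "graded_span \<Omega> (gcomp \<Omega>) \<subseteq> carrier \<Omega>" by blast
qed

lemma graded_induct [consumes 1, case_names zero add]:
  assumes "x \<in> carrier \<Omega>" and "P \<zero>"
    and "\<And>n x y. \<lbrakk>x \<in> gcomp \<Omega> n; y \<in> carrier \<Omega>; P y\<rbrakk> \<Longrightarrow> P (x \<oplus> y)"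
  shows "P x"
  using assms(1) unfolding carrier_eq_graded_span
  by (induction rule: graded_span.induct) (use assms(2,3) carrier_eq_graded_span in auto)

lemma grade_involution_support:
  assumes "x \<in> carrier \<Omega>" "finite S" "{n. hom_part \<Omega> n x \<noteq> \<zero>} \<subseteq> S"
  shows "grade_involution \<Omega> x = (\<Oplus>n\<in>S. sign_pow \<Omega> n (hom_part \<Omega> n x))"
  unfolding grade_involution_def
  by (rule finsum_extend[OF gda_abelian_group assms(2,3)])
    (use assms(1) in \<open>auto simp: sign_pow_def\<close>)

lemma grade_involution_homogeneous:
  assumes "x \<in> gcomp \<Omega> n"
  shows "grade_involution \<Omega> x = sign_pow \<Omega> n x"
proof -
  have "grade_involution \<Omega> x = (\<Oplus>m\<in>{n}. sign_pow \<Omega> m (hom_part \<Omega> m x))"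
    using assms by (intro grade_involution_support) (auto simp: hom_part_homogeneous split: if_splits)
  then show ?thesis using assms by (simp add: hom_part_homogeneous)
qed

lemma grade_involution_linear: "lin_map K \<Omega> \<Omega> (grade_involution \<Omega>)"
proof (rule lin_mapI)
  show "grade_involution \<Omega> x \<in> carrier \<Omega>" if "x \<in> carrier \<Omega>" for x
    using that unfolding grade_involution_def by (intro finsum_closed) auto
next
  fix x y assume x: "x \<in> carrier \<Omega>" and y: "y \<in> carrier \<Omega>"
  define S where "S = {n. hom_part \<Omega> n x \<noteq> \<zero>} \<union> {n. hom_part \<Omega> n y \<noteq> \<zero>}"
  have S: "finite S" using hom_part_decomposition(2) x y by (simp add: S_def)
  have "{n. hom_part \<Omega> n (x \<oplus> y) \<noteq> \<zero>} \<subseteq> S"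
    using x y by (auto simp: S_def hom_part_add)
  then show "grade_involution \<Omega> (x \<oplus> y) = grade_involution \<Omega> x \<oplus> grade_involution \<Omega> y"
    using x y grade_involution_support[OF _ S, of x] grade_involution_support[OF _ S, of y]
      grade_involution_support[OF _ S, of "x \<oplus> y"]
    by (simp add: S_def finsum_addf hom_part_add sign_pow_add gda_abelian_group)
next
  fix c x assume c: "c \<in> carrier K" and x: "x \<in> carrier \<Omega>"
  define S where "S = {n. hom_part \<Omega> n x \<noteq> \<zero>}"
  have S: "finite S" using hom_part_decomposition(2) x by (simp add: S_def)
  have sign: "sign_pow \<Omega> n (c \<odot> y) = c \<odot> sign_pow \<Omega> n y" if "y \<in> carrier \<Omega>" for n y
    using c that smult_r_minus by (simp add: sign_pow_def)
  have "{n. hom_part \<Omega> n (c \<odot> x) \<noteq> \<zero>} \<subseteq> S"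
    using x c by (auto simp: S_def hom_part_smult)
  then show "grade_involution \<Omega> (c \<odot> x) = c \<odot> grade_involution \<Omega> x"
    using x c grade_involution_support[OF _ S, of x]
      grade_involution_support[OF _ S, of "c \<odot> x"]
      finsum_smult_ldistr[OF S c, of "\<lambda>n. sign_pow \<Omega> n (hom_part \<Omega> n x)"]
    by (simp add: S_def hom_part_smult sign)
qed

lemma sign_pow_mult_left:
  assumes "x \<in> carrier \<Omega>" "y \<in> carrier \<Omega>"
  shows "sign_pow \<Omega> n x \<otimes> y = sign_pow \<Omega> n (x \<otimes> y)"
  using assms ring.l_minus[OF gda_ring] by (simp add: sign_pow_def)

lemma sign_pow_mult_right:
  assumes "x \<in> carrier \<Omega>" "y \<in> carrier \<Omega>"
  shows "x \<otimes> sign_pow \<Omega> n y = sign_pow \<Omega> n (x \<otimes> y)"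
  using assms ring.r_minus[OF gda_ring] by (simp add: sign_pow_def)

lemma sign_pow_sign_pow:
  assumes "x \<in> carrier \<Omega>"
  shows "sign_pow \<Omega> m (sign_pow \<Omega> n x) = sign_pow \<Omega> (m + n) x"
  using assms by (auto simp: sign_pow_def)

text \<open>Both sides are additive in each argument, and \<open>(-1)\<^sup>m (-1)\<^sup>n = (-1)\<^sup>m\<^sup>+\<^sup>n\<close>.\<close>

lemma grade_involution_mult:
  assumes x: "x \<in> carrier \<Omega>" and y: "y \<in> carrier \<Omega>"
  shows "grade_involution \<Omega> (x \<otimes> y) = grade_involution \<Omega> x \<otimes> grade_involution \<Omega> y"
proof -
  note lin = grade_involution_linear
  note [simp] = lin_map_closed[OF lin] and g_add = lin_map_add[OF lin]
    and g_zero = lin_map_zero[OF gda_module gda_module lin]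
  have homog: "grade_involution \<Omega> (x \<otimes> y) = grade_involution \<Omega> x \<otimes> grade_involution \<Omega> y"
    if x: "x \<in> gcomp \<Omega> m" and y: "y \<in> carrier \<Omega>" for m x y
    using y
  proof (induction rule: graded_induct)
    case zero
    then show ?case using x by (simp add: g_zero)
  next
    case (add n y z)
    then have "y \<in> carrier \<Omega>" "x \<in> carrier \<Omega>" using x by auto
    moreover have "grade_involution \<Omega> (x \<otimes> y) = grade_involution \<Omega> x \<otimes> grade_involution \<Omega> y"
      using x add.hyps(1) calculation gcomp_mult[OF x add.hyps(1)]
      by (simp add: grade_involution_homogeneous sign_pow_mult_left sign_pow_mult_right
          sign_pow_sign_pow add.commute)
    ultimately show ?case using add by (simp add: A.r_distr g_add)
  qed
  from x show ?thesis
  proof (induction rule: graded_induct)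
    case zero
    then show ?case using y by (simp add: g_zero)
  next
    case (add n x z)
    then show ?case using y homog[OF add.hyps(1) y] by (simp add: A.l_distr g_add)
  qed
qed

end

text \<open>An algebra may be larger than the sum of its homogeneous parts; restricting it to their span gives a
  graded differential algebra.  This produces both the algebra of convolutions, where linear maps may
  have values in infinitely many degrees, and the subalgebras spanned by selected homogeneous elements.\<close>

lemma graded_span_gda:
  fixes W :: "('k, 'b) gda"
  assumes W: "assoc_algebra K W"
    and sub: "\<And>n. submodule (gcomp W n) K W"
    and pr: "\<And>n. lin_map K W W (pr n)"
    and pr_same: "\<And>n x. x \<in> gcomp W n \<Longrightarrow> pr n x = x"
    and pr_other: "\<And>m n x. \<lbrakk>x \<in> gcomp W n; m \<noteq> n\<rbrakk> \<Longrightarrow> pr m x = \<zero>\<^bsub>W\<^esub>"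
    and one: "\<one>\<^bsub>W\<^esub> \<in> gcomp W 0"
    and mult: "\<And>m n x y. \<lbrakk>x \<in> gcomp W m; y \<in> gcomp W n\<rbrakk> \<Longrightarrow> x \<otimes>\<^bsub>W\<^esub> y \<in> gcomp W (m + n)"
    and d: "lin_map K W W (gdiff W)"
    and degree: "\<And>n x. x \<in> gcomp W n \<Longrightarrow> gdiff W x \<in> gcomp W (Suc n)"
    and leibniz: "\<And>m n x y. \<lbrakk>x \<in> gcomp W m; y \<in> gcomp W n\<rbrakk> \<Longrightarrow>
      gdiff W (x \<otimes>\<^bsub>W\<^esub> y) = gdiff W x \<otimes>\<^bsub>W\<^esub> y \<oplus>\<^bsub>W\<^esub> sign_pow W m (x \<otimes>\<^bsub>W\<^esub> gdiff W y)"
    and dd: "\<And>n x. x \<in> gcomp W n \<Longrightarrow> gdiff W (gdiff W x) = \<zero>\<^bsub>W\<^esub>"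
  shows "graded_diff_algebra K (W\<lparr>carrier := graded_span W (gcomp W)\<rparr>)" (is "graded_diff_algebra K ?B")
proof -
  have M: "module K W" by (rule assoc_algebra_module[OF W])
  interpret R: ring W by (rule assoc_algebra_ring[OF W])
  interpret M: module K W by (rule M)
  note V = M.submoduleE[OF sub]
  let ?S = "graded_span W (gcomp W)"
  have V0: "\<zero>\<^bsub>W\<^esub> \<in> gcomp W n" for n
    using sub[of n] by (auto simp: submodule_def dest: subgroup.one_closed)
  have S_carrier: "x \<in> carrier W" if "x \<in> ?S" for x
    using that V(1) by induction auto
  have V_S: "x \<in> ?S" if "x \<in> gcomp W n" for x n
    using graded_span.add[where R = W and V = "gcomp W", OF that graded_span.zero] that V(1)[of n]
    by (simp add: subset_iff)
  have S_add: "x \<oplus>\<^bsub>W\<^esub> y \<in> ?S" if "x \<in> ?S" "y \<in> ?S" for x y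
    using that
  proof induction
    case (add x n z)
    then have "x \<in> carrier W" "z \<in> carrier W" "y \<in> carrier W" using S_carrier V(1) by auto
    then have "x \<oplus>\<^bsub>W\<^esub> z \<oplus>\<^bsub>W\<^esub> y = x \<oplus>\<^bsub>W\<^esub> (z \<oplus>\<^bsub>W\<^esub> y)" by (simp add: R.a_assoc)
    then show ?case using add graded_span.add by metis
  qed (use S_carrier in simp)
  have S_lin: "f x \<in> ?S" if x: "x \<in> ?S" and f: "lin_map K W W f" and fV: "\<And>n x. x \<in> gcomp W n \<Longrightarrow> f x \<in> ?S"
    for f x
    using x
  proof induction
    case zero
    then show ?case using lin_map_zero[OF M M f] graded_span.zero by metis
  next
    case (add x n z)
    then have "x \<in> carrier W" "z \<in> carrier W" using S_carrier V(1) by auto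
    then show ?case using lin_map_add[OF f] S_add fV add by simp
  qed
  have S_smult: "c \<odot>\<^bsub>W\<^esub> x \<in> ?S" if "c \<in> carrier K" "x \<in> ?S" for c x
    by (rule S_lin[OF that(2) _ V_S[OF V(4)[OF that(1)]]])
      (use that in \<open>auto intro!: lin_mapI simp: M.smult_r_distr M.smult_assoc1[symmetric] M.R.m_comm\<close>)
  have S_mult: "x \<otimes>\<^bsub>W\<^esub> y \<in> ?S" if "x \<in> ?S" "y \<in> ?S" for x y
  proof (rule S_lin[OF that(1), of "\<lambda>x. x \<otimes>\<^bsub>W\<^esub> y"])
    show "lin_map K W W (\<lambda>x. x \<otimes>\<^bsub>W\<^esub> y)"
      using S_carrier[OF that(2)]
      by (auto intro!: lin_mapI simp: R.l_distr assoc_algebra.smult_mult_left[OF W])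
    fix n x assume x: "x \<in> gcomp W n"
    then have xc: "x \<in> carrier W" using V(1) by blast
    show "x \<otimes>\<^bsub>W\<^esub> y \<in> ?S"
      by (rule S_lin[OF that(2) _ V_S[OF mult[OF x]]])
       (use xc in \<open>auto intro!: lin_mapI simp: R.r_distr assoc_algebra.smult_mult_right[OF W]\<close>)
  qed
  have B: "assoc_algebra K ?B"
    by (rule assoc_algebra_subalgebra[OF W])
      (use S_carrier S_add S_smult S_mult V_S[OF one] graded_span.zero in auto)
  have MB: "module K ?B" by (rule assoc_algebra_module[OF B])
  have sign: "sign_pow ?B n x = sign_pow W n x" if "x \<in> ?S" for n x
    using uminus_eq_smult[OF M S_carrier[OF that]] uminus_eq_smult[OF MB, of x] that
    by (simp add: sign_pow_def)
  have lin: "lin_map K ?B ?B f"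
    if f: "lin_map K W W f" and fV: "\<And>n x. x \<in> gcomp W n \<Longrightarrow> f x \<in> ?S" for f
    using S_lin[OF _ f fV] S_carrier lin_map_add[OF f] lin_map_smult[OF f]
    by (intro lin_mapI) auto
  have prV: "pr m x \<in> ?S" if "x \<in> gcomp W n" for m n x
    using that pr_same[OF that] pr_other[OF that] V_S[OF that] graded_span.zero[of W "gcomp W"]
    by (cases "m = n") simp_all
  show ?thesis
  proof (rule gdaI[OF B, where pr = pr])
    show "submodule (gcomp ?B n) K ?B" for n
    proof (rule module.submoduleI[OF MB])
      fix a assume a: "a \<in> gcomp ?B n"
      then have "\<ominus>\<^bsub>?B\<^esub> a = \<ominus>\<^bsub>W\<^esub> a" using sign[of a 1] V_S by (simp add: sign_pow_def)
      then show "\<ominus>\<^bsub>?B\<^esub> a \<in> gcomp ?B n" using a V(3) by simp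
    qed (use V V_S V0 in auto)
    have "x \<in> graded_span ?B (gcomp ?B)" if "x \<in> ?S" for x
      using that
      by induction (use graded_span.zero[of ?B "gcomp ?B"] graded_span.add[of _ "gcomp ?B" _ _ ?B] in auto)
    then show "carrier ?B \<subseteq> graded_span ?B (gcomp ?B)" by auto
    show "lin_map K ?B ?B (pr n)" for n by (rule lin[OF pr prV])
    show "lin_map K ?B ?B (gdiff ?B)" using lin[OF d V_S[OF degree]] by simp
    show "gdiff ?B (x \<otimes>\<^bsub>?B\<^esub> y) = gdiff ?B x \<otimes>\<^bsub>?B\<^esub> y \<oplus>\<^bsub>?B\<^esub> sign_pow ?B m (x \<otimes>\<^bsub>?B\<^esub> gdiff ?B y)"
      if x: "x \<in> gcomp ?B m" and y: "y \<in> gcomp ?B n" for m n x y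
    proof -
      have x': "x \<in> gcomp W m" and y': "y \<in> gcomp W n" using x y by simp_all
      show ?thesis
        using leibniz[OF x' y'] sign[OF S_mult[OF V_S[OF x'] V_S[OF degree[OF y']]]] by simp
    qed
  qed (use pr_same pr_other one mult degree dd in auto)
qed

lemma gda_image:
  fixes A :: "('k, 'a) gda" and B :: "('k, 'b) gda"
  assumes A: "graded_diff_algebra K A" and B: "assoc_algebra K B" and hom: "alg_hom K A B e"
    and inj: "inj_on e (carrier A)" and carrier: "carrier B = e ` carrier A"
    and gcomp: "\<And>n. gcomp B n = e ` gcomp A n"
    and gdiff: "\<And>x. x \<in> carrier A \<Longrightarrow> gdiff B (e x) = e (gdiff A x)"
  shows "graded_diff_algebra K B"
proof -
  interpret A: graded_diff_algebra K A by (rule A)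
  have MA: "module K A" by (rule A.gda_module)
  have MB: "module K B" by (rule assoc_algebra_module[OF B])
  interpret RB: ring B by (rule assoc_algebra_ring[OF B])
  have lin: "lin_map K A B e" by (rule alg_hom_lin[OF hom])
  note e_add = lin_map_add[OF lin] and e_smult = lin_map_smult[OF lin]
    and e_zero = lin_map_zero[OF MA MB lin] and e_mult = alg_hom_mult[OF hom]
    and e_sign = lin_map_sign_pow[OF MA MB lin] and e_uminus = lin_map_uminus[OF MA MB lin]
  note e_closed [simp] = lin_map_closed[OF lin]
  have image_lin: "lin_map K B B f"
    if g: "lin_map K A A g" and fe: "\<And>x. x \<in> carrier A \<Longrightarrow> f (e x) = e (g x)" for f g
    using lin_map_closed[OF g] lin_map_add[OF g] lin_map_smult[OF g]
    by (intro lin_mapI)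
      (auto simp: carrier fe e_add[symmetric] e_smult[symmetric])
  show ?thesis
  proof (rule gdaI[OF B, where pr = "\<lambda>n y. e (hom_part A n (inv_into (carrier A) e y))"])
    show "submodule (gcomp B n) K B" for n
      by (rule module.submoduleI[OF MB])
        (auto simp: gcomp e_zero[symmetric] e_uminus[symmetric] e_add[symmetric] e_smult[symmetric]
          A.gcomp_uminus A.gcomp_add A.gcomp_smult)
    have "e x \<in> graded_span B (gcomp B)" if "x \<in> carrier A" for x
      using that
      by (induction rule: A.graded_induct)
        (auto simp: e_zero e_add gcomp intro!: graded_span.zero graded_span.add)
    then show "carrier B \<subseteq> graded_span B (gcomp B)" by (auto simp: carrier)
    show "lin_map K B B (\<lambda>y. e (hom_part A n (inv_into (carrier A) e y)))" for n
      by (rule image_lin[OF A.hom_part_linear[of n]]) (simp add: inj)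
    show "lin_map K B B (gdiff B)" by (rule image_lin[OF A.gdiff_linear gdiff])
    show "gdiff B (x \<otimes>\<^bsub>B\<^esub> y) = gdiff B x \<otimes>\<^bsub>B\<^esub> y \<oplus>\<^bsub>B\<^esub> sign_pow B m (x \<otimes>\<^bsub>B\<^esub> gdiff B y)"
      if x: "x \<in> gcomp B m" and y: "y \<in> gcomp B n" for m n x y
    proof -
      obtain u v where u: "u \<in> gcomp A m" "x = e u" and v: "v \<in> gcomp A n" "y = e v"
        using x y by (auto simp: gcomp)
      then have [simp]: "u \<in> carrier A" "v \<in> carrier A" by auto
      show ?thesis
        using A.gdiff_leibniz[OF u(1), of v]
        by (simp add: u(2) v(2) gdiff e_add[symmetric] e_mult[symmetric] e_sign[symmetric])
    qed
  qed (auto simp: gcomp inj A.hom_part_homogeneous e_zero alg_hom_one[OF hom, symmetric]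
      e_mult[symmetric] gdiff A.gdiff_gdiff A.gcomp_one A.gcomp_mult A.gdiff_degree)
qed

definition transported_gda :: "('a \<Rightarrow> 'c) \<Rightarrow> ('k, 'a) gda \<Rightarrow> ('k, 'c) gda" where
  "transported_gda e A = module.extend (transported_algebra e A)
     \<lparr>gcomp = (\<lambda>n. e ` gcomp A n), gdiff = (\<lambda>y. e (gdiff A (inv_into (carrier A) e y)))\<rparr>"

lemma gda_homI:
  assumes "alg_hom K A B f" "\<And>n x. x \<in> gcomp A n \<Longrightarrow> f x \<in> gcomp B n"
    and "\<And>x. x \<in> carrier A \<Longrightarrow> f (gdiff A x) = gdiff B (f x)"
  shows "gda_hom K A B f"
  using assms by (auto simp: gda_hom_def)

lemma gda_homD:
  assumes "gda_hom K A B f"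
  shows "alg_hom K A B f" "\<And>n x. x \<in> gcomp A n \<Longrightarrow> f x \<in> gcomp B n"
    and "\<And>x. x \<in> carrier A \<Longrightarrow> f (gdiff A x) = gdiff B (f x)"
  using assms by (auto simp: gda_hom_def)

lemma gda_hom_comp:
  assumes "gda_hom K A B f" "gda_hom K B C g"
  shows "gda_hom K A C (\<lambda>x. g (f x))"
  using gda_homD[OF assms(1)] gda_homD[OF assms(2)]
  by (intro gda_homI alg_hom_comp[OF gda_homD(1)[OF assms(1)] gda_homD(1)[OF assms(2)]])
    (auto simp: lin_map_closed[OF alg_hom_lin])

lemma transported_gda:
  assumes A: "graded_diff_algebra K A" and inj: "inj_on e (carrier A)"
  shows "graded_diff_algebra K (transported_gda e A)" (is "graded_diff_algebra K ?B")
    and "gda_hom K A (transported_gda e A) e"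
    and "gda_hom K (transported_gda e A) A (inv_into (carrier A) e)"
proof -
  interpret A: graded_diff_algebra K A by (rule A)
  note T = transported_algebra[OF A.gda_algebra inj]
  have fields: "carrier ?B = e ` carrier A" "zero ?B = e \<zero>\<^bsub>A\<^esub>"
    "gcomp ?B = (\<lambda>n. e ` gcomp A n)"
    "gdiff ?B = (\<lambda>y. e (gdiff A (inv_into (carrier A) e y)))"
    by (simp_all add: transported_gda_def transported_algebra_def module.defs Let_def)
  have hom: "alg_hom K A ?B e"
    using T(2) by (simp add: transported_gda_def transported_algebra_def module.defs Let_def
        alg_hom_def ring_hom_def lin_map_def)
  have hom': "alg_hom K ?B A (inv_into (carrier A) e)"
    using T(3) by (simp add: transported_gda_def transported_algebra_def module.defs Let_def
        alg_hom_def ring_hom_def lin_map_def)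
  have B: "assoc_algebra K ?B"
    by (rule assoc_algebra_image[OF A.gda_algebra fields(1) hom fields(2)])
  show "graded_diff_algebra K ?B"
    by (rule gda_image[OF A B hom inj]) (auto simp: fields inj)
  show "gda_hom K A ?B e"
    by (rule gda_homI[OF hom]) (auto simp: fields inj)
  show "gda_hom K ?B A (inv_into (carrier A) e)"
    by (rule gda_homI[OF hom']) (auto simp: fields inj)
qed

section \<open>Universal properties\<close>

text \<open>The universal property for targets of any type that injects into the type for which it is assumed:
  extend to the copy of the target and return along the inverse.\<close>

lemma envelope_extension:
  fixes B :: "('k, 'b) gda" and e :: "'b \<Rightarrow> 'c"
  assumes env: "differential_envelope TYPE('c) K A \<Omega> \<iota>"
    and B: "graded_diff_algebra K B" and inj: "inj_on e (carrier B)"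
    and \<phi>: "alg_hom K A B \<phi>" "\<phi> ` carrier A \<subseteq> gcomp B 0"
  obtains \<Phi> where "gda_hom K \<Omega> B \<Phi>" "\<And>a. a \<in> carrier A \<Longrightarrow> \<Phi> (\<iota> a) = \<phi> a"
    and "\<And>\<Psi> x. \<lbrakk>gda_hom K \<Omega> B \<Psi>; \<And>a. a \<in> carrier A \<Longrightarrow> \<Psi> (\<iota> a) = \<phi> a; x \<in> carrier \<Omega>\<rbrakk>
      \<Longrightarrow> \<Psi> x = \<Phi> x"
proof -
  let ?T = "transported_gda e B" and ?r = "inv_into (carrier B) e"
  note T = transported_gda[OF B inj]
  have univ: "\<exists>\<Phi>. gda_hom K \<Omega> ?T \<Phi> \<and> (\<forall>a\<in>carrier A. \<Phi> (\<iota> a) = e (\<phi> a)) \<and>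
         (\<forall>\<Psi>. gda_hom K \<Omega> ?T \<Psi> \<and> (\<forall>a\<in>carrier A. \<Psi> (\<iota> a) = e (\<phi> a)) \<longrightarrow>
              (\<forall>x\<in>carrier \<Omega>. \<Psi> x = \<Phi> x))"
    using env T(1) alg_hom_comp[OF \<phi>(1) gda_homD(1)[OF T(2)]] \<phi>(2) gda_homD(2)[OF T(2)]
    unfolding differential_envelope_def by blast
  obtain \<Phi> where \<Phi>: "gda_hom K \<Omega> ?T \<Phi>" "\<And>a. a \<in> carrier A \<Longrightarrow> \<Phi> (\<iota> a) = e (\<phi> a)"
    and unique: "\<And>\<Psi> x. \<lbrakk>gda_hom K \<Omega> ?T \<Psi>; \<And>a. a \<in> carrier A \<Longrightarrow> \<Psi> (\<iota> a) = e (\<phi> a); x \<in> carrier \<Omega>\<rbrakk>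
      \<Longrightarrow> \<Psi> x = \<Phi> x"
    using univ by blast
  have r: "?r (e y) = y" if "y \<in> carrier B" for y using that inj by simp
  show thesis
  proof
    show "gda_hom K \<Omega> B (\<lambda>x. ?r (\<Phi> x))" by (rule gda_hom_comp[OF \<Phi>(1) T(3)])
    show "?r (\<Phi> (\<iota> a)) = \<phi> a" if "a \<in> carrier A" for a
      using \<Phi>(2)[OF that] r lin_map_closed[OF alg_hom_lin[OF \<phi>(1)] that] by simp
    fix \<Psi> x assume \<Psi>: "gda_hom K \<Omega> B \<Psi>" "\<And>a. a \<in> carrier A \<Longrightarrow> \<Psi> (\<iota> a) = \<phi> a" and x: "x \<in> carrier \<Omega>"
    have "e (\<Psi> x) = \<Phi> x"
      by (rule unique[OF gda_hom_comp[OF \<Psi>(1) T(2)] _ x]) (simp add: \<Psi>(2))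
    then show "\<Psi> x = ?r (\<Phi> x)"
      using r lin_map_closed[OF alg_hom_lin[OF gda_homD(1)[OF \<Psi>(1)]] x] by metis
  qed
qed

lemma envelope_gda: "differential_envelope T K A \<Omega> \<iota> \<Longrightarrow> graded_diff_algebra K \<Omega>"
  by (simp add: differential_envelope_def)

lemma envelope_gda_hom_eq:
  fixes B :: "('k, 'b) gda" and e :: "'b \<Rightarrow> 'c"
  assumes env: "differential_envelope TYPE('c) K A \<Omega> \<iota>"
    and B: "graded_diff_algebra K B" and inj: "inj_on e (carrier B)"
    and f: "gda_hom K \<Omega> B f" and g: "gda_hom K \<Omega> B g"
    and eq: "\<And>a. a \<in> carrier A \<Longrightarrow> f (\<iota> a) = g (\<iota> a)" and x: "x \<in> carrier \<Omega>"
  shows "f x = g x"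
proof -
  have \<iota>: "alg_hom K A \<Omega> \<iota>" "\<And>a. a \<in> carrier A \<Longrightarrow> \<iota> a \<in> gcomp \<Omega> 0"
    using env by (auto simp: differential_envelope_def bij_betw_def)
  have "alg_hom K A B (\<lambda>a. f (\<iota> a))" by (rule alg_hom_comp[OF \<iota>(1) gda_homD(1)[OF f]])
  moreover have "(\<lambda>a. f (\<iota> a)) ` carrier A \<subseteq> gcomp B 0" using \<iota>(2) gda_homD(2)[OF f] by blast
  ultimately obtain \<Phi> where "\<And>\<Psi> x. \<lbrakk>gda_hom K \<Omega> B \<Psi>; \<And>a. a \<in> carrier A \<Longrightarrow> \<Psi> (\<iota> a) = f (\<iota> a); x \<in> carrier \<Omega>\<rbrakk>
      \<Longrightarrow> \<Psi> x = \<Phi> x"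
    using envelope_extension[OF env B inj] by metis
  from this[OF f _ x] this[OF g _ x] show ?thesis using eq by simp
qed

text \<open>The envelope is generated by its degree zero part under \<open>d\<close> and products.  The homogeneous elements
  with the property \<open>P\<close> span a graded differential subalgebra \<open>B\<close>; extending \<open>\<iota>\<close> to a morphism into \<open>B\<close> and
  including \<open>B\<close> into \<open>\<Omega>\<close> gives an endomorphism of \<open>\<Omega>\<close> over \<open>A\<close>, hence the identity.  So every
  element of \<open>\<Omega>\<close> lies in \<open>B\<close>.\<close>

lemma envelope_induct [consumes 3, case_names add smult base diff mult]:
  fixes e :: "'w \<Rightarrow> 'c" and \<Omega> :: "('k, 'w) gda"
  assumes env: "differential_envelope TYPE('c) K A \<Omega> \<iota>" and inj: "inj e" and x: "x \<in> carrier \<Omega>"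
    and add: "\<And>x y. \<lbrakk>x \<in> carrier \<Omega>; y \<in> carrier \<Omega>; P x; P y\<rbrakk> \<Longrightarrow> P (x \<oplus>\<^bsub>\<Omega>\<^esub> y)"
    and smult: "\<And>c x. \<lbrakk>c \<in> carrier K; x \<in> carrier \<Omega>; P x\<rbrakk> \<Longrightarrow> P (c \<odot>\<^bsub>\<Omega>\<^esub> x)"
    and base: "\<And>a. a \<in> gcomp \<Omega> 0 \<Longrightarrow> P a"
    and diff: "\<And>n x. \<lbrakk>x \<in> gcomp \<Omega> n; P x\<rbrakk> \<Longrightarrow> P (gdiff \<Omega> x)"
    and mult: "\<And>m n x y. \<lbrakk>x \<in> gcomp \<Omega> m; y \<in> gcomp \<Omega> n; P x; P y\<rbrakk> \<Longrightarrow> P (x \<otimes>\<^bsub>\<Omega>\<^esub> y)"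
  shows "P x"
proof -
  interpret \<Omega>: graded_diff_algebra K \<Omega> by (rule envelope_gda[OF env])
  have \<iota>: "alg_hom K A \<Omega> \<iota>" "\<And>a. a \<in> carrier A \<Longrightarrow> \<iota> a \<in> gcomp \<Omega> 0"
    using env by (auto simp: differential_envelope_def bij_betw_def)
  define V where "V = (\<lambda>n. {x \<in> gcomp \<Omega> n. P x})"
  define B where "B = \<Omega>\<lparr>gcomp := V, carrier := graded_span \<Omega> V\<rparr>"
  have span_gcomp: "graded_span (\<Omega>\<lparr>gcomp := V\<rparr>) V = graded_span \<Omega> V"
  proof (intro equalityI subsetI)
    fix x assume "x \<in> graded_span (\<Omega>\<lparr>gcomp := V\<rparr>) V"
    then show "x \<in> graded_span \<Omega> V" by induction (auto intro: graded_span.intros)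
  next
    fix x assume "x \<in> graded_span \<Omega> V"
    then show "x \<in> graded_span (\<Omega>\<lparr>gcomp := V\<rparr>) V"
      by induction (use graded_span.zero[of "\<Omega>\<lparr>gcomp := V\<rparr>" V]
          graded_span.add[of _ V _ _ "\<Omega>\<lparr>gcomp := V\<rparr>"] in auto)
  qed
  let ?W = "\<Omega>\<lparr>gcomp := V\<rparr>"
  have hom_id: "alg_hom K \<Omega> ?W (\<lambda>x. x)" "alg_hom K ?W \<Omega> (\<lambda>x. x)"
    by (auto intro!: alg_homI lin_mapI)
  have W: "assoc_algebra K ?W"
    by (rule assoc_algebra_image[OF \<Omega>.gda_algebra _ hom_id(1)]) auto
  have MW: "module K ?W" by (rule assoc_algebra_module[OF W])
  have sign: "sign_pow ?W n x = sign_pow \<Omega> n x" if "x \<in> carrier \<Omega>" for n x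
    using lin_map_sign_pow[OF \<Omega>.gda_module MW alg_hom_lin[OF hom_id(1)] that, of n] by simp
  have uminus: "\<ominus>\<^bsub>?W\<^esub> x = \<ominus>\<^bsub>\<Omega>\<^esub> x" if "x \<in> carrier \<Omega>" for x
    using sign[OF that, of 1] by (simp add: sign_pow_def)
  have P_uminus: "P (\<ominus>\<^bsub>\<Omega>\<^esub> x)" if "x \<in> carrier \<Omega>" "P x" for x
    unfolding uminus_eq_smult[OF \<Omega>.gda_module that(1)] using that by (intro smult) auto
  have "graded_diff_algebra K (?W\<lparr>carrier := graded_span ?W (gcomp ?W)\<rparr>)"
  proof (rule graded_span_gda[OF W, where pr = "hom_part \<Omega>"])
    show "submodule (gcomp ?W n) K ?W" for n
      by (rule module.submoduleI[OF MW])
        (auto simp: V_def uminus[unfolded V_def] P_uminus \<Omega>.gcomp_uminus \<Omega>.gcomp_add \<Omega>.gcomp_smult base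
          intro: add smult)
    show "lin_map K ?W ?W (hom_part \<Omega> n)" for n
      using \<Omega>.hom_part_linear[of n] by (simp add: lin_map_def)
    show "lin_map K ?W ?W (gdiff ?W)"
      using \<Omega>.gdiff_linear by (simp add: lin_map_def)
    show "gdiff ?W (x \<otimes>\<^bsub>?W\<^esub> y) = gdiff ?W x \<otimes>\<^bsub>?W\<^esub> y \<oplus>\<^bsub>?W\<^esub> sign_pow ?W m (x \<otimes>\<^bsub>?W\<^esub> gdiff ?W y)"
      if "x \<in> gcomp ?W m" "y \<in> gcomp ?W n" for m n x y
    proof -
      have "x \<in> gcomp \<Omega> m" "x \<in> carrier \<Omega>" "y \<in> carrier \<Omega>" using that by (auto simp: V_def)
      then show ?thesis using \<Omega>.gdiff_leibniz[of x m y] by (simp add: sign)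
    qed
  qed (auto simp: V_def \<Omega>.hom_part_homogeneous \<Omega>.gcomp_one base \<Omega>.gcomp_mult mult \<Omega>.gdiff_degree
      diff \<Omega>.gdiff_gdiff)
  then have B: "graded_diff_algebra K B" by (simp add: B_def span_gcomp)
  interpret B: graded_diff_algebra K B by (rule B)
  have span: "x \<in> carrier \<Omega> \<and> P x" if "x \<in> graded_span \<Omega> V" for x
    using that by induction (auto simp: V_def base intro: add)
  have carrier_B: "x \<in> carrier \<Omega>" "P x" if "x \<in> carrier B" for x
    using span[of x] that by (auto simp: B_def)
  have incl: "gda_hom K B \<Omega> (\<lambda>x. x)"
    using carrier_B(1) by (auto intro!: gda_homI alg_homI lin_mapI simp: B_def V_def)
  have \<iota>V: "\<iota> a \<in> gcomp B 0" if "a \<in> carrier A" for a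
    using \<iota>(2)[OF that] base by (simp add: B_def V_def)
  have "alg_hom K A B \<iota>"
    using \<iota>(1) B.gcomp_carrier[OF \<iota>V] by (auto simp: alg_hom_def lin_map_def ring_hom_def B_def)
  moreover have "inj_on e (carrier B)" using inj by (rule inj_on_subset) simp
  ultimately obtain \<Phi> where \<Phi>: "gda_hom K \<Omega> B \<Phi>" "\<And>a. a \<in> carrier A \<Longrightarrow> \<Phi> (\<iota> a) = \<iota> a"
    using envelope_extension[OF env B] \<iota>V by (metis image_subsetI)
  have "\<Phi> x = x"
  proof (rule envelope_gda_hom_eq[OF env \<Omega>.graded_diff_algebra_axioms _ gda_hom_comp[OF \<Phi>(1) incl] _ \<Phi>(2) x])
    show "inj_on e (carrier \<Omega>)" using inj by (rule inj_on_subset) simp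
    show "gda_hom K \<Omega> \<Omega> (\<lambda>x. x)" by (auto intro!: gda_homI alg_homI lin_mapI)
  qed
  then show "P x"
    using carrier_B(2)[of "\<Phi> x"] lin_map_closed[OF alg_hom_lin[OF gda_homD(1)[OF \<Phi>(1)]] x] by simp
qed

lemma lie_to_alg_hom_comp:
  assumes \<phi>: "lie_to_alg_hom K G A \<phi>" and A: "assoc_algebra K A" and B: "assoc_algebra K B"
    and f: "alg_hom K A B f"
  shows "lie_to_alg_hom K G B (\<lambda>x. f (\<phi> x))"
proof -
  interpret A: ring A by (rule assoc_algebra_ring[OF A])
  have \<phi>': "lin_map K G A \<phi>" using \<phi> by (simp add: lie_to_alg_hom_def)
  show ?thesis
    using \<phi> lin_map_comp[OF \<phi>' alg_hom_lin[OF f]] lin_map_closed[OF \<phi>'] alg_hom_mult[OF f]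
      lin_map_minus[OF assoc_algebra_module[OF A] assoc_algebra_module[OF B] alg_hom_lin[OF f]]
    by (auto simp: lie_to_alg_hom_def)
qed

lemma enveloping_extension:
  fixes B :: "('k, 'b, 'm) module_scheme" and e :: "'b \<Rightarrow> 'c"
  assumes env: "universal_enveloping_algebra TYPE('c) K G U j"
    and B: "assoc_algebra K B" and inj: "inj_on e (carrier B)"
    and \<phi>: "lie_to_alg_hom K G B \<phi>"
  obtains \<Phi> where "alg_hom K U B \<Phi>" "\<And>x. x \<in> carrier G \<Longrightarrow> \<Phi> (j x) = \<phi> x"
    and "\<And>\<Psi> u. \<lbrakk>alg_hom K U B \<Psi>; \<And>x. x \<in> carrier G \<Longrightarrow> \<Psi> (j x) = \<phi> x; u \<in> carrier U\<rbrakk>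
      \<Longrightarrow> \<Psi> u = \<Phi> u"
proof -
  let ?T = "transported_algebra e B" and ?r = "inv_into (carrier B) e"
  note T = transported_algebra[OF B inj]
  have univ: "\<exists>\<Phi>. alg_hom K U ?T \<Phi> \<and> (\<forall>x\<in>carrier G. \<Phi> (j x) = e (\<phi> x)) \<and>
         (\<forall>\<Psi>. alg_hom K U ?T \<Psi> \<and> (\<forall>x\<in>carrier G. \<Psi> (j x) = e (\<phi> x)) \<longrightarrow>
              (\<forall>u\<in>carrier U. \<Psi> u = \<Phi> u))"
    using env T(1) lie_to_alg_hom_comp[OF \<phi> B T(1,2)]
    unfolding universal_enveloping_algebra_def by blast
  obtain \<Phi> where \<Phi>: "alg_hom K U ?T \<Phi>" "\<And>x. x \<in> carrier G \<Longrightarrow> \<Phi> (j x) = e (\<phi> x)"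
    and unique: "\<And>\<Psi> u. \<lbrakk>alg_hom K U ?T \<Psi>; \<And>x. x \<in> carrier G \<Longrightarrow> \<Psi> (j x) = e (\<phi> x); u \<in> carrier U\<rbrakk>
      \<Longrightarrow> \<Psi> u = \<Phi> u"
    using univ by blast
  have r: "?r (e y) = y" if "y \<in> carrier B" for y using that inj by simp
  have \<phi>B: "\<phi> x \<in> carrier B" if "x \<in> carrier G" for x
    using \<phi> that by (auto simp: lie_to_alg_hom_def lin_map_def)
  show thesis
  proof
    show "alg_hom K U B (\<lambda>u. ?r (\<Phi> u))" by (rule alg_hom_comp[OF \<Phi>(1) T(3)])
    show "?r (\<Phi> (j x)) = \<phi> x" if "x \<in> carrier G" for x
      using \<Phi>(2)[OF that] r \<phi>B[OF that] by simp
    fix \<Psi> u assume \<Psi>: "alg_hom K U B \<Psi>" "\<And>x. x \<in> carrier G \<Longrightarrow> \<Psi> (j x) = \<phi> x" and u: "u \<in> carrier U"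
    have "e (\<Psi> u) = \<Phi> u"
      by (rule unique[OF alg_hom_comp[OF \<Psi>(1) T(2)] _ u]) (simp add: \<Psi>(2))
    then show "\<Psi> u = ?r (\<Phi> u)"
      using r lin_map_closed[OF alg_hom_lin[OF \<Psi>(1)] u] by metis
  qed
qed

text \<open>The elements \<open>u\<close> for which \<open>P h\<close> implies \<open>P (h u)\<close> form a subalgebra \<open>E\<close> that contains \<open>g\<close>.  The morphism
  \<open>U(g) \<rightarrow> E \<subseteq> U(g)\<close> over \<open>g\<close> is the identity, whence \<open>E = U(g)\<close>; then take \<open>h = 1\<close>.\<close>

lemma enveloping_induct [consumes 3, case_names one add smult mult]:
  fixes U :: "('k, 'u, 'm) module_scheme" and e :: "'u \<Rightarrow> 'c"
  assumes env: "universal_enveloping_algebra TYPE('c) K G U j" and inj: "inj e"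
    and u: "u \<in> carrier U"
    and one: "P \<one>\<^bsub>U\<^esub>"
    and add: "\<And>g h. \<lbrakk>g \<in> carrier U; h \<in> carrier U; P g; P h\<rbrakk> \<Longrightarrow> P (g \<oplus>\<^bsub>U\<^esub> h)"
    and smult: "\<And>c h. \<lbrakk>c \<in> carrier K; h \<in> carrier U; P h\<rbrakk> \<Longrightarrow> P (c \<odot>\<^bsub>U\<^esub> h)"
    and mult: "\<And>h X. \<lbrakk>h \<in> carrier U; X \<in> carrier G; P h\<rbrakk> \<Longrightarrow> P (h \<otimes>\<^bsub>U\<^esub> j X)"
  shows "P u"
proof -
  have U: "assoc_algebra K U" and j: "lie_to_alg_hom K G U j"
    using env by (auto simp: universal_enveloping_algebra_def)
  interpret R: ring U by (rule assoc_algebra_ring[OF U])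
  interpret M: module K U by (rule assoc_algebra_module[OF U])
  have jU: "j X \<in> carrier U" if "X \<in> carrier G" for X
    using j that by (auto simp: lie_to_alg_hom_def lin_map_def)
  define E where "E = {u \<in> carrier U. \<forall>h\<in>carrier U. P h \<longrightarrow> P (h \<otimes>\<^bsub>U\<^esub> u)}"
  have P0: "P \<zero>\<^bsub>U\<^esub>" using smult[of "\<zero>\<^bsub>K\<^esub>" "\<one>\<^bsub>U\<^esub>"] one by simp
  have E: "assoc_algebra K (U\<lparr>carrier := E\<rparr>)"
    by (rule assoc_algebra_subalgebra[OF U])
      (auto simp: E_def P0 R.r_distr R.m_assoc[symmetric] assoc_algebra.smult_mult_right[OF U]
        intro: add smult)
  have incl: "alg_hom K (U\<lparr>carrier := E\<rparr>) U (\<lambda>x. x)"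
    by (auto intro!: alg_homI lin_mapI simp: E_def)
  have jE: "j X \<in> E" if "X \<in> carrier G" for X using mult that jU by (auto simp: E_def)
  have "x \<ominus>\<^bsub>U\<lparr>carrier := E\<rparr>\<^esub> y = x \<ominus>\<^bsub>U\<^esub> y" if "x \<in> E" "y \<in> E" for x y
    using lin_map_minus[OF assoc_algebra_module[OF E] assoc_algebra_module[OF U] alg_hom_lin[OF incl],
        of x y] that by simp
  moreover have "x \<otimes>\<^bsub>U\<^esub> y \<in> E" if "x \<in> E" "y \<in> E" for x y
    using ring.ring_simprules(5)[OF assoc_algebra_ring[OF E], of x y] that by simp
  ultimately have "lie_to_alg_hom K G (U\<lparr>carrier := E\<rparr>) j"
    using j jE by (auto simp: lie_to_alg_hom_def lin_map_def)
  moreover have "inj_on e (carrier (U\<lparr>carrier := E\<rparr>))" "inj_on e (carrier U)"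
    using inj by (auto intro: inj_on_subset)
  ultimately obtain \<Phi> where \<Phi>: "alg_hom K U (U\<lparr>carrier := E\<rparr>) \<Phi>"
      "\<And>x. x \<in> carrier G \<Longrightarrow> \<Phi> (j x) = j x"
    using enveloping_extension[OF env E] by metis
  obtain \<Phi>' where unique: "\<And>\<Psi> u. \<lbrakk>alg_hom K U U \<Psi>; \<And>x. x \<in> carrier G \<Longrightarrow> \<Psi> (j x) = j x; u \<in> carrier U\<rbrakk>
      \<Longrightarrow> \<Psi> u = \<Phi>' u"
    using enveloping_extension[OF env U \<open>inj_on e (carrier U)\<close> j] by metis
  have "alg_hom K U U (\<lambda>x. x)" by (auto intro!: alg_homI lin_mapI)
  then have "\<Phi> u = u"
    using unique[OF alg_hom_comp[OF \<Phi>(1) incl] \<Phi>(2) u] unique[of "\<lambda>x. x" u] u by simp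
  then have "u \<in> E" using lin_map_closed[OF alg_hom_lin[OF \<Phi>(1)] u] by simp
  then show "P u" using one u by (auto simp: E_def dest: bspec[of _ _ "\<one>\<^bsub>U\<^esub>"])
qed

section \<open>Homotopies between morphisms out of a differential envelope\<close>

text \<open>A triple \<open>(a, p, q)\<close> is the upper triangular matrix with diagonal \<open>a, q\<close> and corner \<open>p\<close>.  The corner has
  degree one less than the diagonal; this accounts for the sign in the product.  The differential is
  \<open>d\<close> plus the graded commutator with the matrix unit \<open>(0, 1, 0)\<close>, which has degree one; the commutator
  contributes \<open>q - a\<close>, and \<open>d\<close> anticommutes with the shift of the corner.\<close>

definition triangular_gda :: "('k, 'b) gda \<Rightarrow> ('k, 'b \<times> 'b \<times> 'b) gda" where
  "triangular_gda C =
     \<lparr>carrier = carrier C \<times> carrier C \<times> carrier C,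
      mult = (\<lambda>(a, p, q) (a', p', q').
        (a \<otimes>\<^bsub>C\<^esub> a', p \<otimes>\<^bsub>C\<^esub> q' \<oplus>\<^bsub>C\<^esub> grade_involution C a \<otimes>\<^bsub>C\<^esub> p', q \<otimes>\<^bsub>C\<^esub> q')),
      one = (\<one>\<^bsub>C\<^esub>, \<zero>\<^bsub>C\<^esub>, \<one>\<^bsub>C\<^esub>),
      zero = (\<zero>\<^bsub>C\<^esub>, \<zero>\<^bsub>C\<^esub>, \<zero>\<^bsub>C\<^esub>),
      add = (\<lambda>(a, p, q) (a', p', q'). (a \<oplus>\<^bsub>C\<^esub> a', p \<oplus>\<^bsub>C\<^esub> p', q \<oplus>\<^bsub>C\<^esub> q')),
      smult = (\<lambda>c (a, p, q). (c \<odot>\<^bsub>C\<^esub> a, c \<odot>\<^bsub>C\<^esub> p, c \<odot>\<^bsub>C\<^esub> q)),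
      gcomp = (\<lambda>n. gcomp C n \<times> (case n of 0 \<Rightarrow> {\<zero>\<^bsub>C\<^esub>} | Suc m \<Rightarrow> gcomp C m) \<times> gcomp C n),
      gdiff = (\<lambda>(a, p, q). (gdiff C a, (q \<ominus>\<^bsub>C\<^esub> a) \<ominus>\<^bsub>C\<^esub> gdiff C p, gdiff C q))\<rparr>"

lemma triangular_gda_simps:
  "carrier (triangular_gda C) = carrier C \<times> carrier C \<times> carrier C"
  "(a, p, q) \<otimes>\<^bsub>triangular_gda C\<^esub> (a', p', q') =
    (a \<otimes>\<^bsub>C\<^esub> a', p \<otimes>\<^bsub>C\<^esub> q' \<oplus>\<^bsub>C\<^esub> grade_involution C a \<otimes>\<^bsub>C\<^esub> p', q \<otimes>\<^bsub>C\<^esub> q')"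
  "\<one>\<^bsub>triangular_gda C\<^esub> = (\<one>\<^bsub>C\<^esub>, \<zero>\<^bsub>C\<^esub>, \<one>\<^bsub>C\<^esub>)"
  "\<zero>\<^bsub>triangular_gda C\<^esub> = (\<zero>\<^bsub>C\<^esub>, \<zero>\<^bsub>C\<^esub>, \<zero>\<^bsub>C\<^esub>)"
  "(a, p, q) \<oplus>\<^bsub>triangular_gda C\<^esub> (a', p', q') = (a \<oplus>\<^bsub>C\<^esub> a', p \<oplus>\<^bsub>C\<^esub> p', q \<oplus>\<^bsub>C\<^esub> q')"
  "c \<odot>\<^bsub>triangular_gda C\<^esub> (a, p, q) = (c \<odot>\<^bsub>C\<^esub> a, c \<odot>\<^bsub>C\<^esub> p, c \<odot>\<^bsub>C\<^esub> q)"
  "gcomp (triangular_gda C) n =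
    gcomp C n \<times> (case n of 0 \<Rightarrow> {\<zero>\<^bsub>C\<^esub>} | Suc m \<Rightarrow> gcomp C m) \<times> gcomp C n"
  "gdiff (triangular_gda C) (a, p, q) = (gdiff C a, (q \<ominus>\<^bsub>C\<^esub> a) \<ominus>\<^bsub>C\<^esub> gdiff C p, gdiff C q)"
  by (simp_all add: triangular_gda_def)

text \<open>The cancellation of the term \<open>X = a q'\<close> in the Leibniz rule for triangular matrices.\<close>

lemma (in abelian_group) add_cancel_middle:
  assumes "Q \<in> carrier G" "N \<in> carrier G" "X \<in> carrier G" "P \<in> carrier G" "D \<in> carrier G"
    "R \<in> carrier G" "Y \<in> carrier G"
  shows "((Q \<ominus> X \<ominus> P) \<oplus> D) \<oplus> (R \<oplus> (X \<ominus> N \<ominus> Y)) = (Q \<ominus> N) \<ominus> ((P \<ominus> R) \<oplus> (Y \<ominus> D))"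
proof -
  have "((Q \<ominus> X \<ominus> P) \<oplus> D) \<oplus> (R \<oplus> (X \<ominus> N \<ominus> Y)) =
      ((Q \<ominus> N) \<ominus> ((P \<ominus> R) \<oplus> (Y \<ominus> D))) \<oplus> (X \<oplus> \<ominus> X)"
    using assms by (simp add: a_minus_def minus_add a_ac del: add.r_inv)
  then show ?thesis using assms by (simp add: r_neg)
qed

context gda
begin

lemma triangular_algebra: "assoc_algebra K (triangular_gda \<Omega>)"
proof -
  note lin = grade_involution_linear
  note [simp] = lin_map_closed[OF lin] and g_add = lin_map_add[OF lin]
    and g_smult = lin_map_smult[OF lin] and g_mult = grade_involution_mult
  have g_one: "grade_involution \<Omega> \<one> = \<one>"
    using grade_involution_homogeneous[OF gcomp_one] by (simp add: sign_pow_def)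
  show ?thesis
    by (rule assoc_algebraI)
      (auto simp: triangular_gda_simps K.field_axioms M.a_ac A.m_assoc A.l_distr A.r_distr
        g_add g_smult g_mult g_one smult_l_distr smult_r_distr smult_assoc1 smult_mult_left
        smult_mult_right)
qed

lemma triangular_uminus:
  assumes "a \<in> carrier \<Omega>" "p \<in> carrier \<Omega>" "q \<in> carrier \<Omega>"
  shows "\<ominus>\<^bsub>triangular_gda \<Omega>\<^esub> (a, p, q) = (\<ominus> a, \<ominus> p, \<ominus> q)"
  using uminus_eq_smult[OF assoc_algebra_module[OF triangular_algebra], of "(a, p, q)"] assms
  by (simp add: triangular_gda_def uminus_eq_smult[OF gda_module])

lemma triangular_sign_pow:
  assumes "a \<in> carrier \<Omega>" "p \<in> carrier \<Omega>" "q \<in> carrier \<Omega>"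
  shows "sign_pow (triangular_gda \<Omega>) n (a, p, q) =
    (sign_pow \<Omega> n a, sign_pow \<Omega> n p, sign_pow \<Omega> n q)"
  using assms by (simp add: sign_pow_def triangular_uminus)

text \<open>Only the corner needs work: there \<open>a q'\<close> appears once from \<open>(q - a) q'\<close> and once from \<open>a (q' - a')\<close>, with
  opposite signs.\<close>

lemma triangular_leibniz:
  assumes x: "x \<in> gcomp (triangular_gda \<Omega>) m" and y: "y \<in> carrier (triangular_gda \<Omega>)"
  shows "gdiff (triangular_gda \<Omega>) (x \<otimes>\<^bsub>triangular_gda \<Omega>\<^esub> y) =
    gdiff (triangular_gda \<Omega>) x \<otimes>\<^bsub>triangular_gda \<Omega>\<^esub> y \<oplus>\<^bsub>triangular_gda \<Omega>\<^esub>
    sign_pow (triangular_gda \<Omega>) m (x \<otimes>\<^bsub>triangular_gda \<Omega>\<^esub> gdiff (triangular_gda \<Omega>) y)"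
proof -
  obtain a p q where xe: "x = (a, p, q)" by (cases x) auto
  obtain a' p' q' where ye: "y = (a', p', q')" by (cases y) auto
  have a: "a \<in> gcomp \<Omega> m" and q: "q \<in> gcomp \<Omega> m"
    and p: "p \<in> (case m of 0 \<Rightarrow> {\<zero>} | Suc k \<Rightarrow> gcomp \<Omega> k)"
    using x by (auto simp: xe triangular_gda_def)
  have [simp]: "a' \<in> carrier \<Omega>" "p' \<in> carrier \<Omega>" "q' \<in> carrier \<Omega>"
    using y by (auto simp: ye triangular_gda_def)
  have [simp]: "a \<in> carrier \<Omega>" "q \<in> carrier \<Omega>" using a q by auto
  have pc [simp]: "p \<in> carrier \<Omega>" using p by (auto split: nat.splits)
  note sgn = grade_involution_homogeneous[OF a] grade_involution_homogeneous[OF gdiff_degree[OF a]]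
  \<comment> \<open>\<open>p\<close> has degree \<open>m - 1\<close>; the formula with the opposite of the sign \<open>(-1)\<^sup>m\<close> also covers \<open>m = 0\<close>, where
    \<open>p = 0\<close>.\<close>
  have dpq: "gdiff \<Omega> (p \<otimes> q') =
      gdiff \<Omega> p \<otimes> q' \<ominus> sign_pow \<Omega> m (p \<otimes> gdiff \<Omega> q')"
  proof (cases m)
    case 0
    then show ?thesis using p by (simp add: sign_pow_def a_minus_def)
  next
    case (Suc k)
    then show ?thesis using p gdiff_leibniz[of p k q'] by (simp add: sign_pow_def a_minus_def)
  qed
  have middle: "(q \<otimes> q' \<ominus> a \<otimes> a') \<ominus>
      gdiff \<Omega> (p \<otimes> q' \<oplus> sign_pow \<Omega> m a \<otimes> p') =
    (((q \<ominus> a) \<ominus> gdiff \<Omega> p) \<otimes> q' \<oplus> sign_pow \<Omega> (Suc m) (gdiff \<Omega> a) \<otimes> p') \<oplus>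
      sign_pow \<Omega> m (p \<otimes> gdiff \<Omega> q' \<oplus>
        sign_pow \<Omega> m a \<otimes> ((q' \<ominus> a') \<ominus> gdiff \<Omega> p'))"
  proof -
    have [simp]: "sign_pow \<Omega> n (x \<oplus> y) = sign_pow \<Omega> n x \<oplus> sign_pow \<Omega> n y"
      if "x \<in> carrier \<Omega>" "y \<in> carrier \<Omega>" for n x y
      using that by (rule sign_pow_add[OF gda_abelian_group])
    have 1: "sign_pow \<Omega> m (sign_pow \<Omega> m z) = z" if "z \<in> carrier \<Omega>" for z
      using that by (simp add: sign_pow_def)
    have 2: "sign_pow \<Omega> (Suc m) z = \<ominus> sign_pow \<Omega> m z" if "z \<in> carrier \<Omega>" for z
      using that by (simp add: sign_pow_def)
    have 3: "sign_pow \<Omega> m (\<ominus> sign_pow \<Omega> m z) = \<ominus> z" if "z \<in> carrier \<Omega>" for z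
      using that by (simp add: sign_pow_def)
    have d: "gdiff \<Omega> (p \<otimes> q' \<oplus> sign_pow \<Omega> m a \<otimes> p') =
        (gdiff \<Omega> p \<otimes> q' \<ominus> sign_pow \<Omega> m (p \<otimes> gdiff \<Omega> q')) \<oplus>
        (a \<otimes> gdiff \<Omega> p' \<ominus> sign_pow \<Omega> (Suc m) (gdiff \<Omega> a \<otimes> p'))"
      using gdiff_leibniz[OF a, of p']
      by (simp add: gdiff_add dpq sign_pow_mult_left gdiff_sign_pow 1 2 a_minus_def M.a_comm)
    show ?thesis
      unfolding d
      by (subst add_cancel_middle[symmetric, where X = "a \<otimes> q'"])
        (simp_all add: a_minus_def sign_pow_mult_left sign_pow_mult_right A.l_distr A.r_distr
          A.l_minus A.r_minus 1 2 3)
  qed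
  show ?thesis
    using middle gdiff_leibniz[OF a, of a'] gdiff_leibniz[OF q, of q'] 
    by (simp add: triangular_gda_simps triangular_sign_pow xe ye sgn)
qed

lemma triangular_gda: "graded_diff_algebra K (triangular_gda \<Omega>)" (is "graded_diff_algebra K ?T")
proof -
  note MT = assoc_algebra_module[OF triangular_algebra]
  interpret T: ring ?T by (rule assoc_algebra_ring[OF triangular_algebra])
  define pr where "pr = (\<lambda>n (a, p, q). (hom_part \<Omega> n a,
      (case n of 0 \<Rightarrow> \<zero> | Suc m \<Rightarrow> hom_part \<Omega> m p), hom_part \<Omega> n q))"
  have comp_carrier: "x \<in> carrier ?T" if "x \<in> gcomp ?T n" for x n
    using that by (auto simp: triangular_gda_simps split: nat.splits)
  have span: "(a, p, q) \<in> graded_span ?T (gcomp ?T)"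
    if a: "a \<in> carrier \<Omega>" and p: "p \<in> carrier \<Omega>" and q: "q \<in> carrier \<Omega>" for a p q
  proof -
    define S where "S = graded_span ?T (gcomp ?T)"
    have S0: "(\<zero>, \<zero>, \<zero>) \<in> S"
      using graded_span.zero[of ?T "gcomp ?T"] unfolding triangular_gda_simps(4) S_def .
    have step: "(b \<oplus> a, r \<oplus> p, s \<oplus> q) \<in> S"
      if "(b, r, s) \<in> gcomp ?T n" "(a, p, q) \<in> S" for b r s a p q n
      using graded_span.add[where R = ?T and V = "gcomp ?T", OF that[unfolded S_def]]
      unfolding triangular_gda_simps(5) S_def .
    have A: "(a, \<zero>, \<zero>) \<in> S"
      using a
    proof (induction rule: graded_induct)
      case zero
      show ?case by (rule S0)
    next
      case (add n x y)
      then show ?case using step[of x "\<zero>" "\<zero>" n y "\<zero>" "\<zero>"]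
        by (simp add: triangular_gda_simps split: nat.splits)
    qed
    have AP: "(a, p, \<zero>) \<in> S"
      using p
    proof (induction rule: graded_induct)
      case zero
      then show ?case by (rule A)
    next
      case (add n x y)
      then show ?case using step[of "\<zero>" x "\<zero>" "Suc n" a y "\<zero>"] a
        by (simp add: triangular_gda_simps)
    qed
    from q have "(a, p, q) \<in> S"
    proof (induction rule: graded_induct)
      case zero
      then show ?case by (rule AP)
    next
      case (add n x y)
      then show ?case using step[of "\<zero>" "\<zero>" x n a p y] a p
        by (simp add: triangular_gda_simps split: nat.splits)
    qed
    then show ?thesis by (simp add: S_def)
  qed
  show ?thesis
  proof (rule gdaI[OF triangular_algebra, where pr = pr])
    show "submodule (gcomp ?T n) K ?T" for n
    proof (rule module.submoduleI[OF MT])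
      show "\<ominus>\<^bsub>?T\<^esub> x \<in> gcomp ?T n" if "x \<in> gcomp ?T n" for x
        using comp_carrier[OF that] that
        by (cases x) (auto simp: triangular_gda_simps triangular_uminus gcomp_uminus split: nat.splits)
    qed (use comp_carrier in \<open>auto simp: triangular_gda_simps gcomp_add gcomp_smult split: nat.splits\<close>)
    show "carrier ?T \<subseteq> graded_span ?T (gcomp ?T)" using span by (auto simp: triangular_gda_simps)
    show "lin_map K ?T ?T (pr n)" for n
      by (rule lin_mapI)
        (auto simp: triangular_gda_simps pr_def hom_part_add hom_part_smult split: nat.splits)
    show "lin_map K ?T ?T (gdiff ?T)"
      by (rule lin_mapI)
        (auto simp: triangular_gda_simps gdiff_add gdiff_smult smult_r_distr a_minus_def M.minus_add
          M.a_ac smult_r_minus)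
    show "x \<otimes>\<^bsub>?T\<^esub> y \<in> gcomp ?T (m + n)" if x: "x \<in> gcomp ?T m" and y: "y \<in> gcomp ?T n" for m n x y
    proof -
      obtain a p q a' p' q' where xy: "x = (a, p, q)" "y = (a', p', q')" by (cases x; cases y) auto
      have a: "a \<in> gcomp \<Omega> m" "q \<in> gcomp \<Omega> m" "a' \<in> gcomp \<Omega> n" "q' \<in> gcomp \<Omega> n"
        using x y by (auto simp: xy triangular_gda_simps)
      have s: "grade_involution \<Omega> a \<in> gcomp \<Omega> m"
        using submodule_sign_pow[OF gda_module gcomp_submodule a(1)]
        by (simp add: grade_involution_homogeneous[OF a(1)])
      have c: "a \<in> carrier \<Omega>" "q \<in> carrier \<Omega>" "a' \<in> carrier \<Omega>" "q' \<in> carrier \<Omega>"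
        "grade_involution \<Omega> a \<in> carrier \<Omega>" using a s by auto
      have "p \<otimes> q' \<in> (case m + n of 0 \<Rightarrow> {\<zero>} | Suc k \<Rightarrow> gcomp \<Omega> k)"
        using x a c gcomp_mult[of p "m - 1" q' n] by (cases m) (auto simp: xy triangular_gda_simps split: nat.splits)
      moreover have "grade_involution \<Omega> a \<otimes> p' \<in> (case m + n of 0 \<Rightarrow> {\<zero>} | Suc k \<Rightarrow> gcomp \<Omega> k)"
        using y s c gcomp_mult[of "grade_involution \<Omega> a" m p' "n - 1"]
        by (cases n) (auto simp: xy triangular_gda_simps split: nat.splits)
      ultimately show ?thesis
        using a by (auto simp: xy triangular_gda_simps gcomp_mult gcomp_add split: nat.splits)
    qed
    show "gdiff ?T x \<in> gcomp ?T (Suc n)" if "x \<in> gcomp ?T n" for n x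
      using that by (auto simp: triangular_gda_simps a_minus_def split: nat.splits
          intro!: gcomp_add gcomp_uminus gdiff_degree)
    show "gdiff ?T (x \<otimes>\<^bsub>?T\<^esub> y) = gdiff ?T x \<otimes>\<^bsub>?T\<^esub> y \<oplus>\<^bsub>?T\<^esub> sign_pow ?T m (x \<otimes>\<^bsub>?T\<^esub> gdiff ?T y)"
      if "x \<in> gcomp ?T m" "y \<in> gcomp ?T n" for m n x y
      by (rule triangular_leibniz[OF that(1) comp_carrier[OF that(2)]])
    show "gdiff ?T (gdiff ?T x) = \<zero>\<^bsub>?T\<^esub>" if "x \<in> gcomp ?T n" for n x
      using comp_carrier[OF that]
      by (auto simp: triangular_gda_simps gdiff_gdiff a_minus_def gdiff_add gdiff_uminus r_neg)
  qed (auto simp: pr_def triangular_gda_simps hom_part_homogeneous gcomp_one split: nat.splits)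
qed

end

text \<open>A chain homotopy from \<open>f\<close> to \<open>g\<close> that is a derivation of degree \<open>-1\<close> with respect to \<open>f\<close> on the left and
  \<open>g\<close> on the right.\<close>

definition twisted_homotopy ::
  "'k ring \<Rightarrow> ('k, 'v) gda \<Rightarrow> ('k, 'w) gda \<Rightarrow> ('v \<Rightarrow> 'w) \<Rightarrow> ('v \<Rightarrow> 'w) \<Rightarrow> ('v \<Rightarrow> 'w) \<Rightarrow> bool" where
  "twisted_homotopy K \<Omega> C f g p \<longleftrightarrow>
     lin_map K \<Omega> C p \<and>
     (\<forall>x\<in>gcomp \<Omega> 0. p x = \<zero>\<^bsub>C\<^esub>) \<and> (\<forall>n. \<forall>x\<in>gcomp \<Omega> (Suc n). p x \<in> gcomp C n) \<and>
     (\<forall>n. \<forall>x\<in>gcomp \<Omega> n. \<forall>y\<in>carrier \<Omega>.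
       p (x \<otimes>\<^bsub>\<Omega>\<^esub> y) = p x \<otimes>\<^bsub>C\<^esub> g y \<oplus>\<^bsub>C\<^esub> sign_pow C n (f x \<otimes>\<^bsub>C\<^esub> p y)) \<and>
     (\<forall>x\<in>carrier \<Omega>. p (gdiff \<Omega> x) = (g x \<ominus>\<^bsub>C\<^esub> f x) \<ominus>\<^bsub>C\<^esub> gdiff C (p x))"

text \<open>The algebra homomorphism \<open>a \<mapsto> diag(f(a), g(a))\<close> on \<open>A\<close> extends to a morphism from \<open>\<Omega>\<close> to triangular
  matrices.  Its diagonal entries are morphisms that agree with \<open>f\<close> and \<open>g\<close> on \<open>A\<close>, so they are \<open>f\<close> and
  \<open>g\<close>; multiplicativity and compatibility with the differentials, read in the corner, say that the
  corner is a twisted homotopy.\<close>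

lemma gda_hom_homotopy:
  fixes \<Omega> :: "('k, 'w) gda" and C :: "('k, 'b) gda" and e :: "'b \<times> 'b \<times> 'b \<Rightarrow> 'c"
  assumes env: "differential_envelope TYPE('c) K A \<Omega> \<iota>"
    and C: "graded_diff_algebra K C" and inj: "inj e"
    and f: "gda_hom K \<Omega> C f" and g: "gda_hom K \<Omega> C g"
  shows "\<exists>p. twisted_homotopy K \<Omega> C f g p"
proof -
  interpret \<Omega>: graded_diff_algebra K \<Omega> by (rule envelope_gda[OF env])
  interpret C: graded_diff_algebra K C by (rule C)
  have \<iota>: "alg_hom K A \<Omega> \<iota>" "\<And>a. a \<in> carrier A \<Longrightarrow> \<iota> a \<in> gcomp \<Omega> 0"
    using env by (auto simp: differential_envelope_def bij_betw_def)
  let ?T = "triangular_gda C"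
  let ?\<phi> = "\<lambda>a. (f (\<iota> a), \<zero>\<^bsub>C\<^esub>, g (\<iota> a))"
  have f\<iota>: "alg_hom K A C (\<lambda>a. f (\<iota> a))" and g\<iota>: "alg_hom K A C (\<lambda>a. g (\<iota> a))"
    using alg_hom_comp[OF \<iota>(1) gda_homD(1)] f g by blast+
  have inj_T: "inj_on e (carrier ?T)" using inj by (rule inj_on_subset) simp
  have closed [simp]: "f (\<iota> a) \<in> carrier C" "g (\<iota> a) \<in> carrier C" if "a \<in> carrier A" for a
    using lin_map_closed[OF alg_hom_lin[OF f\<iota>] that] lin_map_closed[OF alg_hom_lin[OF g\<iota>] that]
    by simp_all
  have \<phi>: "alg_hom K A ?T ?\<phi>"
  proof (rule alg_homI, rule lin_mapI)
    fix x y assume x: "x \<in> carrier A" and y: "y \<in> carrier A"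
    show "?\<phi> (x \<otimes>\<^bsub>A\<^esub> y) = ?\<phi> x \<otimes>\<^bsub>?T\<^esub> ?\<phi> y"
      using x y alg_hom_mult[OF f\<iota> x y] alg_hom_mult[OF g\<iota> x y]
        lin_map_closed[OF C.grade_involution_linear]
      by (simp add: triangular_gda_simps)
    show "?\<phi> (x \<oplus>\<^bsub>A\<^esub> y) = ?\<phi> x \<oplus>\<^bsub>?T\<^esub> ?\<phi> y"
      using x y lin_map_add[OF alg_hom_lin[OF f\<iota>] x y] lin_map_add[OF alg_hom_lin[OF g\<iota>] x y]
      by (simp add: triangular_gda_simps)
  next
    fix c x assume c: "c \<in> carrier K" and x: "x \<in> carrier A"
    show "?\<phi> (c \<odot>\<^bsub>A\<^esub> x) = c \<odot>\<^bsub>?T\<^esub> ?\<phi> x"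
      using x c lin_map_smult[OF alg_hom_lin[OF f\<iota>] c x] lin_map_smult[OF alg_hom_lin[OF g\<iota>] c x]
      by (simp add: triangular_gda_simps)
  qed (auto simp: triangular_gda_simps alg_hom_one[OF f\<iota>] alg_hom_one[OF g\<iota>])
  have \<phi>0: "?\<phi> ` carrier A \<subseteq> gcomp ?T 0"
    using \<iota>(2) gda_homD(2)[OF f] gda_homD(2)[OF g] by (auto simp: triangular_gda_simps)
  obtain \<Phi> where \<Phi>: "gda_hom K \<Omega> ?T \<Phi>" "\<And>a. a \<in> carrier A \<Longrightarrow> \<Phi> (\<iota> a) = ?\<phi> a"
    by (rule envelope_extension[OF env C.triangular_gda inj_T \<phi> \<phi>0], erule that) simp_all
  note hom = gda_homD(1)[OF \<Phi>(1)] and lin = alg_hom_lin[OF gda_homD(1)[OF \<Phi>(1)]]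
  define F p H where "F x = fst (\<Phi> x)" and "p x = fst (snd (\<Phi> x))" and "H x = snd (snd (\<Phi> x))" for x
  have \<Phi>_eq: "\<Phi> x = (F x, p x, H x)" for x by (simp add: F_def p_def H_def)
  have closed' [simp]: "F x \<in> carrier C" "p x \<in> carrier C" "H x \<in> carrier C" if "x \<in> carrier \<Omega>" for x
    using lin_map_closed[OF lin that] by (auto simp: \<Phi>_eq triangular_gda_simps)
  have add: "F (x \<oplus>\<^bsub>\<Omega>\<^esub> y) = F x \<oplus>\<^bsub>C\<^esub> F y" "p (x \<oplus>\<^bsub>\<Omega>\<^esub> y) = p x \<oplus>\<^bsub>C\<^esub> p y" "H (x \<oplus>\<^bsub>\<Omega>\<^esub> y) = H x \<oplus>\<^bsub>C\<^esub> H y"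
    if "x \<in> carrier \<Omega>" "y \<in> carrier \<Omega>" for x y
    using lin_map_add[OF lin that] by (auto simp: \<Phi>_eq triangular_gda_simps)
  have smult: "F (c \<odot>\<^bsub>\<Omega>\<^esub> x) = c \<odot>\<^bsub>C\<^esub> F x" "p (c \<odot>\<^bsub>\<Omega>\<^esub> x) = c \<odot>\<^bsub>C\<^esub> p x" "H (c \<odot>\<^bsub>\<Omega>\<^esub> x) = c \<odot>\<^bsub>C\<^esub> H x"
    if "c \<in> carrier K" "x \<in> carrier \<Omega>" for c x
    using lin_map_smult[OF lin that] by (auto simp: \<Phi>_eq triangular_gda_simps)
  have mult: "F (x \<otimes>\<^bsub>\<Omega>\<^esub> y) = F x \<otimes>\<^bsub>C\<^esub> F y" "H (x \<otimes>\<^bsub>\<Omega>\<^esub> y) = H x \<otimes>\<^bsub>C\<^esub> H y"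
    "p (x \<otimes>\<^bsub>\<Omega>\<^esub> y) = p x \<otimes>\<^bsub>C\<^esub> H y \<oplus>\<^bsub>C\<^esub> grade_involution C (F x) \<otimes>\<^bsub>C\<^esub> p y"
    if "x \<in> carrier \<Omega>" "y \<in> carrier \<Omega>" for x y
    using alg_hom_mult[OF hom that] by (auto simp: \<Phi>_eq triangular_gda_simps)
  have one: "F \<one>\<^bsub>\<Omega>\<^esub> = \<one>\<^bsub>C\<^esub>" "H \<one>\<^bsub>\<Omega>\<^esub> = \<one>\<^bsub>C\<^esub>"
    using alg_hom_one[OF hom] by (auto simp: \<Phi>_eq triangular_gda_simps)
  have deg: "F x \<in> gcomp C n" "H x \<in> gcomp C n" "p x \<in> (case n of 0 \<Rightarrow> {\<zero>\<^bsub>C\<^esub>} | Suc m \<Rightarrow> gcomp C m)"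
    if "x \<in> gcomp \<Omega> n" for x n
    using gda_homD(2)[OF \<Phi>(1) that] by (auto simp: \<Phi>_eq triangular_gda_simps)
  have d: "F (gdiff \<Omega> x) = gdiff C (F x)" "H (gdiff \<Omega> x) = gdiff C (H x)"
    "p (gdiff \<Omega> x) = (H x \<ominus>\<^bsub>C\<^esub> F x) \<ominus>\<^bsub>C\<^esub> gdiff C (p x)" if "x \<in> carrier \<Omega>" for x
    using gda_homD(3)[OF \<Phi>(1) that] by (auto simp: \<Phi>_eq triangular_gda_simps)
  \<comment> \<open>The diagonal embedding makes \<open>C\<close> itself an admissible target, for the uniqueness of extensions.\<close>
  have "inj_on (\<lambda>x. e (x, x, x)) (carrier C)" using inj by (auto simp: inj_def inj_on_def)
  note eqI = envelope_gda_hom_eq[OF env C this]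
  have "gda_hom K \<Omega> C F" "gda_hom K \<Omega> C H"
    using add smult mult one deg d by (auto intro!: gda_homI alg_homI lin_mapI)
  then have F: "F x = f x" and H: "H x = g x" if "x \<in> carrier \<Omega>" for x
    using eqI[OF _ f _ that, of F] eqI[OF _ g _ that, of H] \<Phi>(2) by (simp_all add: \<Phi>_eq)
  have "twisted_homotopy K \<Omega> C f g p"
    unfolding twisted_homotopy_def
  proof (intro conjI ballI allI)
    show "lin_map K \<Omega> C p" using add smult by (auto intro!: lin_mapI)
    show "p x = \<zero>\<^bsub>C\<^esub>" if "x \<in> gcomp \<Omega> 0" for x using deg(3)[OF that] by simp
    show "p x \<in> gcomp C n" if "x \<in> gcomp \<Omega> (Suc n)" for n x using deg(3)[OF that] by simp
    show "p (gdiff \<Omega> x) = (g x \<ominus>\<^bsub>C\<^esub> f x) \<ominus>\<^bsub>C\<^esub> gdiff C (p x)" if "x \<in> carrier \<Omega>" for x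
      using d(3)[OF that] that by (simp add: F H)
    show "p (x \<otimes>\<^bsub>\<Omega>\<^esub> y) = p x \<otimes>\<^bsub>C\<^esub> g y \<oplus>\<^bsub>C\<^esub> sign_pow C n (f x \<otimes>\<^bsub>C\<^esub> p y)"
      if x: "x \<in> gcomp \<Omega> n" and y: "y \<in> carrier \<Omega>" for n x y
    proof -
      have xc: "x \<in> carrier \<Omega>" using x by simp
      have "f x \<in> carrier C" using closed'(1)[OF xc] F[OF xc] by simp
      then show ?thesis
        using mult(3)[OF xc y] C.grade_involution_homogeneous[OF deg(1)[OF x]] xc y
        by (simp add: F H C.sign_pow_mult_left)
    qed
  qed
  then show ?thesis by blast
qed

section \<open>Sweedler sums and convolution\<close>

lemma tensor_sum_Nil [simp]: "tensor_sum N \<beta> [] = \<zero>\<^bsub>N\<^esub>"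
  by (simp add: tensor_sum_def)

lemma tensor_sum_Cons [simp]: "tensor_sum N \<beta> ((x, y) # s) = \<beta> x y \<oplus>\<^bsub>N\<^esub> tensor_sum N \<beta> s"
  by (simp add: tensor_sum_def)

lemma tensor_sum_map:
  "tensor_sum N \<beta> (map (\<lambda>(x, y). (\<phi> x y, \<psi> x y)) s) = tensor_sum N (\<lambda>x y. \<beta> (\<phi> x y) (\<psi> x y)) s"
  by (induction s) auto

lemma tensor_sum_eqI:
  assumes "set s \<subseteq> S \<times> S" "\<And>x y. \<lbrakk>x \<in> S; y \<in> S\<rbrakk> \<Longrightarrow> \<beta> x y = \<gamma> x y"
  shows "tensor_sum N \<beta> s = tensor_sum N \<gamma> s"
  using assms by (induction s) auto

lemma (in abelian_group) tensor_sum_closed: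
  assumes "set s \<subseteq> S \<times> S" "\<And>x y. \<lbrakk>x \<in> S; y \<in> S\<rbrakk> \<Longrightarrow> \<beta> x y \<in> carrier G"
  shows "tensor_sum G \<beta> s \<in> carrier G"
  using assms by (induction s) auto

lemma (in abelian_group) tensor_sum_append:
  assumes "set (s @ t) \<subseteq> S \<times> S" and \<beta>: "\<And>x y. \<lbrakk>x \<in> S; y \<in> S\<rbrakk> \<Longrightarrow> \<beta> x y \<in> carrier G"
  shows "tensor_sum G \<beta> (s @ t) = tensor_sum G \<beta> s \<oplus> tensor_sum G \<beta> t"
  using assms(1)
proof (induction s)
  case Nil
  then show ?case using tensor_sum_closed[of t S \<beta>] \<beta> by simp
next
  case (Cons a s)
  then have "tensor_sum G \<beta> s \<in> carrier G" "tensor_sum G \<beta> t \<in> carrier G"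
    using \<beta> by (auto intro!: tensor_sum_closed[where S = S])
  then show ?case using Cons \<beta> by (cases a) (auto simp: a_assoc)
qed

lemma (in abelian_group) tensor_sum_concat:
  assumes "\<And>a. a \<in> set s \<Longrightarrow> set (F a) \<subseteq> S \<times> S"
    and \<beta>: "\<And>x y. \<lbrakk>x \<in> S; y \<in> S\<rbrakk> \<Longrightarrow> \<beta> x y \<in> carrier G"
  shows "tensor_sum G \<beta> (concat (map F s)) = tensor_sum G (\<lambda>x y. tensor_sum G \<beta> (F (x, y))) s"
  using assms(1)
proof (induction s)
  case (Cons a s)
  then have "set (F a @ concat (map F s)) \<subseteq> S \<times> S" by auto
  from tensor_sum_append[of _ _ S \<beta>, OF this \<beta>] Cons show ?case by (cases a) auto
qed simp

lemma (in abelian_group) tensor_sum_add: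
  assumes "set s \<subseteq> S \<times> S" "\<And>x y. \<lbrakk>x \<in> S; y \<in> S\<rbrakk> \<Longrightarrow> \<beta> x y \<in> carrier G"
    and "\<And>x y. \<lbrakk>x \<in> S; y \<in> S\<rbrakk> \<Longrightarrow> \<gamma> x y \<in> carrier G"
  shows "tensor_sum G (\<lambda>x y. \<beta> x y \<oplus> \<gamma> x y) s = tensor_sum G \<beta> s \<oplus> tensor_sum G \<gamma> s"
  using assms(1)
proof (induction s)
  case (Cons a s)
  then have "tensor_sum G \<beta> s \<in> carrier G" "tensor_sum G \<gamma> s \<in> carrier G"
    using assms(2,3) by (auto intro!: tensor_sum_closed[where S = S])
  then show ?case using Cons assms(2,3) by (cases a) (auto simp: a_ac)
qed simp

lemma (in abelian_group) tensor_sum_swap: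
  assumes s: "set s \<subseteq> S \<times> S" and t: "set t \<subseteq> S \<times> S"
    and F: "\<And>x y x' y'. \<lbrakk>x \<in> S; y \<in> S; x' \<in> S; y' \<in> S\<rbrakk> \<Longrightarrow> F x y x' y' \<in> carrier G"
  shows "tensor_sum G (\<lambda>x y. tensor_sum G (F x y) t) s =
    tensor_sum G (\<lambda>x' y'. tensor_sum G (\<lambda>x y. F x y x' y') s) t"
  using s
proof (induction s)
  case Nil
  show ?case by (induction t) auto
next
  case (Cons a s)
  obtain x y where a: "a = (x, y)" by (cases a)
  have s: "set s \<subseteq> S \<times> S" using Cons.prems by simp
  show ?case
    using Cons a tensor_sum_add[OF t, of "F x y" "\<lambda>x' y'. tensor_sum G (\<lambda>x y. F x y x' y') s"]
      F tensor_sum_closed[OF s] by simp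
qed

lemma tensor_sum_lin_map:
  assumes M: "module K M" and N: "module K N" and f: "lin_map K M N f"
    and s: "set s \<subseteq> S \<times> S" and \<beta>: "\<And>x y. \<lbrakk>x \<in> S; y \<in> S\<rbrakk> \<Longrightarrow> \<beta> x y \<in> carrier M"
  shows "f (tensor_sum M \<beta> s) = tensor_sum N (\<lambda>x y. f (\<beta> x y)) s"
  using s
proof (induction s)
  case Nil
  then show ?case using lin_map_zero[OF M N f] by simp
next
  case (Cons a s)
  then have "tensor_sum M \<beta> s \<in> carrier M"
    using \<beta> by (auto intro!: abelian_group.tensor_sum_closed[where S = S] module_abelian_group[OF M])
  then show ?case using Cons \<beta> lin_map_add[OF f] by (cases a) auto
qed

definition bilinear_map ::
  "'k ring \<Rightarrow> ('k, 'a, 'm) module_scheme \<Rightarrow> ('k, 'b, 'n) module_scheme \<Rightarrow> ('a \<Rightarrow> 'a \<Rightarrow> 'b) \<Rightarrow> bool" where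
  "bilinear_map K M N \<beta> \<longleftrightarrow>
     (\<forall>y\<in>carrier M. lin_map K M N (\<lambda>x. \<beta> x y)) \<and> (\<forall>x\<in>carrier M. lin_map K M N (\<beta> x))"

lemma bilinear_map_mult:
  assumes R: "assoc_algebra K R" and f: "lin_map K M R f" and g: "lin_map K M R g"
  shows "bilinear_map K M R (\<lambda>x y. f x \<otimes>\<^bsub>R\<^esub> g y)"
proof -
  interpret R: ring R by (rule assoc_algebra_ring[OF R])
  note [simp] = lin_map_closed[OF f] lin_map_closed[OF g]
  show ?thesis
    by (auto simp: bilinear_map_def lin_map_add[OF f] lin_map_add[OF g] lin_map_smult[OF f]
        lin_map_smult[OF g] R.l_distr R.r_distr assoc_algebra.smult_mult_left[OF R]
        assoc_algebra.smult_mult_right[OF R] intro!: lin_mapI)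
qed

lemma bilinear_map_closed:
  "\<lbrakk>bilinear_map K M N \<beta>; x \<in> carrier M; y \<in> carrier M\<rbrakk> \<Longrightarrow> \<beta> x y \<in> carrier N"
  by (auto simp: bilinear_map_def dest: lin_map_closed)

lemma bilinear_map_comp:
  assumes "bilinear_map K M N \<beta>" "lin_map K M M f" "lin_map K M M g"
  shows "bilinear_map K M N (\<lambda>x y. \<beta> (f x) (g y))"
  unfolding bilinear_map_def
proof (intro conjI ballI)
  fix z assume z: "z \<in> carrier M"
  have 1: "lin_map K M N (\<lambda>x. \<beta> x (g z))" and 2: "lin_map K M N (\<beta> (f z))"
    using assms(1) lin_map_closed[OF assms(2) z] lin_map_closed[OF assms(3) z]
    by (auto simp: bilinear_map_def)
  show "lin_map K M N (\<lambda>x. \<beta> (f x) (g z))" by (rule lin_map_comp[OF assms(2) 1])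
  show "lin_map K M N (\<lambda>y. \<beta> (f z) (g y))" by (rule lin_map_comp[OF assms(3) 2])
qed

lemma bilinear_tensor_sum_cong:
  assumes M: "module K M" and N: "module K N" and \<beta>: "bilinear_map K M N \<beta>"
    and eq: "tensor_eq K M (pair_words s) (pair_words t)"
  shows "tensor_sum N \<beta> s = tensor_sum N \<beta> t"
proof (rule tensor_sum_cong[OF M module_abelian_group[OF N] _ _ _ _ eq])
  have 1: "lin_map K M N (\<lambda>x. \<beta> x y)" and 2: "lin_map K M N (\<beta> y)" if "y \<in> carrier M" for y
    using \<beta> that by (auto simp: bilinear_map_def)
  show "\<beta> x y \<in> carrier N" if "x \<in> carrier M" "y \<in> carrier M" for x y
    by (rule bilinear_map_closed[OF \<beta> that])
  show "\<beta> (x \<oplus>\<^bsub>M\<^esub> x') y = \<beta> x y \<oplus>\<^bsub>N\<^esub> \<beta> x' y"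
    if "x \<in> carrier M" "x' \<in> carrier M" "y \<in> carrier M" for x x' y
    using lin_map_add[OF 1] that by simp
  show "\<beta> x (y \<oplus>\<^bsub>M\<^esub> y') = \<beta> x y \<oplus>\<^bsub>N\<^esub> \<beta> x y'"
    if "x \<in> carrier M" "y \<in> carrier M" "y' \<in> carrier M" for x y y'
    using lin_map_add[OF 2] that by simp
  show "\<beta> (c \<odot>\<^bsub>M\<^esub> x) y = \<beta> x (c \<odot>\<^bsub>M\<^esub> y)"
    if "c \<in> carrier K" "x \<in> carrier M" "y \<in> carrier M" for c x y
    using lin_map_smult[OF 1] lin_map_smult[OF 2] that by simp
qed

text \<open>Evaluation of a formal sum of pure tensors under a product of linear forms with values in
  an algebra; words of another length than the number of forms count as zero.\<close>

definition eval_word :: "('b, 'n) ring_scheme \<Rightarrow> ('a \<Rightarrow> 'b) list \<Rightarrow> 'a list \<Rightarrow> 'b" where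
  "eval_word R fs w = (if length w = length fs
     then foldr (\<lambda>(f, x) r. f x \<otimes>\<^bsub>R\<^esub> r) (zip fs w) \<one>\<^bsub>R\<^esub> else \<zero>\<^bsub>R\<^esub>)"

definition eval_words :: "('b, 'n) ring_scheme \<Rightarrow> ('a \<Rightarrow> 'b) list \<Rightarrow> 'a list list \<Rightarrow> 'b" where
  "eval_words R fs s = foldr (\<lambda>w r. eval_word R fs w \<oplus>\<^bsub>R\<^esub> r) s \<zero>\<^bsub>R\<^esub>"

lemma eval_words_simps [simp]:
  "eval_words R fs [] = \<zero>\<^bsub>R\<^esub>"
  "eval_words R fs (w # s) = eval_word R fs w \<oplus>\<^bsub>R\<^esub> eval_words R fs s"
  by (simp_all add: eval_words_def)

text \<open>The value depends only on the element of the tensor power: with all other slots fixed, \<open>eval_word\<close> is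
  linear in each slot (\<open>ev_slot\<close>), which takes care of the addition, zero and scalar rules.  For three
  slots this makes coassociativity usable under products of linear maps.\<close>

lemma eval_words_cong:
  fixes M :: "('k, 'a, 'm) module_scheme" and R :: "('k, 'b, 'n) module_scheme"
  assumes M: "module K M" and R: "assoc_algebra K R" and fs: "\<And>f. f \<in> set fs \<Longrightarrow> lin_map K M R f"
    and eq: "tensor_eq K M s t"
  shows "eval_words R fs s = eval_words R fs t"
proof -
  interpret M: module K M by (rule M)
  interpret R: ring R by (rule assoc_algebra_ring[OF R])
  interpret MR: module K R by (rule assoc_algebra_module[OF R])
  note MR = assoc_algebra_module[OF R]
  define prd :: "('a \<Rightarrow> 'b) list \<Rightarrow> 'a list \<Rightarrow> 'b" where "prd = (\<lambda>fs w. foldr (\<lambda>(f, x) r. f x \<otimes>\<^bsub>R\<^esub> r) (zip fs w) \<one>\<^bsub>R\<^esub>)"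
  have prd_Cons: "prd (f # fs) (x # w) = f x \<otimes>\<^bsub>R\<^esub> prd fs w"
    and prd_Nil: "prd [] w = \<one>\<^bsub>R\<^esub>" "prd fs [] = \<one>\<^bsub>R\<^esub>"
    for f :: "'a \<Rightarrow> 'b" and fs x w by (simp_all add: prd_def)
  have prd_closed: "prd gs w \<in> carrier R" if "set gs \<subseteq> set fs" "w \<in> lists (carrier M)" for gs w
    using that
  proof (induction gs arbitrary: w)
    case Nil
    then show ?case by (simp add: prd_def)
  next
    case (Cons g gs)
    then show ?case using lin_map_closed[OF fs, of g]
      by (cases w) (auto simp: prd_Cons prd_Nil)
  qed
  have prd_append: "prd (gs @ hs) (p @ q) = prd gs p \<otimes>\<^bsub>R\<^esub> prd hs q"
    if "length gs = length p" "set (gs @ hs) \<subseteq> set fs" "p @ q \<in> lists (carrier M)" for gs hs p q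
    using that
  proof (induction gs p rule: list_induct2)
    case Nil
    then show ?case using prd_closed[of hs q] by (simp add: prd_def)
  next
    case (Cons g gs x p)
    then show ?case
      using lin_map_closed[OF fs, of g x] prd_closed[of gs p] prd_closed[of hs q]
      by (simp add: prd_Cons R.m_assoc)
  qed
  have ev: "eval_word R fs w = (if length w = length fs then prd fs w else \<zero>\<^bsub>R\<^esub>)" for w
    by (simp add: eval_word_def prd_def)
  have ev_closed: "eval_word R fs w \<in> carrier R" if "w \<in> lists (carrier M)" for w
    using prd_closed[of fs w] that by (simp add: ev)
  have es_closed: "eval_words R fs u \<in> carrier R" if "u \<in> lists (lists (carrier M))" for u
    using that by (induction u) (auto simp: ev_closed)
  have es_append: "eval_words R fs (u @ v) = eval_words R fs u \<oplus>\<^bsub>R\<^esub> eval_words R fs v"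
    if "u \<in> lists (lists (carrier M))" "v \<in> lists (lists (carrier M))" for u v
    using that by (induction u) (auto simp: ev_closed es_closed R.a_assoc)
  have es_single: "eval_words R fs [w] = eval_word R fs w" if "w \<in> lists (carrier M)" for w
    using ev_closed[OF that] by simp
  have slot: "\<exists>gs f hs. fs = gs @ f # hs \<and> length gs = length p \<and> length hs = length q"
    if "length (p @ x # q) = length fs" for p q :: "'a list" and x :: 'a
  proof -
    have "length p < length fs" using that by simp
    then have "fs = take (length p) fs @ fs ! length p # drop (Suc (length p)) fs"
      by (rule id_take_nth_drop)
    moreover have "length (take (length p) fs) = length p" "length (drop (Suc (length p)) fs) = length q"
      using that[symmetric] by simp_all
    ultimately show ?thesis by blast
  qed
  have ev_slot: "lin_map K M R (\<lambda>x. eval_word R fs (p @ x # q))"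
    if p: "p \<in> lists (carrier M)" and q: "q \<in> lists (carrier M)" for p q
  proof (cases "length (p @ q) + 1 = length fs")
    case True
    then obtain gs f hs where gs: "fs = gs @ f # hs" "length gs = length p" "length hs = length q"
      using slot[of p undefined q] by auto
    have f: "lin_map K M R f" using fs gs by simp
    have "prd gs p \<in> carrier R" "prd hs q \<in> carrier R"
      using p q gs by (auto intro!: prd_closed)
    moreover have "eval_word R fs (p @ x # q) = prd gs p \<otimes>\<^bsub>R\<^esub> (f x \<otimes>\<^bsub>R\<^esub> prd hs q)"
      if "x \<in> carrier M" for x
    proof -
      have "eval_word R fs (p @ x # q) = prd fs (p @ x # q)" using True by (simp add: ev)
      also have "\<dots> = prd gs p \<otimes>\<^bsub>R\<^esub> (f x \<otimes>\<^bsub>R\<^esub> prd hs q)"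
        using prd_append[of gs p "f # hs" "x # q"] p q gs that by (simp add: prd_Cons)
      finally show ?thesis .
    qed
    ultimately show ?thesis
      by (auto intro!: lin_mapI simp: lin_map_closed[OF f] lin_map_add[OF f] lin_map_smult[OF f]
          R.l_distr R.r_distr assoc_algebra.smult_mult_left[OF R]
          assoc_algebra.smult_mult_right[OF R])
  next
    case False
    then show ?thesis by (auto intro!: lin_mapI simp: ev)
  qed
  have "u \<in> lists (lists (carrier M)) \<and> v \<in> lists (lists (carrier M)) \<and>
      eval_words R fs u = eval_words R fs v" if "tensor_eq K M u v" for u v
    using that
  proof induction
    case (tensor_append s s' t t')
    then show ?case using es_append by simp
  next
    case (tensor_comm s t)
    then show ?case using es_append es_closed R.a_comm by simp
  next
    case (tensor_add p x y q)
    then show ?case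
      using lin_map_add[OF ev_slot[of p q]] by (simp add: ev_closed)
  next
    case (tensor_zero p q)
    then show ?case
      using lin_map_zero[OF M MR ev_slot[of p q]] by simp
  next
    case (tensor_smult c p x q y r)
    have "eval_word R fs (p @ (c \<odot>\<^bsub>M\<^esub> x) # q @ y # r) = c \<odot>\<^bsub>R\<^esub> eval_word R fs (p @ x # q @ y # r)"
      using tensor_smult lin_map_smult[OF ev_slot[of p "q @ y # r"], of c x] by simp
    moreover have "eval_word R fs (p @ x # q @ (c \<odot>\<^bsub>M\<^esub> y) # r) =
        c \<odot>\<^bsub>R\<^esub> eval_word R fs (p @ x # q @ y # r)"
      using tensor_smult lin_map_smult[OF ev_slot[of "p @ x # q" r], of c y] by simp
    ultimately show ?case using tensor_smult by simp
  qed auto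
  then show ?thesis using eq by blast
qed

definition convolution ::
  "('k, 'u) hopf \<Rightarrow> ('r, 'n) ring_scheme \<Rightarrow> ('u \<Rightarrow> 'r) \<Rightarrow> ('u \<Rightarrow> 'r) \<Rightarrow> 'u \<Rightarrow> 'r" where
  "convolution H R f g h = tensor_sum R (\<lambda>x y. f x \<otimes>\<^bsub>R\<^esub> g y) (comult H h)"

definition primitive :: "'k ring \<Rightarrow> ('k, 'u) hopf \<Rightarrow> 'u \<Rightarrow> bool" where
  "primitive K H X \<longleftrightarrow> X \<in> carrier H \<and>
     tensor_eq K H (pair_words (comult H X)) (pair_words [(X, \<one>\<^bsub>H\<^esub>), (\<one>\<^bsub>H\<^esub>, X)]) \<and>
     counit H X = \<zero>\<^bsub>K\<^esub>"

text \<open>The same locale with \<open>H\<close> as implicit structure.\<close>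

locale hopf = hopf_algebra K H
  for K :: "'k ring" and H :: "('k, 'u) hopf" (structure)

sublocale hopf_algebra \<subseteq> hopf K H ..

context hopf
begin

lemma H_algebra: "assoc_algebra K H" ..
lemma H_module: "module K H" ..

lemma antipode_closed [simp]: "h \<in> carrier H \<Longrightarrow> antipode H h \<in> carrier H"
  by (rule lin_map_closed[OF antipode_linear])

lemma counit_closed [simp]: "h \<in> carrier H \<Longrightarrow> counit H h \<in> carrier K"
  using counit_ring_hom by (auto simp: ring_hom_def)

lemma counit_simps:
  "\<lbrakk>g \<in> carrier H; h \<in> carrier H\<rbrakk> \<Longrightarrow> counit H (g \<oplus> h) = counit H g \<oplus>\<^bsub>K\<^esub> counit H h"
  "\<lbrakk>g \<in> carrier H; h \<in> carrier H\<rbrakk> \<Longrightarrow> counit H (g \<otimes> h) = counit H g \<otimes>\<^bsub>K\<^esub> counit H h"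
  "counit H \<one> = \<one>\<^bsub>K\<^esub>"
  using counit_ring_hom by (auto simp: ring_hom_def)

lemma sweedler_closed:
  assumes "bilinear_map K H N \<beta>" "module K N" "h \<in> carrier H"
  shows "tensor_sum N \<beta> (comult H h) \<in> carrier N"
  by (rule abelian_group.tensor_sum_closed[OF module_abelian_group[OF assms(2)] comult_closed[OF assms(3)]])
    (rule bilinear_map_closed[OF assms(1)])

text \<open>A Sweedler sum of bilinear terms is the composite of the coproduct with the linear map on the tensor
  square that the bilinear map induces.\<close>

lemma sweedler_linear:
  assumes \<beta>: "bilinear_map K H N \<beta>" and N: "module K N"
  shows "lin_map K H N (\<lambda>h. tensor_sum N \<beta> (comult H h))"
proof (rule lin_mapI)
  interpret N: abelian_group N by (rule module_abelian_group[OF N])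
  note \<beta>c = bilinear_map_closed[OF \<beta>]
  show "tensor_sum N \<beta> (comult H x) \<in> carrier N" if "x \<in> carrier H" for x
    by (rule sweedler_closed[OF \<beta> N that])
  show "tensor_sum N \<beta> (comult H (x \<oplus> y)) =
      tensor_sum N \<beta> (comult H x) \<oplus>\<^bsub>N\<^esub> tensor_sum N \<beta> (comult H y)"
    if "x \<in> carrier H" "y \<in> carrier H" for x y
    unfolding bilinear_tensor_sum_cong[OF H_module N \<beta> comult_add[OF that]]
    by (rule N.tensor_sum_append[where S = "carrier H"]) (use comult_closed that \<beta>c in auto)
  show "tensor_sum N \<beta> (comult H (c \<odot> x)) = c \<odot>\<^bsub>N\<^esub> tensor_sum N \<beta> (comult H x)"
    if c: "c \<in> carrier K" and x: "x \<in> carrier H" for c x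
  proof -
    interpret MN: module K N by (rule N)
    have lin: "lin_map K N N (\<lambda>z. c \<odot>\<^bsub>N\<^esub> z)"
      using c by (auto intro!: lin_mapI simp: MN.smult_r_distr MN.smult_assoc1[symmetric] K.m_comm)
    have "tensor_sum N \<beta> (comult H (c \<odot> x)) =
        tensor_sum N (\<lambda>x y. \<beta> (c \<odot> x) y) (comult H x)"
      unfolding bilinear_tensor_sum_cong[OF H_module N \<beta> comult_smult[OF c x]]
      by (rule tensor_sum_map)
    also have "\<dots> = tensor_sum N (\<lambda>x y. c \<odot>\<^bsub>N\<^esub> \<beta> x y) (comult H x)"
      using \<beta> c by (intro tensor_sum_eqI[OF comult_closed[OF x]])
        (auto simp: bilinear_map_def lin_map_def)
    also have "\<dots> = c \<odot>\<^bsub>N\<^esub> tensor_sum N \<beta> (comult H x)"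
      by (rule tensor_sum_lin_map[OF N N lin comult_closed[OF x] \<beta>c, symmetric])
    finally show ?thesis .
  qed
qed

lemma sweedler_one:
  assumes \<beta>: "bilinear_map K H N \<beta>" and N: "module K N"
  shows "tensor_sum N \<beta> (comult H \<one>) = \<beta> \<one> \<one>"
proof -
  interpret N: abelian_group N by (rule module_abelian_group[OF N])
  show ?thesis
    unfolding bilinear_tensor_sum_cong[OF H_module N \<beta> comult_one]
    using bilinear_map_closed[OF \<beta>] by simp
qed

lemma sweedler_primitive:
  assumes \<beta>: "bilinear_map K H N \<beta>" and N: "module K N" and X: "primitive K H X"
  shows "tensor_sum N \<beta> (comult H X) = \<beta> X \<one> \<oplus>\<^bsub>N\<^esub> \<beta> \<one> X"
proof -
  interpret N: abelian_group N by (rule module_abelian_group[OF N])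
  show ?thesis
    using bilinear_tensor_sum_cong[OF H_module N \<beta>, of "comult H X" "[(X, \<one>), (\<one>, X)]"] X
      bilinear_map_closed[OF \<beta>]
    by (simp add: primitive_def)
qed

lemma mult_left_linear: "z \<in> carrier H \<Longrightarrow> lin_map K H H (\<lambda>x. z \<otimes> x)"
  by (auto intro!: lin_mapI simp: A.r_distr smult_mult_right)

lemma mult_right_linear: "z \<in> carrier H \<Longrightarrow> lin_map K H H (\<lambda>x. x \<otimes> z)"
  by (auto intro!: lin_mapI simp: A.l_distr smult_mult_left)

lemma identity_linear: "lin_map K H H (\<lambda>x. x)"
  by (auto intro!: lin_mapI)

lemma sweedler_mult:
  assumes \<beta>: "bilinear_map K H N \<beta>" and N: "module K N" and g: "g \<in> carrier H" and h: "h \<in> carrier H"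
  shows "tensor_sum N \<beta> (comult H (g \<otimes> h)) =
    tensor_sum N (\<lambda>x y. tensor_sum N (\<lambda>x' y'. \<beta> (x \<otimes> x') (y \<otimes> y')) (comult H h)) (comult H g)"
proof -
  interpret N: abelian_group N by (rule module_abelian_group[OF N])
  define F where "F = (\<lambda>(x, y). map (\<lambda>(x', y'). (x \<otimes> x', y \<otimes> y')) (comult H h))"
  have "tensor_sum N \<beta> (comult H (g \<otimes> h)) = tensor_sum N \<beta> (concat (map F (comult H g)))"
    unfolding bilinear_tensor_sum_cong[OF H_module N \<beta> comult_mult[OF g h]] by (simp add: F_def)
  also have "\<dots> = tensor_sum N (\<lambda>x y. tensor_sum N \<beta> (F (x, y))) (comult H g)"
    by (rule N.tensor_sum_concat[where S = "carrier H"])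
      (use comult_closed[OF g] comult_closed[OF h] bilinear_map_closed[OF \<beta>] in \<open>auto simp: F_def\<close>)
  finally show ?thesis by (simp add: F_def tensor_sum_map)
qed

text \<open>\<open>\<Delta>(hX) = \<Sum> h\<^sup>(\<^sup>1\<^sup>)X \<otimes> h\<^sup>(\<^sup>2\<^sup>) + h\<^sup>(\<^sup>1\<^sup>) \<otimes> h\<^sup>(\<^sup>2\<^sup>)X\<close> for primitive \<open>X\<close>: right multiplication by \<open>X\<close> acts on
  Sweedler sums as a derivation.  This carries the inductions over an enveloping algebra that
  involve the coproduct.\<close>

lemma sweedler_mult_primitive:
  assumes \<beta>: "bilinear_map K H N \<beta>" and N: "module K N" and h: "h \<in> carrier H" and X: "primitive K H X"
  shows "tensor_sum N \<beta> (comult H (h \<otimes> X)) =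
      tensor_sum N (\<lambda>x y. \<beta> (x \<otimes> X) y) (comult H h) \<oplus>\<^bsub>N\<^esub>
      tensor_sum N (\<lambda>x y. \<beta> x (y \<otimes> X)) (comult H h)"
proof -
  interpret N: abelian_group N by (rule module_abelian_group[OF N])
  have Xc: "X \<in> carrier H" using X by (simp add: primitive_def)
  have "tensor_sum N \<beta> (comult H (h \<otimes> X)) =
      tensor_sum N (\<lambda>x y. \<beta> (x \<otimes> X) y \<oplus>\<^bsub>N\<^esub> \<beta> x (y \<otimes> X)) (comult H h)"
    unfolding sweedler_mult[OF \<beta> N h Xc]
  proof (rule tensor_sum_eqI[OF comult_closed[OF h]])
    fix x y assume x: "x \<in> carrier H" and y: "y \<in> carrier H"
    show "tensor_sum N (\<lambda>x' y'. \<beta> (x \<otimes> x') (y \<otimes> y')) (comult H X) =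
        \<beta> (x \<otimes> X) y \<oplus>\<^bsub>N\<^esub> \<beta> x (y \<otimes> X)"
      using sweedler_primitive[OF bilinear_map_comp[OF \<beta> mult_left_linear[OF x] mult_left_linear[OF y]] N X]
        x y by simp
  qed
  also have "\<dots> = tensor_sum N (\<lambda>x y. \<beta> (x \<otimes> X) y) (comult H h) \<oplus>\<^bsub>N\<^esub>
      tensor_sum N (\<lambda>x y. \<beta> x (y \<otimes> X)) (comult H h)"
    by (rule N.tensor_sum_add[OF comult_closed[OF h]]) (use bilinear_map_closed[OF \<beta>] Xc in auto)
  finally show ?thesis .
qed

lemma sweedler_primitive_mult:
  assumes \<beta>: "bilinear_map K H N \<beta>" and N: "module K N" and h: "h \<in> carrier H" and X: "primitive K H X"
  shows "tensor_sum N \<beta> (comult H (X \<otimes> h)) =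
      tensor_sum N (\<lambda>x y. \<beta> (X \<otimes> x) y) (comult H h) \<oplus>\<^bsub>N\<^esub>
      tensor_sum N (\<lambda>x y. \<beta> x (X \<otimes> y)) (comult H h)"
proof -
  interpret N: abelian_group N by (rule module_abelian_group[OF N])
  have Xc: "X \<in> carrier H" using X by (simp add: primitive_def)
  note cl = comult_closed[OF h] comult_closed[OF Xc]
  have "tensor_sum N \<beta> (comult H (X \<otimes> h)) = tensor_sum N (\<lambda>x y. tensor_sum N
      (\<lambda>x' y'. \<beta> (x' \<otimes> x) (y' \<otimes> y)) (comult H X)) (comult H h)"
    \<comment> \<open>Exchanging the two sums puts the known coproduct of \<open>X\<close> inside.\<close>
    unfolding sweedler_mult[OF \<beta> N Xc h]
    by (rule N.tensor_sum_swap[OF cl(2,1)]) (simp add: bilinear_map_closed[OF \<beta>])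
  also have "\<dots> = tensor_sum N (\<lambda>x y. \<beta> (X \<otimes> x) y \<oplus>\<^bsub>N\<^esub> \<beta> x (X \<otimes> y)) (comult H h)"
  proof (rule tensor_sum_eqI[OF cl(1)])
    fix x y assume x: "x \<in> carrier H" and y: "y \<in> carrier H"
    show "tensor_sum N (\<lambda>x' y'. \<beta> (x' \<otimes> x) (y' \<otimes> y)) (comult H X) =
        \<beta> (X \<otimes> x) y \<oplus>\<^bsub>N\<^esub> \<beta> x (X \<otimes> y)"
      using sweedler_primitive[OF bilinear_map_comp[OF \<beta> mult_right_linear[OF x] mult_right_linear[OF y]] N X]
        x y by simp
  qed
  also have "\<dots> = tensor_sum N (\<lambda>x y. \<beta> (X \<otimes> x) y) (comult H h) \<oplus>\<^bsub>N\<^esub>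
      tensor_sum N (\<lambda>x y. \<beta> x (X \<otimes> y)) (comult H h)"
    by (rule N.tensor_sum_add[OF cl(1)]) (use bilinear_map_closed[OF \<beta>] Xc in auto)
  finally show ?thesis .
qed

lemma convolution_linear:
  assumes "assoc_algebra K R" "lin_map K H R f" "lin_map K H R g"
  shows "lin_map K H R (convolution H R f g)"
  unfolding convolution_def
  by (rule sweedler_linear[OF bilinear_map_mult[OF assms] assoc_algebra_module[OF assms(1)]])

lemma convolution_assoc:
  assumes R: "assoc_algebra K R" and f: "lin_map K H R f" and g: "lin_map K H R g"
    and k: "lin_map K H R k" and h: "h \<in> carrier H"
  shows "convolution H R (convolution H R f g) k h = convolution H R f (convolution H R g k) h"
proof -
  interpret R: ring R by (rule assoc_algebra_ring[OF R])
  note MR = assoc_algebra_module[OF R]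
  note [simp] = lin_map_closed[OF f] lin_map_closed[OF g] lin_map_closed[OF k]
  let ?E = "eval_words R [f, g, k]"
  have ev: "eval_word R [f, g, k] [x, y, z] = f x \<otimes>\<^bsub>R\<^esub> (g y \<otimes>\<^bsub>R\<^esub> k z)"
    if "x \<in> carrier H" "y \<in> carrier H" "z \<in> carrier H" for x y z
    using that by (simp add: eval_word_def)
  have closed: "eval_word R [f, g, k] w \<in> carrier R" if "w \<in> lists (carrier H)" for w
    using that by (auto simp: eval_word_def in_lists_conv_set length_Suc_conv)
  have E_closed: "?E s \<in> carrier R" if "s \<in> lists (lists (carrier H))" for s
    using that by (induction s) (auto simp: closed)
  have E_append: "?E (s @ t) = ?E s \<oplus>\<^bsub>R\<^esub> ?E t"
    if "s \<in> lists (lists (carrier H))" "t \<in> lists (lists (carrier H))" for s t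
    using that by (induction s) (auto simp: closed E_closed R.a_assoc)
  have E_concat: "?E (concat (map (\<lambda>(x, y). F x y) s)) = tensor_sum R (\<lambda>x y. ?E (F x y)) s"
    if "set s \<subseteq> carrier H \<times> carrier H"
      "\<And>x y. \<lbrakk>x \<in> carrier H; y \<in> carrier H\<rbrakk> \<Longrightarrow> F x y \<in> lists (lists (carrier H))" for F s
    using that(1)
  proof (induction s)
    case (Cons a s)
    have "concat (map (\<lambda>(x, y). F x y) s) \<in> lists (lists (carrier H))"
      using Cons.prems that(2) by (auto simp: in_lists_conv_set subset_iff) blast
    then show ?case using Cons that(2) E_append by (cases a) auto
  qed simp
  have left: "?E (map (\<lambda>(x', x''). [x', x'', y]) s) = tensor_sum R (\<lambda>x' x''. f x' \<otimes>\<^bsub>R\<^esub> g x'') s \<otimes>\<^bsub>R\<^esub> k y"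
    if "set s \<subseteq> carrier H \<times> carrier H" "y \<in> carrier H" for s y
    using that(1)
  proof (induction s)
    case (Cons a s)
    have "tensor_sum R (\<lambda>x' x''. f x' \<otimes>\<^bsub>R\<^esub> g x'') s \<in> carrier R"
      using Cons.prems by (intro R.tensor_sum_closed[where S = "carrier H"]) auto
    then show ?case using Cons that(2) by (cases a) (auto simp: ev R.l_distr R.m_assoc)
  qed (simp add: that)
  have right: "?E (map (\<lambda>(y', y''). [x, y', y'']) s) = f x \<otimes>\<^bsub>R\<^esub> tensor_sum R (\<lambda>y' y''. g y' \<otimes>\<^bsub>R\<^esub> k y'') s"
    if "set s \<subseteq> carrier H \<times> carrier H" "x \<in> carrier H" for s x
    using that(1)
  proof (induction s)
    case (Cons a s)
    have "tensor_sum R (\<lambda>y' y''. g y' \<otimes>\<^bsub>R\<^esub> k y'') s \<in> carrier R"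
      using Cons.prems by (intro R.tensor_sum_closed[where S = "carrier H"]) auto
    then show ?case using Cons that(2) by (cases a) (auto simp: ev R.r_distr)
  qed (simp add: that)
  have words: "map (\<lambda>(x', x''). [x', x'', y]) (comult H x) \<in> lists (lists (carrier H))"
    "map (\<lambda>(y', y''). [y, y', y'']) (comult H x) \<in> lists (lists (carrier H))"
    if "x \<in> carrier H" "y \<in> carrier H" for x y
    using comult_closed[OF that(1)] that(2) by (auto simp: in_lists_conv_set)
  have "convolution H R (convolution H R f g) k h =
      tensor_sum R (\<lambda>x y. ?E (map (\<lambda>(x', x''). [x', x'', y]) (comult H x))) (comult H h)"
    unfolding convolution_def
    by (rule tensor_sum_eqI[OF comult_closed[OF h]]) (simp add: left comult_closed)
  also have "\<dots> = ?E [[x', x'', y]. (x, y) \<leftarrow> comult H h, (x', x'') \<leftarrow> comult H x]"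
    using E_concat[OF comult_closed[OF h] words(1)] by simp
  also have "\<dots> = ?E [[x, y', y'']. (x, y) \<leftarrow> comult H h, (y', y'') \<leftarrow> comult H y]"
    by (rule eval_words_cong[OF H_module R _ coassoc[OF h]]) (use f g k in auto)
  also have "\<dots> = tensor_sum R (\<lambda>x y. ?E (map (\<lambda>(y', y''). [x, y', y'']) (comult H y))) (comult H h)"
    using E_concat[OF comult_closed[OF h], of "\<lambda>x y. map (\<lambda>(y', y''). [x, y', y'']) (comult H y)"]
      words(2) by simp
  also have "\<dots> = convolution H R f (convolution H R g k) h"
    unfolding convolution_def
    by (rule tensor_sum_eqI[OF comult_closed[OF h]]) (simp add: right comult_closed)
  finally show ?thesis .
qed

lemma counit_linear:
  assumes R: "module K R" and z: "z \<in> carrier R"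
  shows "lin_map K H R (\<lambda>h. counit H h \<odot>\<^bsub>R\<^esub> z)"
proof -
  interpret R: module K R by (rule R)
  show ?thesis
    using z by (auto intro!: lin_mapI simp: counit_simps counit_smult R.smult_l_distr R.smult_assoc1)
qed

lemma convolution_counit_left:
  assumes R: "assoc_algebra K R" and f: "lin_map K H R f" and z: "z \<in> carrier R" and h: "h \<in> carrier H"
  shows "convolution H R (\<lambda>h. counit H h \<odot>\<^bsub>R\<^esub> z) f h = z \<otimes>\<^bsub>R\<^esub> f h"
proof -
  interpret R: ring R by (rule assoc_algebra_ring[OF R])
  note MR = assoc_algebra_module[OF R]
  interpret MR: module K R by (rule MR)
  have lin: "lin_map K H R (\<lambda>x. z \<otimes>\<^bsub>R\<^esub> f x)"
    using z by (auto intro!: lin_mapI simp: lin_map_closed[OF f] lin_map_add[OF f] lin_map_smult[OF f]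
      R.r_distr assoc_algebra.smult_mult_right[OF R])
  have "convolution H R (\<lambda>h. counit H h \<odot>\<^bsub>R\<^esub> z) f h =
      tensor_sum R (\<lambda>x y. z \<otimes>\<^bsub>R\<^esub> f (counit H x \<odot> y)) (comult H h)"
    unfolding convolution_def
    by (rule tensor_sum_eqI[OF comult_closed[OF h]])
      (use z in \<open>simp add: lin_map_smult[OF f] lin_map_closed[OF f]
        assoc_algebra.smult_mult_left[OF R] assoc_algebra.smult_mult_right[OF R]\<close>)
  also have "\<dots> = z \<otimes>\<^bsub>R\<^esub> f (tensor_sum H (\<lambda>x y. counit H x \<odot> y) (comult H h))"
    by (rule tensor_sum_lin_map[OF H_module MR lin comult_closed[OF h], symmetric]) simp
  finally show ?thesis by (simp add: counit_left[OF h])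
qed

lemma convolution_counit_right:
  assumes R: "assoc_algebra K R" and f: "lin_map K H R f" and z: "z \<in> carrier R" and h: "h \<in> carrier H"
  shows "convolution H R f (\<lambda>h. counit H h \<odot>\<^bsub>R\<^esub> z) h = f h \<otimes>\<^bsub>R\<^esub> z"
proof -
  interpret R: ring R by (rule assoc_algebra_ring[OF R])
  note MR = assoc_algebra_module[OF R]
  interpret MR: module K R by (rule MR)
  have lin: "lin_map K H R (\<lambda>x. f x \<otimes>\<^bsub>R\<^esub> z)"
    using z by (auto intro!: lin_mapI simp: lin_map_closed[OF f] lin_map_add[OF f] lin_map_smult[OF f]
      R.l_distr assoc_algebra.smult_mult_left[OF R])
  have "convolution H R f (\<lambda>h. counit H h \<odot>\<^bsub>R\<^esub> z) h =
      tensor_sum R (\<lambda>x y. f (counit H y \<odot> x) \<otimes>\<^bsub>R\<^esub> z) (comult H h)"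
    unfolding convolution_def
    by (rule tensor_sum_eqI[OF comult_closed[OF h]])
      (use z in \<open>simp add: lin_map_smult[OF f] lin_map_closed[OF f]
        assoc_algebra.smult_mult_left[OF R] assoc_algebra.smult_mult_right[OF R]\<close>)
  also have "\<dots> = f (tensor_sum H (\<lambda>x y. counit H y \<odot> x) (comult H h)) \<otimes>\<^bsub>R\<^esub> z"
    by (rule tensor_sum_lin_map[OF H_module MR lin comult_closed[OF h], symmetric]) simp
  finally show ?thesis by (simp add: counit_right[OF h])
qed

text \<open>Both one-sided multiplications by a primitive element are coderivations, hence so is the commutator.
  It replaces a derivation property of \<open>[-, X]\<close> when condition (ii) is checked on products.\<close>

lemma sweedler_commutator:
  assumes \<beta>: "bilinear_map K H N \<beta>" and N: "module K N" and g: "g \<in> carrier H" and X: "primitive K H X"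
  shows "tensor_sum N \<beta> (comult H (g \<otimes> X \<ominus> X \<otimes> g)) =
      tensor_sum N (\<lambda>x y. \<beta> (x \<otimes> X \<ominus> X \<otimes> x) y) (comult H g) \<oplus>\<^bsub>N\<^esub>
      tensor_sum N (\<lambda>x y. \<beta> x (y \<otimes> X \<ominus> X \<otimes> y)) (comult H g)"
proof -
  interpret N: abelian_group N by (rule module_abelian_group[OF N])
  interpret MN: module K N by (rule N)
  have Xc [simp]: "X \<in> carrier H" using X by (simp add: primitive_def)
  note [simp] = bilinear_map_closed[OF \<beta>]
  have uminus: "lin_map K N N (\<lambda>z. \<ominus>\<^bsub>N\<^esub> z)"
    by (auto intro!: lin_mapI simp: N.minus_add MN.smult_r_minus)
  note ts = N.tensor_sum_closed[OF comult_closed[OF g]]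
  have diff: "tensor_sum N (\<lambda>x y. \<gamma> x y \<ominus>\<^bsub>N\<^esub> \<delta> x y) (comult H g) =
      tensor_sum N \<gamma> (comult H g) \<ominus>\<^bsub>N\<^esub> tensor_sum N \<delta> (comult H g)"
    if "\<And>x y. \<lbrakk>x \<in> carrier H; y \<in> carrier H\<rbrakk> \<Longrightarrow> \<gamma> x y \<in> carrier N"
      "\<And>x y. \<lbrakk>x \<in> carrier H; y \<in> carrier H\<rbrakk> \<Longrightarrow> \<delta> x y \<in> carrier N" for \<gamma> \<delta>
    unfolding a_minus_def
    using N.tensor_sum_add[OF comult_closed[OF g], of \<gamma> "\<lambda>x y. \<ominus>\<^bsub>N\<^esub> \<delta> x y"]
      tensor_sum_lin_map[OF N N uminus comult_closed[OF g], of \<delta>] that by simp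
  have 1: "\<beta> (x \<otimes> X \<ominus> X \<otimes> x) y = \<beta> (x \<otimes> X) y \<ominus>\<^bsub>N\<^esub> \<beta> (X \<otimes> x) y"
    if "x \<in> carrier H" "y \<in> carrier H" for x y
    using \<beta> that by (intro lin_map_minus[OF H_module N]) (auto simp: bilinear_map_def)
  have 2: "\<beta> x (y \<otimes> X \<ominus> X \<otimes> y) = \<beta> x (y \<otimes> X) \<ominus>\<^bsub>N\<^esub> \<beta> x (X \<otimes> y)"
    if "x \<in> carrier H" "y \<in> carrier H" for x y
    using \<beta> that by (intro lin_map_minus[OF H_module N]) (auto simp: bilinear_map_def)
  have "tensor_sum N (\<lambda>x y. \<beta> (x \<otimes> X \<ominus> X \<otimes> x) y) (comult H g) =
      tensor_sum N (\<lambda>x y. \<beta> (x \<otimes> X) y) (comult H g) \<ominus>\<^bsub>N\<^esub>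
      tensor_sum N (\<lambda>x y. \<beta> (X \<otimes> x) y) (comult H g)"
    by (subst diff[symmetric]) (auto intro!: tensor_sum_eqI[OF comult_closed[OF g]] simp: 1)
  moreover have "tensor_sum N (\<lambda>x y. \<beta> x (y \<otimes> X \<ominus> X \<otimes> y)) (comult H g) =
      tensor_sum N (\<lambda>x y. \<beta> x (y \<otimes> X)) (comult H g) \<ominus>\<^bsub>N\<^esub>
      tensor_sum N (\<lambda>x y. \<beta> x (X \<otimes> y)) (comult H g)"
    by (subst diff[symmetric]) (auto intro!: tensor_sum_eqI[OF comult_closed[OF g]] simp: 2)
  moreover have "tensor_sum N \<beta> (comult H (g \<otimes> X \<ominus> X \<otimes> g)) =
      tensor_sum N \<beta> (comult H (g \<otimes> X)) \<ominus>\<^bsub>N\<^esub> tensor_sum N \<beta> (comult H (X \<otimes> g))"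
    by (rule lin_map_minus[OF H_module N sweedler_linear[OF \<beta> N]]) (use g in auto)
  ultimately show ?thesis
    using ts[of "\<lambda>x y. \<beta> (x \<otimes> X) y"] ts[of "\<lambda>x y. \<beta> (X \<otimes> x) y"]
      ts[of "\<lambda>x y. \<beta> x (y \<otimes> X)"] ts[of "\<lambda>x y. \<beta> x (X \<otimes> y)"]
    by (simp add: sweedler_mult_primitive[OF \<beta> N g X] sweedler_primitive_mult[OF \<beta> N g X]
        a_minus_def N.minus_add N.a_ac)
qed

lemma antipode_one: "antipode H \<one> = \<one>"
  using antipode_left[of "\<one>"]
    sweedler_one[OF bilinear_map_mult[OF H_algebra antipode_linear identity_linear] H_module]
  by (simp add: counit_simps)

text \<open>The defect \<open>T(h) = S(hX) + X S(h)\<close> satisfies \<open>T * id = 0\<close>, since \<open>S * id = \<epsilon>\<close> and \<open>\<epsilon>(hX) = 0\<close>.  As \<open>id\<close> has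
  the convolution inverse \<open>S\<close>, it follows that \<open>T = T * (id * S) = 0\<close>.\<close>

lemma antipode_mult_primitive:
  assumes X: "primitive K H X" and h: "h \<in> carrier H"
  shows "antipode H (h \<otimes> X) = \<ominus> (X \<otimes> antipode H h)"
proof -
  have Xc [simp]: "X \<in> carrier H" and X0: "counit H X = \<zero>\<^bsub>K\<^esub>" using X by (auto simp: primitive_def)
  let ?\<beta> = "\<lambda>x y. antipode H x \<otimes> y"
  define T where "T = (\<lambda>h. antipode H (h \<otimes> X) \<oplus> X \<otimes> antipode H h)"
  have \<beta>: "bilinear_map K H H ?\<beta>"
    by (rule bilinear_map_mult[OF H_algebra antipode_linear identity_linear])
  note S = lin_map_add[OF antipode_linear] lin_map_smult[OF antipode_linear]
  have T: "lin_map K H H T"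
    by (auto intro!: lin_mapI simp: T_def S A.l_distr A.r_distr smult_mult_left smult_mult_right
        smult_r_distr M.a_ac)
  have Tid: "convolution H H T (\<lambda>x. x) x = \<zero>" if x: "x \<in> carrier H" for x
  proof -
    note ts = M.tensor_sum_closed[OF comult_closed[OF x]]
    let ?s = "\<lambda>\<gamma>. tensor_sum H \<gamma> (comult H x)"
    have anti: "?s ?\<beta> = counit H x \<odot> \<one>" by (rule antipode_left[OF x])
    have "convolution H H T (\<lambda>x. x) x =
        ?s (\<lambda>u v. antipode H (u \<otimes> X) \<otimes> v \<oplus> X \<otimes> (antipode H u \<otimes> v))"
      unfolding convolution_def T_def
      by (rule tensor_sum_eqI[OF comult_closed[OF x]]) (simp add: A.l_distr A.m_assoc)
    also have "\<dots> = ?s (\<lambda>u v. antipode H (u \<otimes> X) \<otimes> v) \<oplus>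
        ?s (\<lambda>u v. X \<otimes> (antipode H u \<otimes> v))"
      by (rule M.tensor_sum_add[OF comult_closed[OF x]]) auto
    also have "?s (\<lambda>u v. X \<otimes> (antipode H u \<otimes> v)) = X \<otimes> ?s ?\<beta>"
      by (rule tensor_sum_lin_map[OF H_module H_module mult_left_linear comult_closed[OF x], symmetric]) auto
    also have "\<dots> = counit H x \<odot> X" using x by (simp add: anti smult_mult_right)
    also have "counit H x \<odot> X = ?s (\<lambda>u v. antipode H u \<otimes> (v \<otimes> X))"
    proof -
      have "?s (\<lambda>u v. antipode H u \<otimes> (v \<otimes> X)) = ?s (\<lambda>u v. antipode H u \<otimes> v \<otimes> X)"
        by (rule tensor_sum_eqI[OF comult_closed[OF x]]) (simp add: A.m_assoc)
      also have "\<dots> = ?s ?\<beta> \<otimes> X"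
        by (rule tensor_sum_lin_map[OF H_module H_module mult_right_linear comult_closed[OF x], symmetric]) auto
      finally show ?thesis using x by (simp add: anti smult_mult_left)
    qed
    also have "?s (\<lambda>u v. antipode H (u \<otimes> X) \<otimes> v) \<oplus> \<dots> = tensor_sum H ?\<beta> (comult H (x \<otimes> X))"
      by (rule sweedler_mult_primitive[OF \<beta> H_module x X, symmetric])
    also have "\<dots> = \<zero>" using x by (simp add: antipode_left counit_simps X0)
    finally show ?thesis .
  qed
  have one: "lin_map K H H (\<lambda>h. counit H h \<odot> \<one>)" by (rule counit_linear[OF H_module]) simp
  have "T h = T h \<otimes> \<one>" using lin_map_closed[OF T h] by simp
  also have "\<dots> = convolution H H T (\<lambda>h. counit H h \<odot> \<one>) h"
    by (rule convolution_counit_right[OF H_algebra T _ h, symmetric]) simp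
  also have "\<dots> = convolution H H T (convolution H H (\<lambda>x. x) (antipode H)) h"
    unfolding convolution_def
    by (rule tensor_sum_eqI[OF comult_closed[OF h]]) (simp add: antipode_right)
  also have "\<dots> = convolution H H (convolution H H T (\<lambda>x. x)) (antipode H) h"
    by (rule convolution_assoc[OF H_algebra T identity_linear antipode_linear h, symmetric])
  also have "\<dots> = tensor_sum H (\<lambda>x y. \<zero>) (comult H h)"
    unfolding convolution_def[of _ _ "convolution H H T (\<lambda>x. x)"]
    by (rule tensor_sum_eqI[OF comult_closed[OF h]]) (simp add: Tid)
  also have "\<dots> = \<zero>"
  proof -
    have "tensor_sum H (\<lambda>x y. \<zero>) s = \<zero>" for s :: "('b \<times> 'b) list" by (induction s) auto
    then show ?thesis .
  qed
  finally have "T h = \<zero>" .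
  then show ?thesis using h by (simp add: T_def M.add.inv_equality[symmetric])
qed

lemma adjoint_bilinear:
  assumes g: "g \<in> carrier H"
  shows "bilinear_map K H H (\<lambda>x y. antipode H x \<otimes> g \<otimes> y)"
  by (rule bilinear_map_mult[OF H_algebra lin_map_comp[OF antipode_linear mult_right_linear[OF g]] identity_linear])

lemma right_adjoint_linear: "g \<in> carrier H \<Longrightarrow> lin_map K H H (\<lambda>h. right_adjoint H h g)"
  unfolding right_adjoint_def by (rule sweedler_linear[OF adjoint_bilinear H_module])

lemma right_adjoint_one: "g \<in> carrier H \<Longrightarrow> right_adjoint H \<one> g = g"
  unfolding right_adjoint_def
  by (subst sweedler_one[OF adjoint_bilinear H_module]) (auto simp: antipode_one)

lemma right_adjoint_mult_primitive:
  assumes X: "primitive K H X" and h: "h \<in> carrier H" and g: "g \<in> carrier H"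
  shows "right_adjoint H (h \<otimes> X) g =
    right_adjoint H h g \<otimes> X \<ominus> X \<otimes> right_adjoint H h g"
proof -
  have Xc [simp]: "X \<in> carrier H" using X by (simp add: primitive_def)
  let ?s = "\<lambda>\<gamma>. tensor_sum H \<gamma> (comult H h)"
  have "right_adjoint H (h \<otimes> X) g =
      ?s (\<lambda>x y. antipode H (x \<otimes> X) \<otimes> g \<otimes> y) \<oplus>
      ?s (\<lambda>x y. antipode H x \<otimes> g \<otimes> (y \<otimes> X))"
    unfolding right_adjoint_def by (rule sweedler_mult_primitive[OF adjoint_bilinear[OF g] H_module h X])
  also have "?s (\<lambda>x y. antipode H (x \<otimes> X) \<otimes> g \<otimes> y) =
      ?s (\<lambda>x y. (\<ominus> X) \<otimes> (antipode H x \<otimes> g \<otimes> y))"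
    by (rule tensor_sum_eqI[OF comult_closed[OF h]])
      (simp add: antipode_mult_primitive[OF X] g A.l_minus A.m_assoc)
  also have "\<dots> = (\<ominus> X) \<otimes> right_adjoint H h g"
    unfolding right_adjoint_def
    by (rule tensor_sum_lin_map[OF H_module H_module mult_left_linear comult_closed[OF h], symmetric])
      (use g in auto)
  also have "?s (\<lambda>x y. antipode H x \<otimes> g \<otimes> (y \<otimes> X)) =
      ?s (\<lambda>x y. antipode H x \<otimes> g \<otimes> y \<otimes> X)"
    by (rule tensor_sum_eqI[OF comult_closed[OF h]]) (simp add: g A.m_assoc)
  also have "\<dots> = right_adjoint H h g \<otimes> X"
    unfolding right_adjoint_def
    by (rule tensor_sum_lin_map[OF H_module H_module mult_right_linear comult_closed[OF h], symmetric])
      (use g in auto)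
  finally show ?thesis
    using lin_map_closed[OF right_adjoint_linear[OF g] h]
    by (simp add: A.l_minus a_minus_def M.a_comm)
qed

end

section \<open>Endomorphism and convolution algebras\<close>

text \<open>Extensional maps, so that linear maps are equal when they agree on the carrier.\<close>

definition end_algebra :: "'k ring \<Rightarrow> ('k, 'a, 'm) module_scheme \<Rightarrow> ('k, 'a \<Rightarrow> 'a) module" where
  "end_algebra K M =
     \<lparr>carrier = {f \<in> extensional (carrier M). lin_map K M M f},
      mult = (\<lambda>f g. \<lambda>x\<in>carrier M. f (g x)), one = (\<lambda>x\<in>carrier M. x),
      zero = (\<lambda>x\<in>carrier M. \<zero>\<^bsub>M\<^esub>), add = (\<lambda>f g. \<lambda>x\<in>carrier M. f x \<oplus>\<^bsub>M\<^esub> g x),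
      smult = (\<lambda>c f. \<lambda>x\<in>carrier M. c \<odot>\<^bsub>M\<^esub> f x)\<rparr>"

lemma end_algebra:
  assumes K: "field K" and M: "module K M"
  shows "assoc_algebra K (end_algebra K M)"
proof -
  interpret M: module K M by (rule M)
  have eqI: "f = g" if "f \<in> extensional (carrier M)" "g \<in> extensional (carrier M)"
    "\<And>x. x \<in> carrier M \<Longrightarrow> f x = g x" for f g :: "'b \<Rightarrow> 'b"
    using that by (rule extensionalityI)
  show ?thesis
    by (rule assoc_algebraI[OF K])
      (auto simp: end_algebra_def M.a_ac M.smult_l_distr M.smult_r_distr M.smult_assoc1 M.R.m_comm
        lin_map_def Pi_iff intro!: eqI simp flip: M.smult_assoc1)
qed

text \<open>All linear maps \<open>H \<rightarrow> \<Omega>\<close>, with the products, grading and differential that \<open>\<Omega>\<close> and the coalgebra \<open>H\<close>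
  induce.  When \<open>H\<close> has infinite dimension this is not the sum of its homogeneous parts, because a linear
  map may take values in infinitely many degrees.\<close>

definition convolution_algebra :: "'k ring \<Rightarrow> ('k, 'u) hopf \<Rightarrow> ('k, 'w) gda \<Rightarrow> ('k, 'u \<Rightarrow> 'w) gda" where
  "convolution_algebra K H \<Omega> =
     \<lparr>carrier = {f \<in> extensional (carrier H). lin_map K H \<Omega> f},
      mult = (\<lambda>f g. restrict (convolution H \<Omega> f g) (carrier H)),
      one = (\<lambda>h\<in>carrier H. counit H h \<odot>\<^bsub>\<Omega>\<^esub> \<one>\<^bsub>\<Omega>\<^esub>),
      zero = (\<lambda>h\<in>carrier H. \<zero>\<^bsub>\<Omega>\<^esub>), add = (\<lambda>f g. \<lambda>h\<in>carrier H. f h \<oplus>\<^bsub>\<Omega>\<^esub> g h),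
      smult = (\<lambda>c f. \<lambda>h\<in>carrier H. c \<odot>\<^bsub>\<Omega>\<^esub> f h),
      gcomp = (\<lambda>n. {f \<in> extensional (carrier H). lin_map K H \<Omega> f \<and> (\<forall>h\<in>carrier H. f h \<in> gcomp \<Omega> n)}),
      gdiff = (\<lambda>f. \<lambda>h\<in>carrier H. gdiff \<Omega> (f h))\<rparr>"

text \<open>The sum of the homogeneous parts.\<close>

definition convolution_gda :: "'k ring \<Rightarrow> ('k, 'u) hopf \<Rightarrow> ('k, 'w) gda \<Rightarrow> ('k, 'u \<Rightarrow> 'w) gda" where
  "convolution_gda K H \<Omega> = (convolution_algebra K H \<Omega>)
     \<lparr>carrier := graded_span (convolution_algebra K H \<Omega>) (gcomp (convolution_algebra K H \<Omega>))\<rparr>"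

locale hopf_gda = hopf_algebra K H + \<Omega>: graded_diff_algebra K \<Omega>
  for K :: "'k ring" and H :: "('k, 'u) hopf" and \<Omega> :: "('k, 'w) gda" (structure)
begin

abbreviation "W \<equiv> convolution_algebra K H \<Omega>"

lemma W_eqI:
  assumes "f \<in> carrier W" "g \<in> carrier W" "\<And>h. h \<in> carrier H \<Longrightarrow> f h = g h"
  shows "f = g"
  using assms by (auto simp: convolution_algebra_def intro: extensionalityI)

lemma W_lin: "f \<in> carrier W \<Longrightarrow> lin_map K H \<Omega> f"
  by (simp add: convolution_algebra_def)

lemma W_I: "lin_map K H \<Omega> f \<Longrightarrow> restrict f (carrier H) \<in> carrier W"
  by (auto simp: convolution_algebra_def lin_map_def)

lemma W_closed [simp]: "\<lbrakk>f \<in> carrier W; h \<in> carrier H\<rbrakk> \<Longrightarrow> f h \<in> carrier \<Omega>"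
  by (rule lin_map_closed[OF W_lin])

lemma W_apply:
  "h \<in> carrier H \<Longrightarrow> (f \<otimes>\<^bsub>W\<^esub> g) h = convolution H \<Omega> f g h"
  "h \<in> carrier H \<Longrightarrow> \<one>\<^bsub>W\<^esub> h = counit H h \<odot> \<one>"
  "h \<in> carrier H \<Longrightarrow> \<zero>\<^bsub>W\<^esub> h = \<zero>"
  "h \<in> carrier H \<Longrightarrow> (f \<oplus>\<^bsub>W\<^esub> g) h = f h \<oplus> g h"
  "h \<in> carrier H \<Longrightarrow> (c \<odot>\<^bsub>W\<^esub> f) h = c \<odot> f h"
  "h \<in> carrier H \<Longrightarrow> gdiff W f h = gdiff \<Omega> (f h)"
  by (simp_all add: convolution_algebra_def)

lemma W_gcomp: "gcomp W n = {f \<in> carrier W. \<forall>h\<in>carrier H. f h \<in> gcomp \<Omega> n}"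
  by (auto simp: convolution_algebra_def)

lemma smult_linear: "c \<in> carrier K \<Longrightarrow> lin_map K \<Omega> \<Omega> (\<lambda>z. c \<odot> z)"
  by (rule lin_mapI) (simp_all add: \<Omega>.smult_r_distr K.m_comm \<Omega>.smult_assoc1[symmetric])

lemma W_unit_closed [simp]: "\<one>\<^bsub>W\<^esub> \<in> carrier W" "\<zero>\<^bsub>W\<^esub> \<in> carrier W"
proof -
  show "\<one>\<^bsub>W\<^esub> \<in> carrier W"
    using W_I[OF counit_linear[OF \<Omega>.gda_module, of "\<one>"]] by (simp add: convolution_algebra_def)
  have "lin_map K H \<Omega> (\<lambda>h. \<zero>)" by (rule lin_mapI) simp_all
  from W_I[OF this] show "\<zero>\<^bsub>W\<^esub> \<in> carrier W" by (simp add: convolution_algebra_def)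
qed

lemma W_smult_closed [simp]:
  assumes "c \<in> carrier K" "f \<in> carrier W"
  shows "c \<odot>\<^bsub>W\<^esub> f \<in> carrier W"
  using W_I[OF lin_map_comp[OF W_lin[OF assms(2)] smult_linear[OF assms(1)]]]
  by (simp add: convolution_algebra_def)

lemma W_gdiff_closed [simp]: "f \<in> carrier W \<Longrightarrow> gdiff W f \<in> carrier W"
  using W_I[OF lin_map_comp[OF W_lin \<Omega>.gdiff_linear], of f] by (simp add: convolution_algebra_def)

lemma W_mult_closed [simp]: "\<lbrakk>f \<in> carrier W; g \<in> carrier W\<rbrakk> \<Longrightarrow> f \<otimes>\<^bsub>W\<^esub> g \<in> carrier W"
  using W_I[OF convolution_linear[OF \<Omega>.gda_algebra W_lin W_lin], of f g]
  by (simp add: convolution_algebra_def)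

lemma W_add_closed [simp]:
  assumes f: "f \<in> carrier W" and g: "g \<in> carrier W"
  shows "f \<oplus>\<^bsub>W\<^esub> g \<in> carrier W"
proof -
  have "lin_map K H \<Omega> (\<lambda>h. f h \<oplus> g h)"
    using f g lin_map_add[OF W_lin[OF f]] lin_map_add[OF W_lin[OF g]]
      lin_map_smult[OF W_lin[OF f]] lin_map_smult[OF W_lin[OF g]]
    by (intro lin_mapI) (simp_all add: \<Omega>.M.a_ac \<Omega>.smult_r_distr)
  from W_I[OF this] show ?thesis by (simp add: convolution_algebra_def)
qed

lemma convolution_cong:
  assumes "h \<in> carrier H" "\<And>x. x \<in> carrier H \<Longrightarrow> f x = f' x" "\<And>x. x \<in> carrier H \<Longrightarrow> g x = g' x"
  shows "convolution H \<Omega> f g h = convolution H \<Omega> f' g' h"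
  unfolding convolution_def by (rule tensor_sum_eqI[OF comult_closed[OF assms(1)]]) (simp add: assms)

lemma convolution_add:
  assumes "f \<in> carrier W" "g \<in> carrier W" "k \<in> carrier W" "h \<in> carrier H"
  shows "convolution H \<Omega> (f \<oplus>\<^bsub>W\<^esub> g) k h = convolution H \<Omega> f k h \<oplus> convolution H \<Omega> g k h"
    and "convolution H \<Omega> k (f \<oplus>\<^bsub>W\<^esub> g) h = convolution H \<Omega> k f h \<oplus> convolution H \<Omega> k g h"
  unfolding convolution_def
  by (subst \<Omega>.M.tensor_sum_add[OF comult_closed[OF assms(4)], symmetric];
      (rule tensor_sum_eqI[OF comult_closed[OF assms(4)]])?;
      simp add: assms W_apply \<Omega>.A.l_distr \<Omega>.A.r_distr)+

lemma convolution_smult: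
  assumes "f \<in> carrier W" "k \<in> carrier W" "h \<in> carrier H" "c \<in> carrier K"
  shows "convolution H \<Omega> (c \<odot>\<^bsub>W\<^esub> f) k h = c \<odot> convolution H \<Omega> f k h"
    and "convolution H \<Omega> k (c \<odot>\<^bsub>W\<^esub> f) h = c \<odot> convolution H \<Omega> k f h"
  unfolding convolution_def
  by (subst tensor_sum_lin_map[OF \<Omega>.gda_module \<Omega>.gda_module smult_linear[OF assms(4)]
        comult_closed[OF assms(3)]];
      (rule tensor_sum_eqI[OF comult_closed[OF assms(3)]])?; simp add: assms W_apply
        \<Omega>.smult_mult_left \<Omega>.smult_mult_right)+

lemma W_algebra: "assoc_algebra K W"
proof -
  have unit: "convolution H \<Omega> \<one>\<^bsub>W\<^esub> f h = f h" "convolution H \<Omega> f \<one>\<^bsub>W\<^esub> h = f h"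
    if f: "f \<in> carrier W" and h: "h \<in> carrier H" for f h
    using convolution_counit_left[OF \<Omega>.gda_algebra W_lin[OF f] \<Omega>.A.one_closed h]
      convolution_counit_right[OF \<Omega>.gda_algebra W_lin[OF f] \<Omega>.A.one_closed h]
      convolution_cong[OF h, of "\<one>\<^bsub>W\<^esub>" _ f f] convolution_cong[OF h, of f f "\<one>\<^bsub>W\<^esub>"] f h
    by (simp_all add: W_apply)
  have assoc: "convolution H \<Omega> (f \<otimes>\<^bsub>W\<^esub> g) k h = convolution H \<Omega> f (g \<otimes>\<^bsub>W\<^esub> k) h"
    if "f \<in> carrier W" "g \<in> carrier W" "k \<in> carrier W" and h: "h \<in> carrier H" for f g k h
    using convolution_assoc[OF \<Omega>.gda_algebra that(1-3)[THEN W_lin] h]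
      convolution_cong[OF h, of "f \<otimes>\<^bsub>W\<^esub> g" "convolution H \<Omega> f g" k k]
      convolution_cong[OF h, of f f "g \<otimes>\<^bsub>W\<^esub> k" "convolution H \<Omega> g k"]
    by (simp add: W_apply)
  show ?thesis
    by (rule assoc_algebraI; (rule W_eqI)?)
      (simp_all add: K.field_axioms W_apply unit assoc convolution_add convolution_smult \<Omega>.M.a_ac
        \<Omega>.smult_l_distr \<Omega>.smult_r_distr \<Omega>.smult_assoc1)
qed

lemma W_uminus: "\<lbrakk>f \<in> carrier W; h \<in> carrier H\<rbrakk> \<Longrightarrow> (\<ominus>\<^bsub>W\<^esub> f) h = \<ominus> f h"
  using uminus_eq_smult[OF assoc_algebra_module[OF W_algebra], of f]
    uminus_eq_smult[OF \<Omega>.gda_module, of "f h"] by (simp add: W_apply)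

lemma W_sign_pow: "\<lbrakk>f \<in> carrier W; h \<in> carrier H\<rbrakk> \<Longrightarrow> sign_pow W n f h = sign_pow \<Omega> n (f h)"
  by (simp add: sign_pow_def W_uminus)

lemma sign_linear: "lin_map K \<Omega> \<Omega> (sign_pow \<Omega> n)"
  by (rule lin_mapI)
    (simp_all add: sign_pow_add \<Omega>.gda_abelian_group, simp add: sign_pow_def \<Omega>.smult_r_minus)

text \<open>Projections, differential and signs act on values, and on values the axioms hold.\<close>

lemma convolution_gda: "graded_diff_algebra K (convolution_gda K H \<Omega>)"
  unfolding convolution_gda_def
proof (rule graded_span_gda[OF W_algebra, where pr = "\<lambda>n f. \<lambda>h\<in>carrier H. hom_part \<Omega> n (f h)"])
  interpret W: ring W by (rule assoc_algebra_ring[OF W_algebra])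
  interpret MW: module K W by (rule assoc_algebra_module[OF W_algebra])
  have gc: "f \<in> carrier W" "\<And>h. h \<in> carrier H \<Longrightarrow> f h \<in> gcomp \<Omega> n" if "f \<in> gcomp W n" for f n
    using that by (auto simp: W_gcomp)
  have post: "(\<lambda>h\<in>carrier H. l (f h)) \<in> carrier W" if "lin_map K \<Omega> \<Omega> l" "f \<in> carrier W" for l f
    by (rule W_I[OF lin_map_comp[OF W_lin[OF that(2)] that(1)]])
  have post_lin: "lin_map K W W (\<lambda>f. \<lambda>h\<in>carrier H. l (f h))" if l: "lin_map K \<Omega> \<Omega> l" for l
  proof (rule lin_mapI)
    show "(\<lambda>h\<in>carrier H. l (f h)) \<in> carrier W" if "f \<in> carrier W" for f
      by (rule post[OF l that])
    show "(\<lambda>h\<in>carrier H. l ((f \<oplus>\<^bsub>W\<^esub> g) h)) = (\<lambda>h\<in>carrier H. l (f h)) \<oplus>\<^bsub>W\<^esub> (\<lambda>h\<in>carrier H. l (g h))"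
      if "f \<in> carrier W" "g \<in> carrier W" for f g
      by (rule W_eqI) (use that post[OF l] in \<open>simp_all add: W_apply lin_map_add[OF l]\<close>)
    show "(\<lambda>h\<in>carrier H. l ((c \<odot>\<^bsub>W\<^esub> f) h)) = c \<odot>\<^bsub>W\<^esub> (\<lambda>h\<in>carrier H. l (f h))"
      if "c \<in> carrier K" "f \<in> carrier W" for c f
      by (rule W_eqI) (use that post[OF l] in \<open>simp_all add: W_apply lin_map_smult[OF l]\<close>)
  qed
  show "submodule (gcomp W n) K W" for n
    by (rule MW.submoduleI)
      (auto simp: W_gcomp W_apply W_uminus \<Omega>.gcomp_uminus \<Omega>.gcomp_add \<Omega>.gcomp_smult)
  show "lin_map K W W (\<lambda>f. \<lambda>h\<in>carrier H. hom_part \<Omega> n (f h))" for n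
    by (rule post_lin[OF \<Omega>.hom_part_linear])
  show "(\<lambda>h\<in>carrier H. hom_part \<Omega> n (f h)) = f" if "f \<in> gcomp W n" for n f
    by (rule W_eqI[OF post[OF \<Omega>.hom_part_linear gc(1)[OF that]] gc(1)[OF that]])
      (simp add: \<Omega>.hom_part_homogeneous[OF gc(2)[OF that]])
  show "(\<lambda>h\<in>carrier H. hom_part \<Omega> m (f h)) = \<zero>\<^bsub>W\<^esub>" if "f \<in> gcomp W n" "m \<noteq> n" for m n f
    by (rule W_eqI[OF post[OF \<Omega>.hom_part_linear gc(1)[OF that(1)]] W.zero_closed])
      (simp add: \<Omega>.hom_part_homogeneous[OF gc(2)[OF that(1)]] that(2) W_apply)
  show "\<one>\<^bsub>W\<^esub> \<in> gcomp W 0"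
    by (simp add: W_gcomp W_apply \<Omega>.gcomp_smult \<Omega>.gcomp_one)
  show "f \<otimes>\<^bsub>W\<^esub> g \<in> gcomp W (m + n)" if f: "f \<in> gcomp W m" and g: "g \<in> gcomp W n" for m n f g
  proof -
    have "tensor_sum \<Omega> (\<lambda>x y. f x \<otimes> g y) s \<in> gcomp \<Omega> (m + n)"
      if "set s \<subseteq> carrier H \<times> carrier H" for s
      using that
      by (induction s) (auto intro!: \<Omega>.gcomp_add \<Omega>.gcomp_mult gc(2)[OF f] gc(2)[OF g])
    then show ?thesis
      using gc(1)[OF f] gc(1)[OF g] comult_closed by (simp add: W_gcomp W_apply convolution_def)
  qed
  have gdiff_W: "gdiff W = (\<lambda>f. \<lambda>h\<in>carrier H. gdiff \<Omega> (f h))"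
    by (simp add: convolution_algebra_def)
  show "lin_map K W W (gdiff W)" unfolding gdiff_W by (rule post_lin[OF \<Omega>.gdiff_linear])
  then have d_closed: "gdiff W f \<in> carrier W" if "f \<in> carrier W" for f
    using lin_map_closed that by metis
  show d_degree: "gdiff W f \<in> gcomp W (Suc n)" if "f \<in> gcomp W n" for n f
    using d_closed[OF gc(1)[OF that]] gc(2)[OF that]
    by (simp add: W_gcomp W_apply \<Omega>.gdiff_degree)
  show "gdiff W (gdiff W f) = \<zero>\<^bsub>W\<^esub>" if "f \<in> gcomp W n" for n f
    by (rule W_eqI) (use gc[OF that] d_closed in \<open>simp_all add: W_apply \<Omega>.gdiff_gdiff\<close>)
  show "gdiff W (f \<otimes>\<^bsub>W\<^esub> g) = gdiff W f \<otimes>\<^bsub>W\<^esub> g \<oplus>\<^bsub>W\<^esub> sign_pow W m (f \<otimes>\<^bsub>W\<^esub> gdiff W g)"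
    if f: "f \<in> gcomp W m" and g: "g \<in> gcomp W n" for m n f g
  proof (rule W_eqI)
    note fc [simp] = gc(1)[OF f] and gcc [simp] = gc(1)[OF g]
    note [simp] = d_closed[OF fc] d_closed[OF gcc]
    show "gdiff W (f \<otimes>\<^bsub>W\<^esub> g) \<in> carrier W" by (rule d_closed) simp
    show "gdiff W f \<otimes>\<^bsub>W\<^esub> g \<oplus>\<^bsub>W\<^esub> sign_pow W m (f \<otimes>\<^bsub>W\<^esub> gdiff W g) \<in> carrier W"
      by (simp add: sign_pow_closed W.abelian_group_axioms)
    fix h assume h: "h \<in> carrier H"
    note cl = comult_closed[OF h]
    note lin = tensor_sum_lin_map[OF \<Omega>.gda_module \<Omega>.gda_module _ cl]
    have "gdiff \<Omega> (convolution H \<Omega> f g h) = tensor_sum \<Omega> (\<lambda>x y. gdiff \<Omega> (f x \<otimes> g y)) (comult H h)"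
      unfolding convolution_def by (rule lin[OF \<Omega>.gdiff_linear]) simp
    also have "\<dots> = tensor_sum \<Omega> (\<lambda>x y. gdiff W f x \<otimes> g y \<oplus>
        sign_pow \<Omega> m (f x \<otimes> gdiff W g y)) (comult H h)"
      by (rule tensor_sum_eqI[OF cl]) (simp add: \<Omega>.gdiff_leibniz[OF gc(2)[OF f]] W_apply)
    also have "\<dots> = convolution H \<Omega> (gdiff W f) g h \<oplus>
        tensor_sum \<Omega> (\<lambda>x y. sign_pow \<Omega> m (f x \<otimes> gdiff W g y)) (comult H h)"
      unfolding convolution_def by (rule \<Omega>.M.tensor_sum_add[OF cl]) simp_all
    also have "tensor_sum \<Omega> (\<lambda>x y. sign_pow \<Omega> m (f x \<otimes> gdiff W g y)) (comult H h) =
        sign_pow \<Omega> m (convolution H \<Omega> f (gdiff W g) h)"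
      unfolding convolution_def by (rule lin[OF sign_linear, symmetric]) simp
    finally show "gdiff W (f \<otimes>\<^bsub>W\<^esub> g) h =
        (gdiff W f \<otimes>\<^bsub>W\<^esub> g \<oplus>\<^bsub>W\<^esub> sign_pow W m (f \<otimes>\<^bsub>W\<^esub> gdiff W g)) h"
      using h by (simp add: W_apply W_sign_pow)
  qed
qed

end

context hopf_gda
begin

abbreviation "C \<equiv> convolution_gda K H \<Omega>"

lemma C_fields:
  "f \<otimes>\<^bsub>C\<^esub> g = f \<otimes>\<^bsub>W\<^esub> g" "\<one>\<^bsub>C\<^esub> = \<one>\<^bsub>W\<^esub>" "\<zero>\<^bsub>C\<^esub> = \<zero>\<^bsub>W\<^esub>" "f \<oplus>\<^bsub>C\<^esub> g = f \<oplus>\<^bsub>W\<^esub> g"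
  "c \<odot>\<^bsub>C\<^esub> f = c \<odot>\<^bsub>W\<^esub> f" "gcomp C n = gcomp W n" "gdiff C f = gdiff W f"
  by (simp_all add: convolution_gda_def)

lemma C_carrier: "f \<in> carrier C \<Longrightarrow> f \<in> carrier W"
proof -
  have "f \<in> carrier W" if "f \<in> graded_span W (gcomp W)" for f
    using that by induction (auto simp: W_gcomp)
  then show "f \<in> carrier C \<Longrightarrow> f \<in> carrier W" by (simp add: convolution_gda_def)
qed

lemma C_incl: "lin_map K C W (\<lambda>f. f)"
  by (rule lin_mapI) (auto simp: C_carrier C_fields)

lemma C_module: "module K C"
  by (rule assoc_algebra_module[OF graded_diff_algebra.axioms(1)[OF convolution_gda]])

lemma C_sign_pow: "\<lbrakk>f \<in> carrier C; h \<in> carrier H\<rbrakk> \<Longrightarrow> sign_pow C n f h = sign_pow \<Omega> n (f h)"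
  using lin_map_sign_pow[OF C_module assoc_algebra_module[OF W_algebra] C_incl, of f n]
  by (simp add: W_sign_pow C_carrier)

lemma C_minus: "\<lbrakk>f \<in> carrier C; g \<in> carrier C; h \<in> carrier H\<rbrakk> \<Longrightarrow> (f \<ominus>\<^bsub>C\<^esub> g) h = f h \<ominus> g h"
  using lin_map_minus[OF C_module assoc_algebra_module[OF W_algebra] C_incl, of f g]
  by (simp add: a_minus_def W_uminus W_apply C_carrier)

text \<open>The morphism axioms may be checked on values.  The image consists of finite sums of homogeneous maps
  because the elements of \<open>\<Omega>\<close> are finite sums of homogeneous elements.\<close>

lemma gda_hom_to_convolution:
  assumes f: "\<And>h. h \<in> carrier H \<Longrightarrow> lin_map K \<Omega> \<Omega> (\<lambda>x. f x h)"
    and lin: "\<And>x. x \<in> carrier \<Omega> \<Longrightarrow> f x \<in> extensional (carrier H) \<and> lin_map K H \<Omega> (f x)"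
    and deg: "\<And>n x h. \<lbrakk>x \<in> gcomp \<Omega> n; h \<in> carrier H\<rbrakk> \<Longrightarrow> f x h \<in> gcomp \<Omega> n"
    and one: "\<And>h. h \<in> carrier H \<Longrightarrow> f \<one> h = counit H h \<odot> \<one>"
    and mult: "\<And>x y h. \<lbrakk>x \<in> carrier \<Omega>; y \<in> carrier \<Omega>; h \<in> carrier H\<rbrakk>
      \<Longrightarrow> f (x \<otimes> y) h = convolution H \<Omega> (f x) (f y) h"
    and d: "\<And>x h. \<lbrakk>x \<in> carrier \<Omega>; h \<in> carrier H\<rbrakk> \<Longrightarrow> f (gdiff \<Omega> x) h = gdiff \<Omega> (f x h)"
  shows "gda_hom K \<Omega> C f"
proof -
  have fW: "f x \<in> carrier W" if "x \<in> carrier \<Omega>" for x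
    using lin[OF that] by (simp add: convolution_algebra_def)
  have fV: "f x \<in> gcomp W n" if "x \<in> gcomp \<Omega> n" for x n
    using fW[OF \<Omega>.gcomp_carrier[OF that]] deg[OF that] by (simp add: W_gcomp)
  have add: "f (x \<oplus> y) = f x \<oplus>\<^bsub>W\<^esub> f y" if "x \<in> carrier \<Omega>" "y \<in> carrier \<Omega>" for x y
    by (rule W_eqI)
      (use that fW in \<open>simp_all add: W_apply lin_map_add[OF f]\<close>)
  have smult: "f (c \<odot> x) = c \<odot>\<^bsub>W\<^esub> f x" if "c \<in> carrier K" "x \<in> carrier \<Omega>" for x c
    by (rule W_eqI)
      (use that fW in \<open>simp_all add: W_apply lin_map_smult[OF f]\<close>)
  have zero: "f \<zero> = \<zero>\<^bsub>W\<^esub>"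
    by (rule W_eqI)
      (use fW in \<open>simp_all add: W_apply lin_map_zero[OF \<Omega>.gda_module \<Omega>.gda_module f]\<close>)
  have fC: "f x \<in> carrier C" if "x \<in> carrier \<Omega>" for x
    using that
    by (induction rule: \<Omega>.graded_induct)
      (auto simp: convolution_gda_def zero add intro: graded_span.intros fV)
  show ?thesis
  proof (intro gda_homI alg_homI lin_mapI)
    show "f \<one> = \<one>\<^bsub>C\<^esub>"
      unfolding C_fields by (rule W_eqI) (simp_all add: fW one W_apply)
    show "f (x \<otimes> y) = f x \<otimes>\<^bsub>C\<^esub> f y" if "x \<in> carrier \<Omega>" "y \<in> carrier \<Omega>" for x y
      unfolding C_fields
      by (rule W_eqI) (use that in \<open>simp_all add: fW mult W_apply\<close>)
    show "f (gdiff \<Omega> x) = gdiff C (f x)" if "x \<in> carrier \<Omega>" for x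
      unfolding C_fields
      by (rule W_eqI) (use that in \<open>simp_all add: fW d W_apply\<close>)
  qed (simp_all add: C_fields fC fV add smult)
qed

end

section \<open>Lie derivatives\<close>

locale lie_gda = lie_algebra K G + \<Omega>: graded_diff_algebra K \<Omega>
  for K :: "'k ring" and G :: "('k, 'g) lie_alg" and \<Omega> :: "('k, 'w) gda" (structure) +
  fixes i :: "'g \<Rightarrow> 'w \<Rightarrow> 'w"
  assumes op: "lie_operation K G \<Omega> i"
begin

abbreviation "L \<equiv> lie_der \<Omega> i"

lemma i_linear: "X \<in> carrier G \<Longrightarrow> lin_map K \<Omega> \<Omega> (i X)"
  using op by (simp add: lie_operation_def antiderivation_minus_one_def)

lemma i_linear_left: "\<alpha> \<in> carrier \<Omega> \<Longrightarrow> lin_map K G \<Omega> (\<lambda>X. i X \<alpha>)"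
  using op by (simp add: lie_operation_def)

lemma i_degree_zero: "\<lbrakk>X \<in> carrier G; \<alpha> \<in> gcomp \<Omega> 0\<rbrakk> \<Longrightarrow> i X \<alpha> = \<zero>"
  using op unfolding lie_operation_def antiderivation_minus_one_def degree_minus_one_def by blast

lemma i_degree_Suc: "\<lbrakk>X \<in> carrier G; \<alpha> \<in> gcomp \<Omega> (Suc n)\<rbrakk> \<Longrightarrow> i X \<alpha> \<in> gcomp \<Omega> n"
  using op by (auto simp: lie_operation_def antiderivation_minus_one_def degree_minus_one_def)

lemma i_leibniz: "\<lbrakk>X \<in> carrier G; \<alpha> \<in> gcomp \<Omega> n; \<beta> \<in> carrier \<Omega>\<rbrakk> \<Longrightarrow>
    i X (\<alpha> \<otimes> \<beta>) = i X \<alpha> \<otimes> \<beta> \<oplus> sign_pow \<Omega> n (\<alpha> \<otimes> i X \<beta>)"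
  using op by (simp add: lie_operation_def antiderivation_minus_one_def)

lemma i_bracket: "\<lbrakk>X \<in> carrier G; Y \<in> carrier G; \<alpha> \<in> carrier \<Omega>\<rbrakk> \<Longrightarrow>
    i (bracket G X Y) \<alpha> = i X (L Y \<alpha>) \<ominus> L Y (i X \<alpha>)"
  using op by (simp add: lie_operation_def)

lemma i_closed [simp]: "\<lbrakk>X \<in> carrier G; \<alpha> \<in> carrier \<Omega>\<rbrakk> \<Longrightarrow> i X \<alpha> \<in> carrier \<Omega>"
  by (rule lin_map_closed[OF i_linear])

lemma bracket_closed [simp]: "\<lbrakk>X \<in> carrier G; Y \<in> carrier G\<rbrakk> \<Longrightarrow> bracket G X Y \<in> carrier G"
  by (rule lin_map_closed[OF bracket_linear_right])

lemma L_linear: "X \<in> carrier G \<Longrightarrow> lin_map K \<Omega> \<Omega> (L X)"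
  by (rule lin_mapI)
    (simp_all add: lie_der_def lin_map_add[OF i_linear] lin_map_smult[OF i_linear] \<Omega>.gdiff_add
      \<Omega>.gdiff_smult \<Omega>.M.a_ac \<Omega>.smult_r_distr)

lemma L_closed [simp]: "\<lbrakk>X \<in> carrier G; \<alpha> \<in> carrier \<Omega>\<rbrakk> \<Longrightarrow> L X \<alpha> \<in> carrier \<Omega>"
  by (rule lin_map_closed[OF L_linear])

lemma L_linear_left: "\<alpha> \<in> carrier \<Omega> \<Longrightarrow> lin_map K G \<Omega> (\<lambda>X. L X \<alpha>)"
  by (rule lin_mapI)
    (simp_all add: lie_der_def lin_map_add[OF i_linear_left] lin_map_smult[OF i_linear_left]
      \<Omega>.gdiff_add \<Omega>.gdiff_smult \<Omega>.M.a_ac \<Omega>.smult_r_distr)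

lemma L_gdiff: "\<lbrakk>X \<in> carrier G; \<alpha> \<in> carrier \<Omega>\<rbrakk> \<Longrightarrow> L X (gdiff \<Omega> \<alpha>) = gdiff \<Omega> (L X \<alpha>)"
  by (simp add: lie_der_def \<Omega>.gdiff_gdiff \<Omega>.gdiff_add
      lin_map_zero[OF \<Omega>.gda_module \<Omega>.gda_module i_linear])

lemma L_degree: "\<lbrakk>X \<in> carrier G; \<alpha> \<in> gcomp \<Omega> n\<rbrakk> \<Longrightarrow> L X \<alpha> \<in> gcomp \<Omega> n"
  by (cases n)
    (auto simp: lie_der_def i_degree_zero intro!: \<Omega>.gcomp_add i_degree_Suc \<Omega>.gdiff_degree)

text \<open>The graded commutator of two antiderivations of degrees \<open>-1\<close> and \<open>1\<close> is a derivation.\<close>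

lemma L_leibniz:
  assumes X: "X \<in> carrier G" and x: "x \<in> carrier \<Omega>" and y: "y \<in> carrier \<Omega>"
  shows "L X (x \<otimes> y) = L X x \<otimes> y \<oplus> x \<otimes> L X y"
  using x
proof (induction rule: \<Omega>.graded_induct)
  case zero
  then show ?case
    using X y lin_map_zero[OF \<Omega>.gda_module \<Omega>.gda_module L_linear[OF X]] by simp
next
  case (add n x z)
  have x: "x \<in> gcomp \<Omega> n" and [simp]: "x \<in> carrier \<Omega>" "y \<in> carrier \<Omega>" "z \<in> carrier \<Omega>" "X \<in> carrier G"
    using add y X by auto
  note i_add = lin_map_add[OF i_linear[OF X]]
    and i_sign = lin_map_sign_pow[OF \<Omega>.gda_module \<Omega>.gda_module i_linear[OF X]]
  let ?s = "sign_pow \<Omega> n"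
  have s_add: "?s (u \<oplus> v) = ?s u \<oplus> ?s v" if "u \<in> carrier \<Omega>" "v \<in> carrier \<Omega>" for u v
    by (rule sign_pow_add[OF \<Omega>.gda_abelian_group that])
  have ss: "?s (?s u) = u" "sign_pow \<Omega> (Suc n) u = \<ominus> ?s u" if "u \<in> carrier \<Omega>" for u
    using that by (simp_all add: sign_pow_def)
  \<comment> \<open>\<open>i X x\<close> has degree \<open>n - 1\<close>, or is zero when \<open>n = 0\<close>; a single sign covers both.\<close>
  have d: "gdiff \<Omega> (i X x \<otimes> y) = gdiff \<Omega> (i X x) \<otimes> y \<oplus> \<ominus> ?s (i X x \<otimes> gdiff \<Omega> y)"
  proof (cases n)
    case 0
    then show ?thesis using i_degree_zero[OF X] x by (simp add: sign_pow_def)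
  next
    case (Suc m)
    then have "i X x \<in> gcomp \<Omega> m" using i_degree_Suc[OF X] x by simp
    then show ?thesis using \<Omega>.gdiff_leibniz[of "i X x" m y] by (simp add: Suc sign_pow_def)
  qed
  have "L X (x \<otimes> y) =
      (i X (gdiff \<Omega> x) \<otimes> y \<oplus> \<ominus> ?s (gdiff \<Omega> x \<otimes> i X y) \<oplus>
        (?s (i X x \<otimes> gdiff \<Omega> y) \<oplus> x \<otimes> i X (gdiff \<Omega> y))) \<oplus>
      (gdiff \<Omega> (i X x) \<otimes> y \<oplus> \<ominus> ?s (i X x \<otimes> gdiff \<Omega> y) \<oplus>
        (?s (gdiff \<Omega> x \<otimes> i X y) \<oplus> x \<otimes> gdiff \<Omega> (i X y)))"
    by (simp add: lie_der_def \<Omega>.gdiff_leibniz[OF x] i_leibniz[OF X x] i_add \<Omega>.gdiff_add d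
        i_leibniz[OF X \<Omega>.gdiff_degree[OF x]] i_sign \<Omega>.gdiff_sign_pow s_add ss)
  also have "\<dots> = (i X (gdiff \<Omega> x) \<otimes> y \<oplus> gdiff \<Omega> (i X x) \<otimes> y) \<oplus>
      (x \<otimes> i X (gdiff \<Omega> y) \<oplus> x \<otimes> gdiff \<Omega> (i X y)) \<oplus>
      ((?s (gdiff \<Omega> x \<otimes> i X y) \<oplus> \<ominus> ?s (gdiff \<Omega> x \<otimes> i X y)) \<oplus>
       (?s (i X x \<otimes> gdiff \<Omega> y) \<oplus> \<ominus> ?s (i X x \<otimes> gdiff \<Omega> y)))"
    by (simp add: \<Omega>.M.a_ac del: \<Omega>.M.add.r_inv)
  also have "\<dots> = L X x \<otimes> y \<oplus> x \<otimes> L X y"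
    by (simp add: \<Omega>.M.r_neg lie_der_def \<Omega>.A.l_distr \<Omega>.A.r_distr)
  finally show ?case
    using add.IH by (simp add: \<Omega>.A.l_distr \<Omega>.A.r_distr lin_map_add[OF L_linear] \<Omega>.M.a_ac)
qed

text \<open>The Lie derivatives commute with \<open>d\<close>, so this follows from the commutation of \<open>i X\<close> with \<open>L Y\<close>.\<close>

lemma L_bracket:
  assumes X: "X \<in> carrier G" and Y: "Y \<in> carrier G" and \<alpha>: "\<alpha> \<in> carrier \<Omega>"
  shows "L (bracket G X Y) \<alpha> = L X (L Y \<alpha>) \<ominus> L Y (L X \<alpha>)"
proof -
  note [simp] = assms
  have "L (bracket G X Y) \<alpha> =
      (i X (gdiff \<Omega> (L Y \<alpha>)) \<ominus> L Y (i X (gdiff \<Omega> \<alpha>))) \<oplus>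
      (gdiff \<Omega> (i X (L Y \<alpha>)) \<ominus> L Y (gdiff \<Omega> (i X \<alpha>)))"
    unfolding lie_der_def[of \<Omega> i "bracket G X Y"]
    by (simp add: i_bracket L_gdiff a_minus_def \<Omega>.gdiff_add \<Omega>.gdiff_uminus)
  also have "\<dots> = L X (L Y \<alpha>) \<ominus> L Y (L X \<alpha>)"
    by (simp add: lie_der_def[of \<Omega> i X] lin_map_add[OF L_linear] a_minus_def \<Omega>.M.minus_add \<Omega>.M.a_ac)
  finally show ?thesis .
qed

lemma L_lie_to_end:
  "lie_to_alg_hom K G (end_algebra K \<Omega>) (\<lambda>X. restrict (L X) (carrier \<Omega>))"
proof -
  let ?E = "end_algebra K \<Omega>"
  have E: "assoc_algebra K ?E" by (rule end_algebra[OF K.field_axioms \<Omega>.gda_module])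
  have closed: "restrict (L X) (carrier \<Omega>) \<in> carrier ?E" if "X \<in> carrier G" for X
    using L_linear[OF that] by (auto simp: end_algebra_def lin_map_def)
  have mult: "restrict (L X) (carrier \<Omega>) \<otimes>\<^bsub>?E\<^esub> restrict (L Y) (carrier \<Omega>) =
      (\<lambda>x\<in>carrier \<Omega>. L X (L Y x))" if "X \<in> carrier G" "Y \<in> carrier G" for X Y
    using that by (auto simp: end_algebra_def)
  have uminus: "\<ominus>\<^bsub>?E\<^esub> f = (\<lambda>x\<in>carrier \<Omega>. \<ominus> f x)" if "f \<in> carrier ?E" for f
  proof -
    have "f x \<in> carrier \<Omega>" if "x \<in> carrier \<Omega>" for x
      using \<open>f \<in> carrier ?E\<close> that by (auto simp: end_algebra_def lin_map_def)
    then have "(\<lambda>x\<in>carrier \<Omega>. \<ominus> f x) = (\<ominus>\<^bsub>K\<^esub> \<one>\<^bsub>K\<^esub>) \<odot>\<^bsub>?E\<^esub> f"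
      by (auto simp: end_algebra_def uminus_eq_smult[OF \<Omega>.gda_module])
    then show ?thesis using uminus_eq_smult[OF assoc_algebra_module[OF E] that] by simp
  qed
  have prod_closed: "(\<lambda>x\<in>carrier \<Omega>. L X (L Y x)) \<in> carrier ?E" if "X \<in> carrier G" "Y \<in> carrier G" for X Y
    using ring.ring_simprules(5)[OF assoc_algebra_ring[OF E] closed[OF that(1)] closed[OF that(2)]]
    unfolding mult[OF that] .
  show ?thesis
    unfolding lie_to_alg_hom_def
  proof (intro conjI ballI)
    show "lin_map K G ?E (\<lambda>X. restrict (L X) (carrier \<Omega>))"
    proof (rule lin_mapI)
      show "restrict (L (X \<oplus>\<^bsub>G\<^esub> Y)) (carrier \<Omega>) =
          restrict (L X) (carrier \<Omega>) \<oplus>\<^bsub>?E\<^esub> restrict (L Y) (carrier \<Omega>)"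
        if "X \<in> carrier G" "Y \<in> carrier G" for X Y
        using lin_map_add[OF L_linear_left that] by (auto simp: end_algebra_def)
      show "restrict (L (c \<odot>\<^bsub>G\<^esub> X)) (carrier \<Omega>) = c \<odot>\<^bsub>?E\<^esub> restrict (L X) (carrier \<Omega>)"
        if "c \<in> carrier K" "X \<in> carrier G" for c X
        using lin_map_smult[OF L_linear_left that] by (auto simp: end_algebra_def)
    qed (rule closed)
    fix X Y assume XY: "X \<in> carrier G" "Y \<in> carrier G"
    show "restrict (L (bracket G X Y)) (carrier \<Omega>) =
        restrict (L X) (carrier \<Omega>) \<otimes>\<^bsub>?E\<^esub> restrict (L Y) (carrier \<Omega>) \<ominus>\<^bsub>?E\<^esub>
        restrict (L Y) (carrier \<Omega>) \<otimes>\<^bsub>?E\<^esub> restrict (L X) (carrier \<Omega>)"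
      unfolding mult[OF XY] mult[OF XY(2,1)] a_minus_def uminus[OF prod_closed[OF XY(2,1)]]
      using L_bracket[OF XY] by (auto simp: end_algebra_def a_minus_def)
  qed
qed

end

section \<open>The operation of the enveloping algebra\<close>

locale envelope_operation = lie_gda K G \<Omega> i + U: hopf_gda K U \<Omega>
  for K :: "'k ring" and G :: "('k, 'g) lie_alg" and \<Omega> :: "('k, 'w) gda" (structure)
    and i :: "'g \<Rightarrow> 'w \<Rightarrow> 'w" and U :: "('k, 'u) hopf" +
  fixes A :: "('k, 'a) module" and \<iota> :: "'a \<Rightarrow> 'w" and j :: "'g \<Rightarrow> 'u"
  assumes env: "differential_envelope TYPE(('u, 'w) universe) K A \<Omega> \<iota>"
    and enveloping: "enveloping_hopf_algebra TYPE(('u, 'w) universe) K G U j"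
begin

lemma universal: "universal_enveloping_algebra TYPE(('u, 'w) universe) K G U j"
  using enveloping by (simp add: enveloping_hopf_algebra_def)

lemma j_closed [simp]: "X \<in> carrier G \<Longrightarrow> j X \<in> carrier U"
  using universal by (auto simp: universal_enveloping_algebra_def lie_to_alg_hom_def lin_map_def)

lemma j_primitive: "X \<in> carrier G \<Longrightarrow> primitive K U (j X)"
  using enveloping by (simp add: enveloping_hopf_algebra_def primitive_def)

lemmas counit_j = j_primitive[unfolded primitive_def, THEN conjunct2, THEN conjunct2]

lemma \<Omega>_induct [consumes 1, case_names add smult base diff mult]:
  assumes "\<alpha> \<in> carrier \<Omega>"
    and "\<And>x y. \<lbrakk>x \<in> carrier \<Omega>; y \<in> carrier \<Omega>; P x; P y\<rbrakk> \<Longrightarrow> P (x \<oplus> y)"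
    and "\<And>c x. \<lbrakk>c \<in> carrier K; x \<in> carrier \<Omega>; P x\<rbrakk> \<Longrightarrow> P (c \<odot> x)"
    and "\<And>a. a \<in> gcomp \<Omega> 0 \<Longrightarrow> P a"
    and "\<And>n x. \<lbrakk>x \<in> gcomp \<Omega> n; P x\<rbrakk> \<Longrightarrow> P (gdiff \<Omega> x)"
    and "\<And>m n x y. \<lbrakk>x \<in> gcomp \<Omega> m; y \<in> gcomp \<Omega> n; P x; P y\<rbrakk> \<Longrightarrow> P (x \<otimes> y)"
  shows "P \<alpha>"
proof (rule envelope_induct[OF env _ assms(1)])
  show "inj (\<lambda>w. {[Inr w :: 'u + 'w]})" by (auto simp: inj_def)
qed (use assms in auto)

lemma U_induct [consumes 1, case_names one add smult mult]:
  assumes "h \<in> carrier U"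
    and "P \<one>\<^bsub>U\<^esub>"
    and "\<And>g h. \<lbrakk>g \<in> carrier U; h \<in> carrier U; P g; P h\<rbrakk> \<Longrightarrow> P (g \<oplus>\<^bsub>U\<^esub> h)"
    and "\<And>c h. \<lbrakk>c \<in> carrier K; h \<in> carrier U; P h\<rbrakk> \<Longrightarrow> P (c \<odot>\<^bsub>U\<^esub> h)"
    and "\<And>h X. \<lbrakk>h \<in> carrier U; X \<in> carrier G; P h\<rbrakk> \<Longrightarrow> P (h \<otimes>\<^bsub>U\<^esub> j X)"
  shows "P h"
proof (rule enveloping_induct[OF universal _ assms(1)])
  show "inj (\<lambda>u. {[Inl u :: 'u + 'w]})" by (auto simp: inj_def)
qed (use assms in auto)

text \<open>The representation of the enveloping algebra by iterated Lie derivatives.\<close>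

definition act :: "'u \<Rightarrow> 'w \<Rightarrow> 'w" where
  "act = (SOME \<Phi>. alg_hom K U (end_algebra K \<Omega>) \<Phi> \<and>
     (\<forall>X\<in>carrier G. \<Phi> (j X) = restrict (L X) (carrier \<Omega>)))"

lemma act: "alg_hom K U (end_algebra K \<Omega>) act"
  and act_restrict: "X \<in> carrier G \<Longrightarrow> act (j X) = restrict (L X) (carrier \<Omega>)"
proof -
  \<comment> \<open>A linear endomorphism is encoded by its graph.\<close>
  let ?e = "\<lambda>f. (\<lambda>x. [Inr x, Inr (f x)] :: ('u + 'w) list) ` UNIV"
  have "inj_on ?e (carrier (end_algebra K \<Omega>))"
  proof (rule inj_onI)
    fix f g :: "'w \<Rightarrow> 'w" assume "?e f = ?e g"
    then have "[Inr x, Inr (f x)] \<in> ?e g" for x by blast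
    then show "f = g" by (intro ext) auto
  qed
  note ext = enveloping_extension[OF universal end_algebra[OF K.field_axioms \<Omega>.gda_module] this
      L_lie_to_end]
  have "\<exists>\<Phi>. alg_hom K U (end_algebra K \<Omega>) \<Phi> \<and>
     (\<forall>X\<in>carrier G. \<Phi> (j X) = restrict (L X) (carrier \<Omega>))"
    by (rule ext) blast
  from someI_ex[OF this] show "alg_hom K U (end_algebra K \<Omega>) act"
    and "X \<in> carrier G \<Longrightarrow> act (j X) = restrict (L X) (carrier \<Omega>)"
    unfolding act_def by blast+
qed

lemma act_linear: "h \<in> carrier U \<Longrightarrow> lin_map K \<Omega> \<Omega> (act h)"
  using lin_map_closed[OF alg_hom_lin[OF act]] by (simp add: end_algebra_def)

lemma act_closed [simp]: "\<lbrakk>h \<in> carrier U; \<alpha> \<in> carrier \<Omega>\<rbrakk> \<Longrightarrow> act h \<alpha> \<in> carrier \<Omega>"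
  by (rule lin_map_closed[OF act_linear])

lemma act_linear_left: "\<alpha> \<in> carrier \<Omega> \<Longrightarrow> lin_map K U \<Omega> (\<lambda>h. act h \<alpha>)"
  using lin_map_add[OF alg_hom_lin[OF act]] lin_map_smult[OF alg_hom_lin[OF act]]
  by (intro lin_mapI) (simp_all add: end_algebra_def)

lemma act_one: "\<alpha> \<in> carrier \<Omega> \<Longrightarrow> act \<one>\<^bsub>U\<^esub> \<alpha> = \<alpha>"
  using alg_hom_one[OF act] by (simp add: end_algebra_def)

lemma act_mult:
  "\<lbrakk>g \<in> carrier U; h \<in> carrier U; \<alpha> \<in> carrier \<Omega>\<rbrakk> \<Longrightarrow> act (g \<otimes>\<^bsub>U\<^esub> h) \<alpha> = act g (act h \<alpha>)"
  using alg_hom_mult[OF act] by (simp add: end_algebra_def)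

lemma act_j: "\<lbrakk>X \<in> carrier G; \<alpha> \<in> carrier \<Omega>\<rbrakk> \<Longrightarrow> act (j X) \<alpha> = L X \<alpha>"
  by (simp add: act_restrict)

lemmas act_simps = lin_map_add[OF act_linear] lin_map_smult[OF act_linear]
  lin_map_add[OF act_linear_left] lin_map_smult[OF act_linear_left] act_one act_mult act_j

lemma act_degree:
  assumes "h \<in> carrier U" "\<alpha> \<in> gcomp \<Omega> n"
  shows "act h \<alpha> \<in> gcomp \<Omega> n"
  using assms
proof (induction arbitrary: \<alpha> rule: U_induct)
  case (mult h X)
  then have "\<alpha> \<in> carrier \<Omega>" by simp
  then show ?case using mult by (simp add: act_simps L_degree)
qed (auto simp: act_simps \<Omega>.gcomp_add \<Omega>.gcomp_smult)

lemma act_gdiff: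
  assumes "h \<in> carrier U" "\<alpha> \<in> carrier \<Omega>"
  shows "act h (gdiff \<Omega> \<alpha>) = gdiff \<Omega> (act h \<alpha>)"
  using assms
  by (induction arbitrary: \<alpha> rule: U_induct)
    (simp_all add: act_simps L_gdiff \<Omega>.gdiff_add \<Omega>.gdiff_smult)

lemma act_bilinear: "\<lbrakk>\<alpha> \<in> carrier \<Omega>; \<beta> \<in> carrier \<Omega>\<rbrakk> \<Longrightarrow>
    bilinear_map K U \<Omega> (\<lambda>x y. act x \<alpha> \<otimes> act y \<beta>)"
  by (rule bilinear_map_mult[OF \<Omega>.gda_algebra act_linear_left act_linear_left])

text \<open>\<open>\<Omega>\<close> is a module algebra: elements of \<open>g\<close> act by derivations and are primitive, and both
  sides behave alike when \<open>h\<close> is multiplied by such an element.\<close>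

lemma act_product:
  assumes "h \<in> carrier U" "\<alpha> \<in> carrier \<Omega>" "\<beta> \<in> carrier \<Omega>"
  shows "act h (\<alpha> \<otimes> \<beta>) = tensor_sum \<Omega> (\<lambda>x y. act x \<alpha> \<otimes> act y \<beta>) (comult U h)"
  using assms
proof (induction arbitrary: \<alpha> \<beta> rule: U_induct)
  case one
  then show ?case
    using U.sweedler_one[OF act_bilinear \<Omega>.gda_module] by (simp add: act_simps)
next
  case (add g h)
  then show ?case
    using lin_map_add[OF U.sweedler_linear[OF act_bilinear \<Omega>.gda_module]] by (simp add: act_simps)
next
  case (smult c h)
  then show ?case
    using lin_map_smult[OF U.sweedler_linear[OF act_bilinear \<Omega>.gda_module]] by (simp add: act_simps)
next
  case (mult h X)
  note eqI = tensor_sum_eqI[OF U.comult_closed[OF mult.hyps(1)]]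
  have "act (h \<otimes>\<^bsub>U\<^esub> j X) (\<alpha> \<otimes> \<beta>) =
      act h (L X \<alpha> \<otimes> \<beta>) \<oplus> act h (\<alpha> \<otimes> L X \<beta>)"
    using mult by (simp add: act_simps L_leibniz)
  also have "\<dots> = tensor_sum \<Omega> (\<lambda>x y. act (x \<otimes>\<^bsub>U\<^esub> j X) \<alpha> \<otimes> act y \<beta>) (comult U h) \<oplus>
      tensor_sum \<Omega> (\<lambda>x y. act x \<alpha> \<otimes> act (y \<otimes>\<^bsub>U\<^esub> j X) \<beta>) (comult U h)"
    unfolding mult.IH[OF L_closed[OF mult.hyps(2) mult.prems(1)] mult.prems(2)]
      mult.IH[OF mult.prems(1) L_closed[OF mult.hyps(2) mult.prems(2)]]
    using mult by (intro arg_cong2[where f = "add \<Omega>"] eqI) (simp_all add: act_simps)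
  also have "\<dots> = tensor_sum \<Omega> (\<lambda>x y. act x \<alpha> \<otimes> act y \<beta>) (comult U (h \<otimes>\<^bsub>U\<^esub> j X))"
    by (rule U.sweedler_mult_primitive[OF act_bilinear[OF mult.prems] \<Omega>.gda_module mult.hyps(1)
        j_primitive[OF mult.hyps(2)], symmetric])
  finally show ?case .
qed

definition trivial_orbit :: "'w \<Rightarrow> 'u \<Rightarrow> 'w" where
  "trivial_orbit \<alpha> = (\<lambda>h\<in>carrier U. counit U h \<odot> \<alpha>)"

definition orbit :: "'w \<Rightarrow> 'u \<Rightarrow> 'w" where
  "orbit \<alpha> = (\<lambda>h\<in>carrier U. act h \<alpha>)"

lemma restrict_linear: "lin_map K U \<Omega> f \<Longrightarrow> lin_map K U \<Omega> (restrict f (carrier U))"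
  by (auto simp: lin_map_def)

lemma trivial_orbit_hom: "gda_hom K \<Omega> (convolution_gda K U \<Omega>) trivial_orbit"
proof (rule U.gda_hom_to_convolution)
  show "lin_map K \<Omega> \<Omega> (\<lambda>x. trivial_orbit x h)" if "h \<in> carrier U" for h
    using U.smult_linear[OF U.counit_closed[OF that]] that by (simp add: trivial_orbit_def)
  show "trivial_orbit x \<in> extensional (carrier U) \<and> lin_map K U \<Omega> (trivial_orbit x)"
    if "x \<in> carrier \<Omega>" for x
    using restrict_linear[OF U.counit_linear[OF \<Omega>.gda_module that]]
    by (simp add: trivial_orbit_def)
  show "trivial_orbit (x \<otimes> y) h = convolution U \<Omega> (trivial_orbit x) (trivial_orbit y) h"
    if "x \<in> carrier \<Omega>" "y \<in> carrier \<Omega>" "h \<in> carrier U" for x y h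
    using U.convolution_counit_left[OF \<Omega>.gda_algebra
        restrict_linear[OF U.counit_linear[OF \<Omega>.gda_module that(2)]] that(1,3)]
      U.convolution_cong[OF that(3), of "trivial_orbit x" "\<lambda>h. counit U h \<odot> x"
        "trivial_orbit y" "trivial_orbit y"] that
    by (simp add: trivial_orbit_def \<Omega>.smult_mult_right)
qed (simp_all add: trivial_orbit_def \<Omega>.gcomp_smult \<Omega>.gdiff_smult)

lemma orbit_hom: "gda_hom K \<Omega> (convolution_gda K U \<Omega>) orbit"
proof (rule U.gda_hom_to_convolution)
  show "lin_map K \<Omega> \<Omega> (\<lambda>x. orbit x h)" if "h \<in> carrier U" for h
    using act_linear[OF that] that by (simp add: orbit_def)
  show "orbit x \<in> extensional (carrier U) \<and> lin_map K U \<Omega> (orbit x)" if "x \<in> carrier \<Omega>" for x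
    using restrict_linear[OF act_linear_left[OF that]] by (simp add: orbit_def)
  show "orbit (x \<otimes> y) h = convolution U \<Omega> (orbit x) (orbit y) h"
    if "x \<in> carrier \<Omega>" "y \<in> carrier \<Omega>" "h \<in> carrier U" for x y h
    using U.convolution_cong[OF that(3), of "orbit x" "\<lambda>h. act h x" "orbit y" "\<lambda>h. act h y"]
      act_product[OF that(3,1,2)] that
    by (simp add: orbit_def convolution_def)
  show "orbit \<one> h = counit U h \<odot> \<one>" if "h \<in> carrier U" for h
    using that
  proof (induction rule: U_induct)
    case one
    then show ?case by (simp add: orbit_def act_one U.counit_simps)
  next
    case (add g h)
    then show ?case by (simp add: orbit_def act_simps U.counit_simps \<Omega>.smult_l_distr)
  next
    case (smult c h)
    then show ?case by (simp add: orbit_def act_simps U.counit_smult \<Omega>.smult_assoc1)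
  next
    case (mult h X)
    have "L X (\<one> \<otimes> \<one>) = L X \<one> \<oplus> L X \<one>"
      using mult by (subst L_leibniz) simp_all
    then have "L X \<one> = \<zero>" using mult by simp
    then show ?case
      using mult lin_map_zero[OF \<Omega>.gda_module \<Omega>.gda_module act_linear]
      by (simp add: orbit_def act_simps U.counit_simps counit_j)
  qed
qed (simp_all add: orbit_def act_degree act_gdiff)

lemma contraction_exists: "\<exists>p. twisted_homotopy K \<Omega> (convolution_gda K U \<Omega>) trivial_orbit orbit p"
proof -
  \<comment> \<open>A triple of functions is encoded by its joint graph.\<close>
  let ?e = "\<lambda>(a, p, q). (\<lambda>u. [Inl u, Inr (a u), Inr (p u), Inr (q u)] :: ('u + 'w) list) ` UNIV"
  have "inj ?e"
  proof (rule injI)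
    fix x y :: "('u \<Rightarrow> 'w) \<times> ('u \<Rightarrow> 'w) \<times> ('u \<Rightarrow> 'w)"
    assume eq: "?e x = ?e y"
    obtain a p q a' p' q' where xy: "x = (a, p, q)" "y = (a', p', q')" by (cases x; cases y) auto
    have "(\<lambda>u. [Inl u, Inr (a u), Inr (p u), Inr (q u)] :: ('u + 'w) list) ` UNIV =
      (\<lambda>u. [Inl u, Inr (a' u), Inr (p' u), Inr (q' u)]) ` UNIV"
      using eq by (simp add: xy)
    then have "[Inl u, Inr (a u), Inr (p u), Inr (q u)] \<in>
        (\<lambda>u. [Inl u, Inr (a' u), Inr (p' u), Inr (q' u)] :: ('u + 'w) list) ` UNIV" for u
      by blast
    then have "a u = a' u \<and> p u = p' u \<and> q u = q' u" for u by auto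
    then show "x = y" by (auto simp: xy)
  qed
  then show ?thesis by (rule gda_hom_homotopy[OF env U.convolution_gda _ trivial_orbit_hom orbit_hom])
qed

text \<open>The operation of the enveloping algebra: the homotopy between the trivial and the given action, with
  its arguments exchanged.\<close>

definition I :: "'u \<Rightarrow> 'w \<Rightarrow> 'w" where
  "I h \<alpha> = (SOME p. twisted_homotopy K \<Omega> (convolution_gda K U \<Omega>) trivial_orbit orbit p) \<alpha> h"

lemma I_homotopy: "twisted_homotopy K \<Omega> (convolution_gda K U \<Omega>) trivial_orbit orbit (\<lambda>\<alpha> h. I h \<alpha>)"
  unfolding I_def by (rule someI_ex[OF contraction_exists])

lemma I_carrier: "\<alpha> \<in> carrier \<Omega> \<Longrightarrow> (\<lambda>h. I h \<alpha>) \<in> carrier (convolution_gda K U \<Omega>)"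
  using I_homotopy by (auto simp: twisted_homotopy_def lin_map_def)

lemma I_linear_left: "\<alpha> \<in> carrier \<Omega> \<Longrightarrow> lin_map K U \<Omega> (\<lambda>h. I h \<alpha>)"
  by (rule U.W_lin[OF U.C_carrier[OF I_carrier]])

lemma I_closed [simp]: "\<lbrakk>h \<in> carrier U; \<alpha> \<in> carrier \<Omega>\<rbrakk> \<Longrightarrow> I h \<alpha> \<in> carrier \<Omega>"
  by (rule lin_map_closed[OF I_linear_left])

lemma I_linear:
  assumes h: "h \<in> carrier U"
  shows "lin_map K \<Omega> \<Omega> (I h)"
proof (rule lin_mapI)
  have lin: "lin_map K \<Omega> (convolution_gda K U \<Omega>) (\<lambda>\<alpha> h. I h \<alpha>)"
    using I_homotopy by (simp add: twisted_homotopy_def)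
  show "I h (x \<oplus> y) = I h x \<oplus> I h y" if "x \<in> carrier \<Omega>" "y \<in> carrier \<Omega>" for x y
    using fun_cong[OF lin_map_add[OF lin that], of h] h by (simp add: U.C_fields U.W_apply)
  show "I h (c \<odot> x) = c \<odot> I h x" if "c \<in> carrier K" "x \<in> carrier \<Omega>" for c x
    using fun_cong[OF lin_map_smult[OF lin that], of h] h by (simp add: U.C_fields U.W_apply)
qed (use h in simp)

lemma I_degree_zero:
  assumes "h \<in> carrier U" "\<alpha> \<in> gcomp \<Omega> 0"
  shows "I h \<alpha> = \<zero>"
proof -
  have "(\<lambda>h. I h \<alpha>) = \<zero>\<^bsub>convolution_gda K U \<Omega>\<^esub>"
    using I_homotopy assms(2) by (simp add: twisted_homotopy_def)
  from fun_cong[OF this, of h] show ?thesis using assms(1) by (simp add: U.C_fields U.W_apply)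
qed

lemma I_degree_Suc:
  assumes "h \<in> carrier U" "\<alpha> \<in> gcomp \<Omega> (Suc n)"
  shows "I h \<alpha> \<in> gcomp \<Omega> n"
proof -
  have "(\<lambda>h. I h \<alpha>) \<in> gcomp (convolution_gda K U \<Omega>) n"
    using I_homotopy assms(2) by (simp add: twisted_homotopy_def)
  then show ?thesis using assms(1) by (simp add: U.C_fields U.W_gcomp)
qed

text \<open>The derivation property of the homotopy, evaluated at \<open>h\<close>; convolution with \<open>h \<mapsto> \<epsilon>(h) \<alpha>\<close> on the left
  is multiplication by \<open>\<alpha>\<close>.\<close>

lemma I_product:
  assumes h: "h \<in> carrier U" and \<alpha>: "\<alpha> \<in> gcomp \<Omega> n" and \<beta>: "\<beta> \<in> carrier \<Omega>"
  shows "I h (\<alpha> \<otimes> \<beta>) = tensor_sum \<Omega> (\<lambda>x y. I x \<alpha> \<otimes> act y \<beta>) (comult U h) \<oplus>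
    sign_pow \<Omega> n (\<alpha> \<otimes> I h \<beta>)"
proof -
  let ?C = "convolution_gda K U \<Omega>"
  interpret C: ring ?C by (rule assoc_algebra_ring[OF graded_diff_algebra.axioms(1)[OF U.convolution_gda]])
  have [simp]: "\<alpha> \<in> carrier \<Omega>" using \<alpha> by simp
  have t: "trivial_orbit \<alpha> \<in> carrier ?C"
    by (rule lin_map_closed[OF alg_hom_lin[OF gda_homD(1)[OF trivial_orbit_hom]]]) simp
  have "(\<lambda>h. I h (\<alpha> \<otimes> \<beta>)) = (\<lambda>h. I h \<alpha>) \<otimes>\<^bsub>?C\<^esub> orbit \<beta> \<oplus>\<^bsub>?C\<^esub>
      sign_pow ?C n (trivial_orbit \<alpha> \<otimes>\<^bsub>?C\<^esub> (\<lambda>h. I h \<beta>))"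
    using I_homotopy \<alpha> \<beta> by (simp add: twisted_homotopy_def)
  from fun_cong[OF this, of h]
  have "I h (\<alpha> \<otimes> \<beta>) = convolution U \<Omega> (\<lambda>h. I h \<alpha>) (orbit \<beta>) h \<oplus>
      sign_pow \<Omega> n (convolution U \<Omega> (trivial_orbit \<alpha>) (\<lambda>h. I h \<beta>) h)"
    using h C.m_closed[OF t I_carrier[OF \<beta>]] by (simp add: U.C_fields U.W_apply U.C_sign_pow[unfolded U.C_fields])
  moreover have "convolution U \<Omega> (trivial_orbit \<alpha>) (\<lambda>h. I h \<beta>) h = \<alpha> \<otimes> I h \<beta>"
    using U.convolution_counit_left[OF \<Omega>.gda_algebra I_linear_left[OF \<beta>] _ h, of \<alpha>]
      U.convolution_cong[OF h, of "trivial_orbit \<alpha>" "\<lambda>h. counit U h \<odot> \<alpha>" "\<lambda>h. I h \<beta>" "\<lambda>h. I h \<beta>"]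
    by (simp add: trivial_orbit_def)
  moreover have "convolution U \<Omega> (\<lambda>h. I h \<alpha>) (orbit \<beta>) h =
      tensor_sum \<Omega> (\<lambda>x y. I x \<alpha> \<otimes> act y \<beta>) (comult U h)"
    unfolding convolution_def
    by (rule tensor_sum_eqI[OF U.comult_closed[OF h]]) (simp add: orbit_def)
  ultimately show ?thesis by simp
qed

lemma I_gdiff:
  assumes h: "h \<in> carrier U" and \<alpha>: "\<alpha> \<in> carrier \<Omega>"
  shows "I h (gdiff \<Omega> \<alpha>) = (act h \<alpha> \<ominus> counit U h \<odot> \<alpha>) \<ominus> gdiff \<Omega> (I h \<alpha>)"
proof -
  let ?C = "convolution_gda K U \<Omega>"
  interpret C: graded_diff_algebra K ?C by (rule U.convolution_gda)
  have t: "trivial_orbit \<alpha> \<in> carrier ?C" "orbit \<alpha> \<in> carrier ?C"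
    using lin_map_closed[OF alg_hom_lin[OF gda_homD(1)[OF trivial_orbit_hom]] \<alpha>]
      lin_map_closed[OF alg_hom_lin[OF gda_homD(1)[OF orbit_hom]] \<alpha>] by simp_all
  have "(\<lambda>h. I h (gdiff \<Omega> \<alpha>)) = (orbit \<alpha> \<ominus>\<^bsub>?C\<^esub> trivial_orbit \<alpha>) \<ominus>\<^bsub>?C\<^esub> gdiff ?C (\<lambda>h. I h \<alpha>)"
    using I_homotopy \<alpha> by (simp add: twisted_homotopy_def)
  from fun_cong[OF this, of h] show ?thesis
    using h t C.gdiff_closed[OF I_carrier[OF \<alpha>]] I_carrier[OF \<alpha>] C.M.minus_closed[OF t(2,1)]
    by (simp add: U.C_minus, simp add: U.C_fields U.W_apply orbit_def trivial_orbit_def)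
qed

text \<open>The homotopy identity: the derivative of the operation is the action that it was built from.\<close>

lemma hopf_der_I:
  assumes "h \<in> carrier U" "\<alpha> \<in> carrier \<Omega>"
  shows "hopf_der U \<Omega> I h \<alpha> = act h \<alpha>"
proof -
  have "hopf_der U \<Omega> I h \<alpha> = act h \<alpha> \<oplus> (gdiff \<Omega> (I h \<alpha>) \<oplus> \<ominus> gdiff \<Omega> (I h \<alpha>)) \<oplus>
      (counit U h \<odot> \<alpha> \<oplus> \<ominus> (counit U h \<odot> \<alpha>))"
    using assms by (simp add: hopf_der_def I_gdiff a_minus_def \<Omega>.M.a_ac del: \<Omega>.M.add.r_inv)
  then show ?thesis using assms by (simp add: \<Omega>.M.r_neg)
qed

lemma I_bilinear: "\<lbrakk>\<alpha> \<in> carrier \<Omega>; \<beta> \<in> carrier \<Omega>\<rbrakk> \<Longrightarrow>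
    bilinear_map K U \<Omega> (\<lambda>x y. I x \<alpha> \<otimes> act y \<beta>)"
  by (rule bilinear_map_mult[OF \<Omega>.gda_algebra I_linear_left act_linear_left])

lemmas I_simps = lin_map_add[OF I_linear] lin_map_smult[OF I_linear]
  lin_map_add[OF I_linear_left] lin_map_smult[OF I_linear_left]

text \<open>\<open>1\<close> acts as the identity, so the homotopy there is between equal maps and vanishes on generators.\<close>

lemma I_one:
  assumes "\<alpha> \<in> carrier \<Omega>"
  shows "I \<one>\<^bsub>U\<^esub> \<alpha> = \<zero>"
  using assms
proof (induction rule: \<Omega>_induct)
  case (diff n x)
  then have "x \<in> carrier \<Omega>" by simp
  then show ?case using diff by (simp add: I_gdiff act_one U.counit_simps a_minus_def \<Omega>.M.r_neg)
next
  case (mult m n x y)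
  then have "x \<in> carrier \<Omega>" "y \<in> carrier \<Omega>" by auto
  then show ?case
    using mult I_product[OF U.A.one_closed mult.hyps(1), of y]
      U.sweedler_one[OF I_bilinear \<Omega>.gda_module, of x y]
    by (simp add: sign_pow_def)
qed (simp_all add: I_simps I_degree_zero)

text \<open>Both sides are antiderivations that vanish on \<open>A\<close> and have the same Lie derivative.\<close>

lemma I_j:
  assumes X: "X \<in> carrier G" and \<alpha>: "\<alpha> \<in> carrier \<Omega>"
  shows "I (j X) \<alpha> = i X \<alpha>"
  using \<alpha>
proof (induction rule: \<Omega>_induct)
  case (diff n x)
  then have [simp]: "x \<in> carrier \<Omega>" by simp
  have "I (j X) (gdiff \<Omega> x) = i X (gdiff \<Omega> x) \<oplus> (gdiff \<Omega> (i X x) \<oplus> \<ominus> gdiff \<Omega> (i X x))"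
    using X diff by (simp add: I_gdiff act_j counit_j a_minus_def lie_der_def \<Omega>.M.a_assoc del: \<Omega>.M.add.r_inv)
  then show ?case using X by (simp add: \<Omega>.M.r_neg)
next
  case (mult m n x y)
  then have [simp]: "x \<in> carrier \<Omega>" "y \<in> carrier \<Omega>" by auto
  show ?case
    using X mult I_product[OF j_closed[OF X] mult.hyps(1), of y] i_leibniz[OF X mult.hyps(1), of y]
      U.sweedler_primitive[OF I_bilinear \<Omega>.gda_module j_primitive[OF X], of x y]
    by (simp add: act_one I_one)
qed (use X in \<open>simp_all add: I_simps I_degree_zero i_degree_zero lin_map_add[OF i_linear] lin_map_smult[OF i_linear]\<close>)

text \<open>Condition (ii) for an element \<open>X\<close> of the Lie algebra.  On exact elements it reduces to
  \<open>L\<^sub>g L\<^sub>X = L\<^sub>X L\<^sub>g + L\<^sub>[\<^sub>g\<^sub>,\<^sub>X\<^sub>]\<close>.  On products, \<open>L\<^sub>X\<close> is a derivation and \<open>[-, X]\<close> a coderivation, and the four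
  sums \<open>?Sa\<close> to \<open>?Sd\<close> arise on both sides, grouped by factor on the left and by operator on the right.  The
  induction needs all \<open>g\<close> at once, as the factors \<open>g\<^sup>(\<^sup>1\<^sup>)\<close> take its place.\<close>

lemma I_L:
  assumes X: "X \<in> carrier G" and \<alpha>: "\<alpha> \<in> carrier \<Omega>" and g: "g \<in> carrier U"
  shows "I g (L X \<alpha>) = L X (I g \<alpha>) \<oplus> I (g \<otimes>\<^bsub>U\<^esub> j X \<ominus>\<^bsub>U\<^esub> j X \<otimes>\<^bsub>U\<^esub> g) \<alpha>"
  using \<alpha> g
proof (induction arbitrary: g rule: \<Omega>_induct)
  case (add x y)
  then show ?case using X
    by (simp add: I_simps lin_map_add[OF L_linear] \<Omega>.M.a_ac)
next
  case (smult c x)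
  then show ?case using X
    by (simp add: I_simps lin_map_smult[OF L_linear] \<Omega>.smult_r_distr)
next
  case (base a)
  then show ?case using X
    by (simp add: I_degree_zero L_degree lin_map_zero[OF \<Omega>.gda_module \<Omega>.gda_module L_linear])
next
  case (diff n x)
  have [simp]: "x \<in> carrier \<Omega>" "X \<in> carrier G" "g \<in> carrier U" using diff X by auto
  let ?c = "g \<otimes>\<^bsub>U\<^esub> j X \<ominus>\<^bsub>U\<^esub> j X \<otimes>\<^bsub>U\<^esub> g"
  have c [simp]: "?c \<in> carrier U" by simp
  have \<epsilon>: "counit U ?c = \<zero>\<^bsub>K\<^esub>"
  proof -
    have "counit U ?c = counit U (g \<otimes>\<^bsub>U\<^esub> j X) \<oplus>\<^bsub>K\<^esub> counit U ((\<ominus>\<^bsub>K\<^esub> \<one>\<^bsub>K\<^esub>) \<odot>\<^bsub>U\<^esub> (j X \<otimes>\<^bsub>U\<^esub> g))"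
      unfolding a_minus_def
      by (subst U.counit_simps(1)) (simp_all add: uminus_eq_smult[OF U.H_module])
    then show ?thesis by (simp add: U.counit_simps U.counit_smult counit_j)
  qed
  have act_c: "act ?c x = act g (L X x) \<ominus> L X (act g x)"
    using lin_map_minus[OF U.H_module \<Omega>.gda_module act_linear_left[of x], of "g \<otimes>\<^bsub>U\<^esub> j X" "j X \<otimes>\<^bsub>U\<^esub> g"]
    by (simp add: act_mult act_j)
  note L_lin = lin_map_add[OF L_linear] lin_map_smult[OF L_linear]
    lin_map_uminus[OF \<Omega>.gda_module \<Omega>.gda_module L_linear]
  have "L X (I g (gdiff \<Omega> x)) \<oplus> I ?c (gdiff \<Omega> x) =
      (act g (L X x) \<ominus> counit U g \<odot> L X x) \<ominus> gdiff \<Omega> (L X (I g x) \<oplus> I ?c x) \<oplus>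
      (L X (act g x) \<oplus> \<ominus> L X (act g x))"
    by (simp add: I_gdiff \<epsilon> act_c L_lin L_gdiff \<Omega>.gdiff_add a_minus_def[of \<Omega>] \<Omega>.M.minus_add
        \<Omega>.M.a_ac del: \<Omega>.M.add.r_inv)
  also have "\<dots> = I g (L X (gdiff \<Omega> x))"
    using diff.IH[of g] by (simp add: \<Omega>.M.r_neg L_gdiff I_gdiff)
  finally show ?case by simp
next
  case (mult m n x y)
  have x: "x \<in> gcomp \<Omega> m" using mult by simp
  have [simp]: "x \<in> carrier \<Omega>" "y \<in> carrier \<Omega>" "X \<in> carrier G" "g \<in> carrier U" using mult X by auto
  let ?c = "\<lambda>g. g \<otimes>\<^bsub>U\<^esub> j X \<ominus>\<^bsub>U\<^esub> j X \<otimes>\<^bsub>U\<^esub> g"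
  have c [simp]: "?c h \<in> carrier U" if "h \<in> carrier U" for h using that by simp
  let ?S = "\<lambda>\<gamma>. tensor_sum \<Omega> \<gamma> (comult U g)"
  let ?s = "sign_pow \<Omega> m"
  note cl = U.comult_closed[OF \<open>g \<in> carrier U\<close>]
  note eqI = tensor_sum_eqI[OF cl] and S_add = \<Omega>.M.tensor_sum_add[OF cl]
    and S_closed = \<Omega>.M.tensor_sum_closed[OF cl]
  have s_add: "?s (u \<oplus> v) = ?s u \<oplus> ?s v" if "u \<in> carrier \<Omega>" "v \<in> carrier \<Omega>" for u v
    by (rule sign_pow_add[OF \<Omega>.gda_abelian_group that])
  have act_L: "act v (L X y) = L X (act v y) \<oplus> act (?c v) y" if v: "v \<in> carrier U" for v
  proof -
    have "act (?c v) y = act v (L X y) \<ominus> L X (act v y)"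
      using v lin_map_minus[OF U.H_module \<Omega>.gda_module act_linear_left[of y], of "v \<otimes>\<^bsub>U\<^esub> j X" "j X \<otimes>\<^bsub>U\<^esub> v"]
      by (simp add: act_mult act_j)
    then show ?thesis using v by (simp add: a_minus_def, subst \<Omega>.M.a_lcomm) (simp_all add: \<Omega>.M.r_neg)
  qed
  let ?Sa = "?S (\<lambda>u v. L X (I u x) \<otimes> act v y)" and ?Sb = "?S (\<lambda>u v. I (?c u) x \<otimes> act v y)"
  let ?Sc = "?S (\<lambda>u v. I u x \<otimes> L X (act v y))" and ?Sd = "?S (\<lambda>u v. I u x \<otimes> act (?c v) y)"
  have Sab: "?S (\<lambda>u v. I u (L X x) \<otimes> act v y) = ?Sa \<oplus> ?Sb"
    by (subst S_add[symmetric]) (auto intro!: eqI simp: mult.IH(1) \<Omega>.A.l_distr simp del: c intro: c)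
  have Scd: "?S (\<lambda>u v. I u x \<otimes> act v (L X y)) = ?Sc \<oplus> ?Sd"
    by (subst S_add[symmetric]) (auto intro!: eqI simp: act_L \<Omega>.A.r_distr)
  have Sac: "L X (?S (\<lambda>u v. I u x \<otimes> act v y)) = ?Sa \<oplus> ?Sc"
    by (subst S_add[symmetric], simp, simp, subst tensor_sum_lin_map[OF \<Omega>.gda_module \<Omega>.gda_module
        L_linear[OF X] cl]) (auto intro!: eqI simp: L_leibniz)
  have Sbd: "tensor_sum \<Omega> (\<lambda>u v. I u x \<otimes> act v y) (comult U (?c g)) = ?Sb \<oplus> ?Sd"
    by (rule U.sweedler_commutator[OF I_bilinear \<Omega>.gda_module _ j_primitive]) simp_all
  have closed: "?Sa \<in> carrier \<Omega>" "?Sb \<in> carrier \<Omega>" "?Sc \<in> carrier \<Omega>" "?Sd \<in> carrier \<Omega>"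
    "?S (\<lambda>u v. I u x \<otimes> act v y) \<in> carrier \<Omega>"
    by (auto intro!: S_closed)
  have "I g (L X (x \<otimes> y)) = I g (L X x \<otimes> y) \<oplus> I g (x \<otimes> L X y)"
    by (simp add: L_leibniz I_simps)
  also have "\<dots> = (?Sa \<oplus> ?Sb \<oplus> ?s (L X x \<otimes> I g y)) \<oplus>
      (?Sc \<oplus> ?Sd \<oplus> (?s (x \<otimes> L X (I g y)) \<oplus> ?s (x \<otimes> I (?c g) y)))"
    using mult.IH(2)[of g]
    by (simp add: I_product[OF _ x] I_product[OF _ L_degree[OF X x]] Sab Scd \<Omega>.A.r_distr s_add)
  also have "\<dots> = (?Sa \<oplus> ?Sc \<oplus> (?s (L X x \<otimes> I g y) \<oplus> ?s (x \<otimes> L X (I g y)))) \<oplus>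
      (?Sb \<oplus> ?Sd \<oplus> ?s (x \<otimes> I (?c g) y))"
    using closed by (simp add: \<Omega>.M.a_ac)
  also have "\<dots> = L X (I g (x \<otimes> y)) \<oplus> I (?c g) (x \<otimes> y)"
    using closed
    by (simp add: I_product[OF _ x] Sbd Sac lin_map_add[OF L_linear] L_leibniz s_add
        lin_map_sign_pow[OF \<Omega>.gda_module \<Omega>.gda_module L_linear])
  finally show ?case .
qed

lemma adjoint_closed [simp]:
  "\<lbrakk>h \<in> carrier U; g \<in> carrier U\<rbrakk> \<Longrightarrow> right_adjoint U h g \<in> carrier U"
  by (rule lin_map_closed[OF U.right_adjoint_linear])

lemma act_I_bilinear:
  assumes g: "g \<in> carrier U" and \<alpha>: "\<alpha> \<in> carrier \<Omega>"
  shows "bilinear_map K U \<Omega> (\<lambda>x y. act x (I (right_adjoint U y g) \<alpha>))"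
  unfolding bilinear_map_def
proof (intro conjI ballI)
  fix z assume z: "z \<in> carrier U"
  show "lin_map K U \<Omega> (\<lambda>x. act x (I (right_adjoint U z g) \<alpha>))"
    using z g \<alpha> by (intro act_linear_left) simp
  show "lin_map K U \<Omega> (\<lambda>y. act z (I (right_adjoint U y g) \<alpha>))"
    by (rule lin_map_comp[OF lin_map_comp[OF U.right_adjoint_linear[OF g] I_linear_left[OF \<alpha>]] act_linear[OF z]])
qed

text \<open>Condition (ii), by induction on \<open>h\<close>: if it holds for \<open>h\<close>, then for \<open>hX\<close> one moves \<open>L\<^sub>X\<close> past \<open>i\<^sub>g\<close> with
  \<open>g\<close> replaced by \<open>ad(h\<^sup>(\<^sup>2\<^sup>)) g\<close>, and the resulting two sums are the two terms of \<open>\<Delta>(hX)\<close>.\<close>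

lemma I_act:
  assumes h: "h \<in> carrier U" and g: "g \<in> carrier U" and \<alpha>: "\<alpha> \<in> carrier \<Omega>"
  shows "I g (act h \<alpha>) = tensor_sum \<Omega> (\<lambda>x y. act x (I (right_adjoint U y g) \<alpha>)) (comult U h)"
  using h \<alpha>
proof (induction arbitrary: \<alpha> rule: U_induct)
  case one
  then show ?case
    using U.sweedler_one[OF act_I_bilinear[OF g] \<Omega>.gda_module] g
    by (simp add: act_one U.right_adjoint_one)
next
  case (add h h')
  then show ?case
    using lin_map_add[OF U.sweedler_linear[OF act_I_bilinear[OF g] \<Omega>.gda_module]] g
    by (simp add: act_simps I_simps)
next
  case (smult c h)
  then show ?case
    using lin_map_smult[OF U.sweedler_linear[OF act_I_bilinear[OF g] \<Omega>.gda_module]] g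
    by (simp add: act_simps I_simps)
next
  case (mult h X)
  note cl = U.comult_closed[OF mult.hyps(1)]
  have [simp]: "X \<in> carrier G" "\<alpha> \<in> carrier \<Omega>" "h \<in> carrier U" using mult by auto
  have "I g (act (h \<otimes>\<^bsub>U\<^esub> j X) \<alpha>) = I g (act h (L X \<alpha>))" by (simp add: act_simps)
  also have "\<dots> = tensor_sum \<Omega> (\<lambda>x y. act x (I (right_adjoint U y g) (L X \<alpha>))) (comult U h)"
    by (rule mult.IH) simp
  also have "\<dots> = tensor_sum \<Omega> (\<lambda>x y. act (x \<otimes>\<^bsub>U\<^esub> j X) (I (right_adjoint U y g) \<alpha>) \<oplus>
      act x (I (right_adjoint U (y \<otimes>\<^bsub>U\<^esub> j X) g) \<alpha>)) (comult U h)"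
    by (rule tensor_sum_eqI[OF cl])
      (simp add: g I_L act_simps U.right_adjoint_mult_primitive[OF j_primitive])
  also have "\<dots> = tensor_sum \<Omega> (\<lambda>x y. act (x \<otimes>\<^bsub>U\<^esub> j X) (I (right_adjoint U y g) \<alpha>)) (comult U h) \<oplus>
      tensor_sum \<Omega> (\<lambda>x y. act x (I (right_adjoint U (y \<otimes>\<^bsub>U\<^esub> j X) g) \<alpha>)) (comult U h)"
    by (rule \<Omega>.M.tensor_sum_add[OF cl]) (simp_all add: g)
  also have "\<dots> = tensor_sum \<Omega> (\<lambda>x y. act x (I (right_adjoint U y g) \<alpha>)) (comult U (h \<otimes>\<^bsub>U\<^esub> j X))"
    by (rule U.sweedler_mult_primitive[OF act_I_bilinear[OF g] \<Omega>.gda_module _ j_primitive, symmetric])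
      simp_all
  finally show ?case .
qed

lemma hopf_operation_I: "hopf_operation K U \<Omega> I"
  unfolding hopf_operation_def
proof (intro conjI ballI allI)
  show "lin_map K \<Omega> \<Omega> (I h)" if "h \<in> carrier U" for h by (rule I_linear[OF that])
  show "degree_minus_one \<Omega> (I h)" if "h \<in> carrier U" for h
    using that by (auto simp: degree_minus_one_def I_degree_zero I_degree_Suc)
  show "lin_map K U \<Omega> (\<lambda>h. I h \<alpha>)" if "\<alpha> \<in> carrier \<Omega>" for \<alpha> by (rule I_linear_left[OF that])
  show "I \<one>\<^bsub>U\<^esub> \<alpha> = \<zero>" if "\<alpha> \<in> carrier \<Omega>" for \<alpha> by (rule I_one[OF that])
  show "I h (\<alpha> \<otimes> \<beta>) =
      tensor_sum \<Omega> (\<lambda>x y. I x \<alpha> \<otimes> hopf_der U \<Omega> I y \<beta>) (comult U h)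
      \<oplus> sign_pow \<Omega> n (\<alpha> \<otimes> I h \<beta>)"
    if "h \<in> carrier U" "\<alpha> \<in> gcomp \<Omega> n" "\<beta> \<in> carrier \<Omega>" for h n \<alpha> \<beta>
    unfolding I_product[OF that]
    by (intro arg_cong2[where f = "add \<Omega>"] tensor_sum_eqI[OF U.comult_closed[OF that(1)]] refl)
      (simp add: hopf_der_I that)
  show "I g (hopf_der U \<Omega> I h \<alpha>) =
      tensor_sum \<Omega> (\<lambda>x y. hopf_der U \<Omega> I x (I (right_adjoint U y g) \<alpha>)) (comult U h)"
    if "g \<in> carrier U" "h \<in> carrier U" "\<alpha> \<in> carrier \<Omega>" for g h \<alpha>
    unfolding hopf_der_I[OF that(2,3)] I_act[OF that(2,1,3)]
    by (rule tensor_sum_eqI[OF U.comult_closed[OF that(2)]]) (simp add: hopf_der_I that)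
  show "hopf_der U \<Omega> I h (hopf_der U \<Omega> I g \<alpha>) = hopf_der U \<Omega> I (h \<otimes>\<^bsub>U\<^esub> g) \<alpha>"
    if "g \<in> carrier U" "h \<in> carrier U" "\<alpha> \<in> carrier \<Omega>" for g h \<alpha>
    using that by (simp add: hopf_der_I act_mult)
qed

text \<open>First \<open>L\<^sub>h\<close> is determined, since it is multiplicative and given on the Lie algebra; then \<open>I'\<close> and
  \<open>I\<close> agree on \<open>A\<close>, and agreement persists under \<open>d\<close> and products, where only \<open>I'\<close> on the factors and
  \<open>L\<^sub>h\<close> enter.\<close>

lemma hopf_operation_unique:
  assumes op': "hopf_operation K U \<Omega> I'" and ext: "extends_operation G \<Omega> j i I'"
    and h: "h \<in> carrier U" and \<alpha>: "\<alpha> \<in> carrier \<Omega>"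
  shows "I' h \<alpha> = I h \<alpha>"
proof -
  have lin: "lin_map K \<Omega> \<Omega> (I' h)" and deg: "\<And>\<alpha>. \<alpha> \<in> gcomp \<Omega> 0 \<Longrightarrow> I' h \<alpha> = \<zero>" if "h \<in> carrier U" for h
    using op' that unfolding hopf_operation_def degree_minus_one_def by blast+
  have lin_left: "lin_map K U \<Omega> (\<lambda>h. I' h \<alpha>)" if "\<alpha> \<in> carrier \<Omega>" for \<alpha>
    using op' that by (simp add: hopf_operation_def)
  have unit: "I' \<one>\<^bsub>U\<^esub> \<alpha> = \<zero>" if "\<alpha> \<in> carrier \<Omega>" for \<alpha>
    using op' that by (simp add: hopf_operation_def)
  have product: "I' h (\<alpha> \<otimes> \<beta>) =
      tensor_sum \<Omega> (\<lambda>x y. I' x \<alpha> \<otimes> hopf_der U \<Omega> I' y \<beta>) (comult U h)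
      \<oplus> sign_pow \<Omega> n (\<alpha> \<otimes> I' h \<beta>)"
    if "h \<in> carrier U" "\<alpha> \<in> gcomp \<Omega> n" "\<beta> \<in> carrier \<Omega>" for h n \<alpha> \<beta>
    using op' that unfolding hopf_operation_def by blast
  have der_mult: "hopf_der U \<Omega> I' (h \<otimes>\<^bsub>U\<^esub> g) \<alpha> = hopf_der U \<Omega> I' h (hopf_der U \<Omega> I' g \<alpha>)"
    if "g \<in> carrier U" "h \<in> carrier U" "\<alpha> \<in> carrier \<Omega>" for g h \<alpha>
    using op' that by (simp add: hopf_operation_def)
  have j: "I' (j X) \<alpha> = i X \<alpha>" if "X \<in> carrier G" "\<alpha> \<in> carrier \<Omega>" for X \<alpha>
    using ext that by (simp add: extends_operation_def)
  have closed [simp]: "I' h \<alpha> \<in> carrier \<Omega>" if "h \<in> carrier U" "\<alpha> \<in> carrier \<Omega>" for h \<alpha>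
    by (rule lin_map_closed[OF lin[OF that(1)] that(2)])
  have der: "hopf_der U \<Omega> I' h \<alpha> = act h \<alpha>" if "h \<in> carrier U" "\<alpha> \<in> carrier \<Omega>" for h \<alpha>
    using that
  proof (induction arbitrary: \<alpha> rule: U_induct)
    case one
    then show ?case by (simp add: hopf_der_def unit act_one U.counit_simps)
  next
    case (add g h)
    have "hopf_der U \<Omega> I' (g \<oplus>\<^bsub>U\<^esub> h) \<alpha> = hopf_der U \<Omega> I' g \<alpha> \<oplus> hopf_der U \<Omega> I' h \<alpha>"
      using add.hyps(1,2) add.prems by (simp add: hopf_der_def lin_map_add[OF lin_left] U.counit_simps \<Omega>.gdiff_add
          \<Omega>.smult_l_distr \<Omega>.M.a_ac)
    then show ?case using add by (simp add: act_simps)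
  next
    case (smult c h)
    have "hopf_der U \<Omega> I' (c \<odot>\<^bsub>U\<^esub> h) \<alpha> = c \<odot> hopf_der U \<Omega> I' h \<alpha>"
      using smult.hyps(1,2) smult.prems by (simp add: hopf_der_def lin_map_smult[OF lin_left] U.counit_smult \<Omega>.gdiff_smult
          \<Omega>.smult_r_distr \<Omega>.smult_assoc1)
    then show ?case using smult by (simp add: act_simps)
  next
    case (mult h X)
    have "hopf_der U \<Omega> I' (j X) \<alpha> = L X \<alpha>"
      using mult.hyps mult.prems by (simp add: hopf_der_def lie_der_def j counit_j \<Omega>.M.a_comm)
    then show ?case using mult by (simp add: der_mult act_simps)
  qed
  show ?thesis
    using \<alpha> h
  proof (induction arbitrary: h rule: \<Omega>_induct)
    case (add x y)
    then show ?case by (simp add: I_simps lin_map_add[OF lin])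
  next
    case (smult c x)
    then show ?case by (simp add: I_simps lin_map_smult[OF lin])
  next
    case (base a)
    then show ?case by (simp add: deg I_degree_zero)
  next
    case (diff n x)
    then have x: "x \<in> carrier \<Omega>" by simp
    have "hopf_der U \<Omega> I' h x = hopf_der U \<Omega> I h x"
      using diff x by (simp add: der hopf_der_I)
    then show ?case using diff x by (simp add: hopf_der_def)
  next
    case (mult m n x y)
    then have [simp]: "x \<in> carrier \<Omega>" "y \<in> carrier \<Omega>" by auto
    have "tensor_sum \<Omega> (\<lambda>u v. I' u x \<otimes> hopf_der U \<Omega> I' v y) (comult U h) =
        tensor_sum \<Omega> (\<lambda>u v. I u x \<otimes> act v y) (comult U h)"
      by (rule tensor_sum_eqI[OF U.comult_closed[OF mult.prems]]) (simp add: mult.IH der)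
    then show ?case
      using mult product[OF mult.prems mult.hyps(1), of y] I_product[OF mult.prems mult.hyps(1), of y]
      by simp
  qed
qed

end

theorem proposition4:
  fixes K :: "'k ring"
    and G :: "('k, 'g) lie_alg"
    and A :: "('k, 'a) module"
    and \<Omega> :: "('k, 'w) gda" and \<iota> :: "'a \<Rightarrow> 'w"
    and U :: "('k, 'u) hopf" and j :: "'g \<Rightarrow> 'u"
    and i :: "'g \<Rightarrow> 'w \<Rightarrow> 'w"
  assumes "lie_algebra K G" and "finite_dim K G"
    and "differential_envelope TYPE(('u, 'w) universe) K A \<Omega> \<iota>"
    and "enveloping_hopf_algebra TYPE(('u, 'w) universe) K G U j"
    and "lie_operation K G \<Omega> i"
  shows "\<exists>I. hopf_operation K U \<Omega> I \<and> extends_operation G \<Omega> j i I \<and>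
           (\<forall>I'. hopf_operation K U \<Omega> I' \<and> extends_operation G \<Omega> j i I' \<longrightarrow>
                 (\<forall>h\<in>carrier U. \<forall>\<alpha>\<in>carrier \<Omega>. I' h \<alpha> = I h \<alpha>))"
proof -
  interpret lie_algebra K G by (rule assms(1))
  interpret \<Omega>: graded_diff_algebra K \<Omega> by (rule envelope_gda[OF assms(3)])
  interpret U: hopf_algebra K U using assms(4) by (simp add: enveloping_hopf_algebra_def)
  interpret envelope_operation K G \<Omega> i U A \<iota> j
    by unfold_locales (rule assms)+
  show ?thesis
  proof (intro exI conjI allI impI ballI)
    show "hopf_operation K U \<Omega> I" by (rule hopf_operation_I)
    show "extends_operation G \<Omega> j i I" by (simp add: extends_operation_def I_j)
    show "I' h \<alpha> = I h \<alpha>"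
      if "hopf_operation K U \<Omega> I' \<and> extends_operation G \<Omega> j i I'" "h \<in> carrier U" "\<alpha> \<in> carrier \<Omega>"
      for I' h \<alpha>
      using that by (intro hopf_operation_unique) auto
  qed
qed

end
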